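(* Let $m \geq 3$ and $r \geq 1$ be integers and let $0 < k_1 < \cdots < k_r$ be integers. The diagonal action of $\mathbb{P}GL((m-1)k_r)$ on $F(k_1, \dots, k_r; (m-1)k_r)^m$ is dense if and only if the diagonal action of $\mathbb{P}GL(k_r)$ on $F(k_1, \dots, k_{r-1}; k_r)^m$ is dense.
   Context: Work over an algebraically closed field. For integers $0 < k_1 < \cdots < k_r < n$ and an $n$-dimensional vector space $V$, $F(k_1, \dots, k_r; n)$ denotes the partial flag variety parameterizing flags $W_{k_1} \subset \cdots \subset W_{k_r} \subset V$ of linear subspaces with $\dim W_{k_i} = k_i$. When the list of dimensions is empty (the case $r=1$ on the right-hand side), the flag variety is a single point. The group $\mathbb{P}GL(n) = \mathbb{P}GL(V)$ acts on $F(k_1,\dots,k_r;n)$ and hence diagonally on the $m$-fold self-product $F(k_1,\dots,k_r;n)^m$. The action is called dense if it has a (Zariski) dense orbit. *)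

theory Defs
  imports
    "HOL-Algebra.Group_Action"
    "Jordan_Normal_Form.VS_Connect"
begin

section \<open>Flag varieties over an algebraically closed field\<close>

text \<open>
  We take \<open>V = K\<^sup>n\<close> (as \<open>carrier_vec n\<close>). A flag with dimension list \<open>ks\<close> is the list
  of its subspaces; for \<open>ks = []\<close> the flag variety is the single point \<open>[]\<close>.
\<close>

definition subspaces :: "'a::field itself \<Rightarrow> nat \<Rightarrow> nat \<Rightarrow> 'a vec set set" where
  "subspaces ty n k =
     {W. VectorSpace.subspace class_ring W (module_vec ty n) \<and>
         vectorspace.dim class_ring ((module_vec ty n) \<lparr>carrier := W\<rparr>) = k}"

definition flags :: "'a::field itself \<Rightarrow> nat list \<Rightarrow> nat \<Rightarrow> 'a vec set list set" where
  "flags ty ks n =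
     {Ws. length Ws = length ks \<and>
          (\<forall>i<length ks. Ws ! i \<in> subspaces ty n (ks ! i)) \<and>
          (\<forall>i. Suc i < length ks \<longrightarrow> Ws ! i \<subseteq> Ws ! Suc i)}"

definition flag_tuples ::
  "'a::field itself \<Rightarrow> nat \<Rightarrow> nat list \<Rightarrow> nat \<Rightarrow> 'a vec set list list set" where
  "flag_tuples ty m ks n = {xs. length xs = m \<and> set xs \<subseteq> flags ty ks n}"

section \<open>Zariski topology on products of flag varieties\<close>

text \<open>
  The \<open>m\<close>-fold product of \<open>F(k\<^sub>1, \<dots>, k\<^sub>r; n)\<close> is a subvariety of a product of projective
  spaces via the Pluecker embedding of each of its \<open>m \<cdot> r\<close> Grassmannian components.
\<close>

text \<open>The columns of \<open>B\<close> form a basis of the \<open>k\<close>-dimensional subspace \<open>W\<close>.\<close>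

definition is_frame :: "nat \<Rightarrow> nat \<Rightarrow> 'a::field vec set \<Rightarrow> 'a mat \<Rightarrow> bool" where
  "is_frame n k W B \<longleftrightarrow>
     B \<in> carrier_mat n k \<and> bij_betw (\<lambda>v. B *\<^sub>v v) (carrier_vec k) W"

text \<open>
  The Pluecker coordinate \<open>p\<^bsub>\<alpha>\<^esub>\<close> is the minor of \<open>B\<close> on the rows \<open>\<alpha>\<close>. We allow arbitrary
  sequences \<open>\<alpha>\<close> of \<open>k\<close> rows (counted from 0), not only increasing ones: the additional
  coordinates are \<open>0\<close> or \<open>\<plusminus>\<close> one of the latter.
\<close>

definition pluecker :: "nat \<Rightarrow> nat \<Rightarrow> 'a::field mat \<Rightarrow> nat list \<Rightarrow> 'a" where
  "pluecker n k B \<alpha> =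
     (if length \<alpha> = k \<and> set \<alpha> \<subseteq> {..<n} then det (mat k k (\<lambda>(a, b). B $$ (\<alpha> ! a, b))) else 0)"

text \<open>
  Coordinate \<open>(j, i, \<alpha>)\<close> is the coordinate \<open>p\<^bsub>\<alpha>\<^esub>\<close> of the \<open>i\<close>-th subspace of the \<open>j\<close>-th flag.
  The bases of the individual subspaces are chosen independently, so the set below
  consists of all systems of homogeneous coordinates of the point \<open>xs\<close>, i.e. every projective
  factor may be rescaled by a nonzero scalar of its own.
\<close>

definition homogeneous_coords ::
  "nat list \<Rightarrow> nat \<Rightarrow> 'a::field vec set list list \<Rightarrow> (nat \<times> nat \<times> nat list \<Rightarrow> 'a) set" where
  "homogeneous_coords ks n xs =
     {p. \<exists>B. (\<forall>j<length xs. \<forall>i<length ks. is_frame n (ks ! i) (xs ! j ! i) (B j i)) \<and>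
             p = (\<lambda>(j, i, \<alpha>). if j < length xs \<and> i < length ks
                               then pluecker n (ks ! i) (B j i) \<alpha> else 0)}"

inductive_set polynomial_functions :: "(('i \<Rightarrow> 'a::comm_ring_1) \<Rightarrow> 'a) set" where
  const: "(\<lambda>p. c) \<in> polynomial_functions"
| coord: "(\<lambda>p. p i) \<in> polynomial_functions"
| add: "f \<in> polynomial_functions \<Longrightarrow> g \<in> polynomial_functions
    \<Longrightarrow> (\<lambda>p. f p + g p) \<in> polynomial_functions"
| mult: "f \<in> polynomial_functions \<Longrightarrow> g \<in> polynomial_functions
    \<Longrightarrow> (\<lambda>p. f p * g p) \<in> polynomial_functions"

text \<open>
  A polynomial vanishes at a point of a product of projective spaces if it vanishes at all its
  systems of homogeneous coordinates. As the field is infinite, this holds iff all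
  multihomogeneous components vanish, so these are the common zero sets of
  multihomogeneous polynomials.
\<close>

definition zariski_closed ::
  "'a::field itself \<Rightarrow> nat \<Rightarrow> nat list \<Rightarrow> nat \<Rightarrow> 'a vec set list list set \<Rightarrow> bool" where
  "zariski_closed ty m ks n Z \<longleftrightarrow>
     (\<exists>T \<subseteq> polynomial_functions.
        Z = {xs \<in> flag_tuples ty m ks n. \<forall>f\<in>T. \<forall>p\<in>homogeneous_coords ks n xs. f p = 0})"

definition zariski_dense ::
  "'a::field itself \<Rightarrow> nat \<Rightarrow> nat list \<Rightarrow> nat \<Rightarrow> 'a vec set list list set \<Rightarrow> bool" where
  "zariski_dense ty m ks n S \<longleftrightarrow>
     S \<subseteq> flag_tuples ty m ks n \<and>
     (\<forall>Z. zariski_closed ty m ks n Z \<and> S \<subseteq> Z \<longrightarrow> Z = flag_tuples ty m ks n)"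

section \<open>The projective linear group and its diagonal action\<close>

definition GL :: "'a::field itself \<Rightarrow> nat \<Rightarrow> 'a mat monoid" where
  "GL ty n = units_of (ring_mat ty n ())"

definition scalar_mats :: "'a::field itself \<Rightarrow> nat \<Rightarrow> 'a mat set" where
  "scalar_mats ty n = {c \<cdot>\<^sub>m 1\<^sub>m n | c. c \<noteq> 0}"

definition PGL :: "'a::field itself \<Rightarrow> nat \<Rightarrow> 'a mat set monoid" where
  "PGL ty n = GL ty n Mod scalar_mats ty n"

definition mat_act :: "'a::field mat \<Rightarrow> 'a vec set list list \<Rightarrow> 'a vec set list list" where
  "mat_act g xs = map (map (\<lambda>W. (\<lambda>v. g *\<^sub>v v) ` W)) xs"

text \<open>The choice of the representative is irrelevant, see \<open>PGL_act_eq\<close> below.\<close>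

definition PGL_act :: "'a::field mat set \<Rightarrow> 'a vec set list list \<Rightarrow> 'a vec set list list" where
  "PGL_act C xs = mat_act (SOME g. g \<in> C) xs"

definition dense_PGL_action :: "'a::field itself \<Rightarrow> nat \<Rightarrow> nat list \<Rightarrow> nat \<Rightarrow> bool" where
  "dense_PGL_action ty m ks n \<longleftrightarrow>
     (\<exists>x \<in> flag_tuples ty m ks n. zariski_dense ty m ks n (orbit (PGL ty n) PGL_act x))"

subsection \<open>Well-definedness\<close>

lemma group_GL: "group (GL TYPE('a::field) n)"
proof -
  interpret ring "ring_mat TYPE('a) n ()" by (rule ring_mat)
  show ?thesis unfolding GL_def by (rule units_group)
qed

lemma GL_carrier:
  "g \<in> carrier (GL TYPE('a::field) n) \<longleftrightarrow>
     g \<in> carrier_mat n n \<and> (\<exists>h \<in> carrier_mat n n. h * g = 1\<^sub>m n \<and> g * h = 1\<^sub>m n)"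
  by (auto simp: GL_def units_of_def Units_def ring_mat_def)

lemma GL_mult [simp]: "mult (GL TYPE('a::field) n) = (*)"
  and GL_one [simp]: "one (GL TYPE('a::field) n) = 1\<^sub>m n"
  by (auto simp: GL_def units_of_def ring_mat_def)

lemma scalar_mult:
  assumes "(g::'a::field mat) \<in> carrier_mat n n"
  shows "(c \<cdot>\<^sub>m 1\<^sub>m n) * g = c \<cdot>\<^sub>m g" "g * (c \<cdot>\<^sub>m 1\<^sub>m n) = c \<cdot>\<^sub>m g"
  using assms by (simp_all add: mult_smult_distrib[of _ n n _ n] mult_smult_assoc_mat[of _ n n _ n])

lemma scalar_mats_GL: "scalar_mats TYPE('a::field) n \<subseteq> carrier (GL TYPE('a) n)"
proof
  fix s assume "s \<in> scalar_mats TYPE('a) n"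
  then obtain c :: 'a where c: "c \<noteq> 0" "s = c \<cdot>\<^sub>m 1\<^sub>m n" by (auto simp: scalar_mats_def)
  have "(inverse c \<cdot>\<^sub>m 1\<^sub>m n) * s = 1\<^sub>m n" "s * (inverse c \<cdot>\<^sub>m 1\<^sub>m n) = 1\<^sub>m n"
    using c by (auto simp: scalar_mult)
  then show "s \<in> carrier (GL TYPE('a) n)"
    unfolding GL_carrier using c by (auto intro!: bexI[of _ "inverse c \<cdot>\<^sub>m 1\<^sub>m n"])
qed

lemma scalar_mats_normal: "scalar_mats TYPE('a::field) n \<lhd> GL TYPE('a) n"
proof -
  interpret group "GL TYPE('a) n" by (rule group_GL)
  have sub: "subgroup (scalar_mats TYPE('a) n) (GL TYPE('a) n)"
  proof (rule subgroupI)
    show "scalar_mats TYPE('a) n \<subseteq> carrier (GL TYPE('a) n)" by (rule scalar_mats_GL)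
    show "scalar_mats TYPE('a) n \<noteq> {}" by (auto simp: scalar_mats_def intro: exI[of _ 1])
  next
    fix s assume s: "s \<in> scalar_mats TYPE('a) n"
    then obtain c :: 'a where c: "c \<noteq> 0" "s = c \<cdot>\<^sub>m 1\<^sub>m n" by (auto simp: scalar_mats_def)
    have t: "inverse c \<cdot>\<^sub>m 1\<^sub>m n \<in> scalar_mats TYPE('a) n"
      using c by (auto simp: scalar_mats_def)
    have "(inverse c \<cdot>\<^sub>m 1\<^sub>m n) * s = 1\<^sub>m n" using c by (auto simp: scalar_mult)
    then have "inv\<^bsub>GL TYPE('a) n\<^esub> s = inverse c \<cdot>\<^sub>m 1\<^sub>m n"
      using s t scalar_mats_GL by (intro inv_equality) auto
    with t show "inv\<^bsub>GL TYPE('a) n\<^esub> s \<in> scalar_mats TYPE('a) n" by simp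
  next
    fix s t assume "s \<in> scalar_mats TYPE('a) n" "t \<in> scalar_mats TYPE('a) n"
    then obtain c d :: 'a where
      "c \<noteq> 0" "s = c \<cdot>\<^sub>m 1\<^sub>m n" "d \<noteq> 0" "t = d \<cdot>\<^sub>m 1\<^sub>m n"
      by (auto simp: scalar_mats_def)
    then have "s * t = (c * d) \<cdot>\<^sub>m 1\<^sub>m n" "c * d \<noteq> 0" by (auto simp: scalar_mult)
    then show "s \<otimes>\<^bsub>GL TYPE('a) n\<^esub> t \<in> scalar_mats TYPE('a) n"
      by (auto simp: scalar_mats_def)
  qed
  show ?thesis
  proof (rule normalI[OF sub], intro ballI)
    fix g assume "g \<in> carrier (GL TYPE('a) n)"
    then have g: "g \<in> carrier_mat n n" by (auto simp: GL_carrier)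
    show "scalar_mats TYPE('a) n #>\<^bsub>GL TYPE('a) n\<^esub> g = g <#\<^bsub>GL TYPE('a) n\<^esub> scalar_mats TYPE('a) n"
      by (auto simp: r_coset_def l_coset_def scalar_mats_def scalar_mult[OF g])
  qed
qed

lemma group_PGL: "group (PGL TYPE('a::field) n)"
  unfolding PGL_def by (rule normal.factorgroup_is_group[OF scalar_mats_normal])

lemma smult_image_subspace:
  assumes W: "W \<in> subspaces TYPE('a::field) n k" and c: "c \<noteq> 0"
  shows "(\<lambda>v. c \<cdot>\<^sub>v v) ` W = W"
proof -
  have cl: "d \<cdot>\<^sub>v v \<in> W" if "v \<in> W" for d v
    using W that by (auto simp: subspaces_def VectorSpace.subspace_def submodule_def module_vec_simps)
  have "v \<in> (\<lambda>v. c \<cdot>\<^sub>v v) ` W" if "v \<in> W" for v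
    using c cl[OF that, of "inverse c"]
    by (intro image_eqI[of _ _ "inverse c \<cdot>\<^sub>v v"]) (auto simp: smult_smult_assoc)
  with cl show ?thesis by auto
qed

lemma PGL_act_eq:
  assumes C: "C \<in> carrier (PGL TYPE('a::field) n)" and g: "g \<in> C"
    and xs: "xs \<in> flag_tuples TYPE('a) m ks n"
  shows "PGL_act C xs = mat_act g xs"
proof -
  obtain h where h: "h \<in> carrier (GL TYPE('a) n)" and
      "C = scalar_mats TYPE('a) n #>\<^bsub>GL TYPE('a) n\<^esub> h"
    using C by (auto simp: PGL_def FactGroup_def RCOSETS_def)
  moreover from h have hc: "h \<in> carrier_mat n n" by (auto simp: GL_carrier)
  ultimately have Ch: "C = {c \<cdot>\<^sub>m h | c. c \<noteq> 0}"
    by (auto simp: r_coset_def scalar_mats_def scalar_mult[OF hc])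
  have *: "mat_act g' xs = mat_act h xs" if g': "g' \<in> C" for g'
  proof -
    obtain c where c: "c \<noteq> 0" "g' = c \<cdot>\<^sub>m h" using g' Ch by auto
    have "(\<lambda>v. g' *\<^sub>v v) ` W = (\<lambda>v. h *\<^sub>v v) ` W" if W: "W \<in> subspaces TYPE('a) n k" for W k
    proof -
      have Wn: "W \<subseteq> carrier_vec n"
        using W by (auto simp: subspaces_def VectorSpace.subspace_def submodule_def module_vec_simps)
      have "(\<lambda>v. g' *\<^sub>v v) ` W = (\<lambda>v. h *\<^sub>v v) ` (\<lambda>v. c \<cdot>\<^sub>v v) ` W"
        unfolding image_image c
      proof (rule image_cong[OF refl])
        fix v assume "v \<in> W"
        with Wn have v: "v \<in> carrier_vec n" by auto
        show "(c \<cdot>\<^sub>m h) *\<^sub>v v = h *\<^sub>v (c \<cdot>\<^sub>v v)"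
          using hc v by (intro eq_vecI) auto
      qed
      then show ?thesis using smult_image_subspace[OF W c(1)] by simp
    qed
    moreover have "\<exists>k. W \<in> subspaces TYPE('a) n k" if "x \<in> set xs" "W \<in> set x" for x W
    proof -
      have "x \<in> flags TYPE('a) ks n" using xs that by (auto simp: flag_tuples_def)
      then show ?thesis using that(2) by (auto simp: flags_def in_set_conv_nth)
    qed
    ultimately show ?thesis unfolding mat_act_def by (intro map_cong refl) metis
  qed
  have "(SOME g. g \<in> C) \<in> C" using g by (rule someI)
  from *[OF this] *[OF g] show ?thesis by (simp add: PGL_act_def)
qed

end

(*
  Choose a basis adapted to each flag: an m-tuple of flags becomes an m-tuple of matrices, defined up
  to right multiplication by block upper triangular matrices, and density of an orbit means that a
  polynomial in the entries vanishing on all these matrices is zero. (Polynomials are transported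
  between matrix entries and Pluecker coordinates by the big cell, whose coordinates are ratios of
  Pluecker coordinates.) If W_1, ..., W_m are K-dimensional and in general position in a space of
  dimension (m - 1) K, then W_1, ..., W_(m-1) are independent and W_m is the graph of isomorphisms
  between them. Hence all W_j are identified with one K-dimensional space, the stabiliser of
  (W_1, ..., W_m) is GL(K) acting diagonally, and only the smaller flags inside the W_j remain.
*)

theory Submission
  imports Defs
begin

section \<open>Polynomial and regular functions\<close>

text \<open>Density is tested with homogeneous coordinates of flags, while general position is
  visible on matrices, and the passage between them is rational, defined only on an open set. No
  topologies are compared. Each implication takes a polynomial f vanishing on the target orbit and
  one fixed target point, and builds a polynomial or rational map from the source space that sends
  the source orbit into the target orbit where it is defined and hits the fixed point exactly; the
  constants of the map are read off from that point. The pullback of f vanishes on a dense set,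
  hence at the fixed point. Where only points with d \<noteq> 0 are reached, f * d = 0 gives f = 0,
  because polynomial functions over an infinite field have no zero divisors; algebraic closedness
  enters by making the field infinite. Both flag varieties are presented by matrices with the same
  number k_r of columns modulo the same parabolic group: in dimension k_r the largest subspace is
  the whole space. The theorem thus compares matrices with (m - 1) k_r rows and with k_r
  rows.\<close>

locale function_algebra =
  fixes R :: "('x \<Rightarrow> 'a::comm_ring_1) set"
  assumes const [intro]: "(\<lambda>x. c) \<in> R"
    and add [intro]: "f \<in> R \<Longrightarrow> g \<in> R \<Longrightarrow> (\<lambda>x. f x + g x) \<in> R"
    and mult [intro]: "f \<in> R \<Longrightarrow> g \<in> R \<Longrightarrow> (\<lambda>x. f x * g x) \<in> R"
begin

lemma sum: "(\<And>i. i \<in> I \<Longrightarrow> f i \<in> R) \<Longrightarrow> (\<lambda>x. \<Sum>i\<in>I. f i x) \<in> R"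
  by (induction I rule: infinite_finite_induct) auto

lemma prod: "(\<And>i. i \<in> I \<Longrightarrow> f i \<in> R) \<Longrightarrow> (\<lambda>x. \<Prod>i\<in>I. f i x) \<in> R"
  by (induction I rule: infinite_finite_induct) auto

text \<open>The tool for pulling a test polynomial back along a map: one such fact serves polynomial
  maps and rational maps alike.\<close>

lemma polynomial_comp:
  assumes "f \<in> polynomial_functions" and "\<And>i. (\<lambda>x. \<phi> x i) \<in> R"
  shows "(\<lambda>x. f (\<phi> x)) \<in> R"
  using assms(1) by induction (auto intro: assms(2))

lemma det:
  assumes "\<And>x. M x \<in> carrier_mat n n"
    and "\<And>a b. a < n \<Longrightarrow> b < n \<Longrightarrow> (\<lambda>x. M x $$ (a, b)) \<in> R"
  shows "(\<lambda>x. det (M x)) \<in> R"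
proof -
  have "(\<lambda>x. \<Sum>p | p permutes {0..<n}. signof p * (\<Prod>i = 0..<n. M x $$ (i, p i))) \<in> R"
    by (intro sum mult const prod assms(2)) (auto dest: permutes_in_image)
  then show ?thesis by (simp add: det_def'[OF assms(1)])
qed

lemma mat_mult:
  assumes "\<And>x. M x \<in> carrier_mat n l" "\<And>x. N x \<in> carrier_mat l k"
    and "\<And>a b. a < n \<Longrightarrow> b < l \<Longrightarrow> (\<lambda>x. M x $$ (a, b)) \<in> R"
    and "\<And>a b. a < l \<Longrightarrow> b < k \<Longrightarrow> (\<lambda>x. N x $$ (a, b)) \<in> R"
    and "a < n" "b < k"
  shows "(\<lambda>x. (M x * N x) $$ (a, b)) \<in> R"
proof -
  have "(M x * N x) $$ (a, b) = (\<Sum>c = 0..<l. M x $$ (a, c) * N x $$ (c, b))" for x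
    using assms(1)[of x] assms(2)[of x] assms(5,6) by (auto simp: scalar_prod_def)
  then show ?thesis using assms by (auto intro!: sum)
qed

text \<open>Adjugates stand in for inverses of varying matrices: their entries are signed minors,
  hence free of denominators.\<close>

lemma adj_mat:
  assumes "\<And>x. M x \<in> carrier_mat n n"
    and "\<And>a b. a < n \<Longrightarrow> b < n \<Longrightarrow> (\<lambda>x. M x $$ (a, b)) \<in> R"
    and "a < n" "b < n"
  shows "(\<lambda>x. adj_mat (M x) $$ (a, b)) \<in> R"
proof -
  have "(\<lambda>x. (-1) ^ (b + a) * det (mat_delete (M x) b a)) \<in> R"
    using assms
    by (intro mult const det[of _ "n - 1"]) (auto simp: mat_delete_def carrier_matD[OF assms(1)])
  moreover have "adj_mat (M x) $$ (a, b) = (-1) ^ (b + a) * det (mat_delete (M x) b a)" for x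
    using assms by (simp add: adj_mat_def cofactor_def carrier_matD[OF assms(1)])
  ultimately show ?thesis by simp
qed

end

interpretation polynomial: function_algebra "polynomial_functions"
  by unfold_locales (auto intro: polynomial_functions.intros)

text \<open>Quotients are written without division, so that \<open>x / 0 = 0\<close> plays no role.\<close>

definition regular_on :: "('i \<Rightarrow> 'a::field) set \<Rightarrow> (('i \<Rightarrow> 'a) \<Rightarrow> 'a) set" where
  "regular_on U = {\<phi>. \<exists>P\<in>polynomial_functions. \<exists>Q\<in>polynomial_functions.
     \<forall>x\<in>U. Q x \<noteq> 0 \<and> \<phi> x * Q x = P x}"

lemma regular_onE:
  assumes "\<phi> \<in> regular_on U"
  obtains P Q where "P \<in> polynomial_functions" "Q \<in> polynomial_functions"
    "\<And>x. x \<in> U \<Longrightarrow> Q x \<noteq> 0" "\<And>x. x \<in> U \<Longrightarrow> \<phi> x * Q x = P x"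
  using assms by (auto simp: regular_on_def)

lemma regular_onI:
  "P \<in> polynomial_functions \<Longrightarrow> Q \<in> polynomial_functions \<Longrightarrow>
    (\<And>x. x \<in> U \<Longrightarrow> Q x \<noteq> 0 \<and> \<phi> x * Q x = P x) \<Longrightarrow> \<phi> \<in> regular_on U"
  by (auto simp: regular_on_def)

lemma polynomial_regular: "f \<in> polynomial_functions \<Longrightarrow> f \<in> regular_on U"
  by (rule regular_onI[of f "\<lambda>_. 1"]) (auto intro: polynomial_functions.intros)

interpretation regular: function_algebra "regular_on U"
proof
  show "(\<lambda>x. c) \<in> regular_on U" for c
    by (intro polynomial_regular polynomial_functions.intros)
next
  fix f g assume "f \<in> regular_on U" "g \<in> regular_on U"
  then obtain P Q P' Q' where
    PQ: "P \<in> polynomial_functions" "Q \<in> polynomial_functions"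
        "P' \<in> polynomial_functions" "Q' \<in> polynomial_functions"
    and eq: "\<And>x. x \<in> U \<Longrightarrow> Q x \<noteq> 0 \<and> f x * Q x = P x" "\<And>x. x \<in> U \<Longrightarrow> Q' x \<noteq> 0 \<and> g x * Q' x = P' x"
    by (elim regular_onE) metis
  show "(\<lambda>x. f x + g x) \<in> regular_on U"
  proof (rule regular_onI[of "\<lambda>x. P x * Q' x + P' x * Q x" "\<lambda>x. Q x * Q' x"])
    fix x assume "x \<in> U"
    with eq[of x] show "Q x * Q' x \<noteq> 0 \<and> (f x + g x) * (Q x * Q' x) = P x * Q' x + P' x * Q x"
      by (auto simp: algebra_simps)
  qed (use PQ in \<open>auto intro: polynomial_functions.intros\<close>)
  show "(\<lambda>x. f x * g x) \<in> regular_on U"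
  proof (rule regular_onI[of "\<lambda>x. P x * P' x" "\<lambda>x. Q x * Q' x"])
    fix x assume "x \<in> U"
    with eq[of x] show "Q x * Q' x \<noteq> 0 \<and> (f x * g x) * (Q x * Q' x) = P x * P' x"
      by (metis mult.assoc mult.left_commute mult_eq_0_iff)
  qed (use PQ in \<open>auto intro: polynomial_functions.intros\<close>)
qed

lemma regular_divide:
  assumes "f \<in> regular_on U" "g \<in> regular_on U" and nz: "\<And>x. x \<in> U \<Longrightarrow> g x \<noteq> 0"
  shows "(\<lambda>x. f x / g x) \<in> regular_on U"
proof -
  obtain P Q P' Q' where
    PQ: "P \<in> polynomial_functions" "Q \<in> polynomial_functions"
        "P' \<in> polynomial_functions" "Q' \<in> polynomial_functions"
    and eq: "\<And>x. x \<in> U \<Longrightarrow> Q x \<noteq> 0 \<and> f x * Q x = P x" "\<And>x. x \<in> U \<Longrightarrow> Q' x \<noteq> 0 \<and> g x * Q' x = P' x"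
    using assms(1,2) by (elim regular_onE) metis
  show ?thesis
  \<comment> \<open>(P / Q) / (P' / Q') = P Q' / (Q P'); the new denominator is nonzero because P' =
    g Q' with both factors nonzero on \<open>U\<close>.\<close>
  proof (rule regular_onI[of "\<lambda>x. P x * Q' x" "\<lambda>x. Q x * P' x"])
    fix x assume x: "x \<in> U"
    have "f x / g x * (Q x * P' x) = f x / g x * (Q x * (g x * Q' x))" using eq(2)[OF x] by simp
    also have "\<dots> = (f x * Q x) * Q' x" using nz[OF x] by simp
    finally show "Q x * P' x \<noteq> 0 \<and> f x / g x * (Q x * P' x) = P x * Q' x"
      using eq(1)[OF x] eq(2)[OF x] nz[OF x] by auto
  qed (use PQ in \<open>auto intro: polynomial_functions.intros\<close>)
qed

text \<open>Euclid's argument: over a finite field the product of all X - a, increased by 1, has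
  positive degree but takes the value 1 everywhere.\<close>

lemma infinite_alg_closed_field: "infinite (UNIV :: 'a::alg_closed_field set)"
proof
  assume fin: "finite (UNIV :: 'a set)"
  define p :: "'a poly" where "p = (\<Prod>a\<in>UNIV. [:- a, 1:])"
  have "degree p = card (UNIV :: 'a set)"
    unfolding p_def by (subst degree_prod_eq_sum_degree) auto
  moreover have "card (UNIV :: 'a set) > 0" using fin by (simp add: card_gt_0_iff)
  ultimately have "degree (p + 1) > 0" by (simp add: degree_add_eq_left)
  then obtain x where "poly (p + 1) x = 0" using alg_closed_imp_poly_has_root by blast
  moreover have "poly p x = 0" unfolding p_def poly_prod using fin by (auto simp: prod_zero_iff)
  ultimately show False by simp
qed

text \<open>Restriction to the line through a non-zero of \<open>f\<close> and one of \<open>g\<close> reduces the claim to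
  univariate polynomials.\<close>

lemma polynomial_functions_no_zero_divisors:
  fixes f g :: "('i \<Rightarrow> 'a::alg_closed_field) \<Rightarrow> 'a"
  assumes f: "f \<in> polynomial_functions" and g: "g \<in> polynomial_functions"
    and fg: "\<And>x. f x * g x = 0" and gy: "g y \<noteq> 0"
  shows "f x = 0"
proof (rule ccontr)
  assume fx: "f x \<noteq> 0"
  have line: "\<exists>p. \<forall>t. h (\<lambda>i. x i + t * (y i - x i)) = poly p t" if "h \<in> polynomial_functions" for h
    using that
  proof induction
    case (const c) show ?case by (rule exI[of _ "[:c:]"]) simp
  next
    case (coord i) show ?case by (rule exI[of _ "[:x i, y i - x i:]"]) simp
  next
    case (add f g)
    then obtain p q where "\<forall>t. f (\<lambda>i. x i + t * (y i - x i)) = poly p t"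
      "\<forall>t. g (\<lambda>i. x i + t * (y i - x i)) = poly q t" by blast
    then show ?case by (intro exI[of _ "p + q"]) simp
  next
    case (mult f g)
    then obtain p q where "\<forall>t. f (\<lambda>i. x i + t * (y i - x i)) = poly p t"
      "\<forall>t. g (\<lambda>i. x i + t * (y i - x i)) = poly q t" by blast
    then show ?case by (intro exI[of _ "p * q"]) simp
  qed
  obtain p q where pq: "\<And>t. f (\<lambda>i. x i + t * (y i - x i)) = poly p t"
      "\<And>t. g (\<lambda>i. x i + t * (y i - x i)) = poly q t" using line[OF f] line[OF g] by blast
  have "poly (p * q) t = 0" for t using fg pq by (metis poly_mult)
  then have "{t. poly (p * q) t = 0} = UNIV" by blast
  then have "p * q = 0" using poly_roots_finite[of "p * q"] infinite_alg_closed_field by metis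
  then have "p = 0 \<or> q = 0" by simp
  \<comment> \<open>The line passes through \<open>x\<close> at t = 0 and through \<open>y\<close>
    at t = 1, so \<open>p = 0\<close> contradicts \<open>fx\<close> and \<open>q = 0\<close>
    contradicts \<open>gy\<close>.\<close>
  then show False using pq(1)[of 0] pq(2)[of 1] fx gy by auto
qed

section \<open>Density of subsets of affine space, tested by polynomials\<close>

definition poly_dense :: "('i \<Rightarrow> 'a::field) set \<Rightarrow> bool" where
  "poly_dense S \<longleftrightarrow> (\<forall>f\<in>polynomial_functions. (\<forall>x\<in>S. f x = 0) \<longrightarrow> (\<forall>x. f x = 0))"

lemma poly_denseD:
  "poly_dense S \<Longrightarrow> f \<in> polynomial_functions \<Longrightarrow> (\<And>x. x \<in> S \<Longrightarrow> f x = 0) \<Longrightarrow> f x = 0"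
  by (auto simp: poly_dense_def)

lemma poly_dense_regular_eq_0:
  fixes \<phi> :: "('i \<Rightarrow> 'a::field) \<Rightarrow> 'a"
  assumes S: "poly_dense S" and d: "d \<in> polynomial_functions"
    and reg: "\<phi> \<in> regular_on {x. d x \<noteq> 0}"
    and zero: "\<And>x. x \<in> S \<Longrightarrow> d x \<noteq> 0 \<Longrightarrow> \<phi> x = 0" and x: "d x \<noteq> 0"
  shows "\<phi> x = 0"
proof -
  obtain P Q where P: "P \<in> polynomial_functions"
    and eq: "\<And>x. d x \<noteq> 0 \<Longrightarrow> Q x \<noteq> 0 \<and> \<phi> x * Q x = P x"
    using reg by (elim regular_onE) auto
  \<comment> \<open>The factor \<open>d\<close> turns the numerator into a polynomial that vanishes
    on all of \<open>S\<close>, including the points where the fraction says nothing about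
    \<open>\<phi>\<close>.\<close>
  have "P x * d x = 0"
  proof (rule poly_denseD[OF S, of "\<lambda>x. P x * d x" x])
    show "(\<lambda>x. P x * d x) \<in> polynomial_functions" using P d by auto
    show "P x * d x = 0" if "x \<in> S" for x
      using eq[of x] zero[OF that] by (cases "d x = 0") auto
  qed
  with x have "P x = 0" by simp
  with eq[OF x] show ?thesis by auto
qed

lemma poly_dense_nonzero:
  assumes "poly_dense S" "d \<in> polynomial_functions" "d y \<noteq> 0"
  obtains x where "x \<in> S" "d x \<noteq> 0"
  using poly_denseD[OF assms(1,2), of y] assms(3) that by metis

section \<open>Frames and invertible matrices\<close>

definition col_span :: "'a::semiring_0 mat \<Rightarrow> 'a vec set" where
  "col_span B = (\<lambda>v. B *\<^sub>v v) ` carrier_vec (dim_col B)"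

definition col_inj :: "'a::semiring_0 mat \<Rightarrow> bool" where
  "col_inj B \<longleftrightarrow> inj_on (\<lambda>v. B *\<^sub>v v) (carrier_vec (dim_col B))"

definition first_cols :: "nat \<Rightarrow> 'a mat \<Rightarrow> 'a mat" where
  "first_cols k B = mat (dim_row B) k (\<lambda>(a, b). B $$ (a, b))"

lemma first_cols_carrier [simp]: "B \<in> carrier_mat n l \<Longrightarrow> first_cols k B \<in> carrier_mat n k"
  by (simp add: first_cols_def)

lemma first_cols_one_carrier [simp]: "first_cols k (1\<^sub>m l) \<in> carrier_mat l k"
  by (simp add: first_cols_def)

lemma first_cols_index [simp]:
  "a < dim_row B \<Longrightarrow> b < k \<Longrightarrow> first_cols k B $$ (a, b) = B $$ (a, b)"
  by (simp add: first_cols_def)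

lemma first_cols_same: "B \<in> carrier_mat n l \<Longrightarrow> first_cols l B = B"
  by (intro eq_matI) (auto simp: first_cols_def)

lemma first_cols_first_cols: "k \<le> l \<Longrightarrow> first_cols k (first_cols l B) = first_cols k B"
  by (intro eq_matI) (auto simp: first_cols_def)

lemma first_cols_mult:
  "B \<in> carrier_mat n l \<Longrightarrow> C \<in> carrier_mat l l' \<Longrightarrow> k \<le> l' \<Longrightarrow>
    first_cols k (B * C) = B * first_cols k C"
  by (intro eq_matI) (auto simp: first_cols_def scalar_prod_def)

text \<open>Truncation becomes right multiplication by a truncated identity, so that facts on
  products cover spans and injectivity of leading columns.\<close>

lemma first_cols_eq_mult:
  fixes B :: "'a::semiring_1 mat"
  shows "B \<in> carrier_mat n l \<Longrightarrow> k \<le> l \<Longrightarrow> first_cols k B = B * first_cols k (1\<^sub>m l)"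
  using first_cols_mult[of B n l "1\<^sub>m l" l k] by simp

lemma is_frame_iff:
  "is_frame n k W B \<longleftrightarrow> B \<in> carrier_mat n k \<and> col_inj B \<and> col_span B = W"
  by (auto simp: is_frame_def col_inj_def col_span_def bij_betw_def)

lemma mult_mat_zero_vec: "dim_col B = k \<Longrightarrow> B *\<^sub>v 0\<^sub>v k = 0\<^sub>v (dim_row B)"
  by (intro eq_vecI) (auto simp: scalar_prod_def)

lemma col_injI:
  fixes B :: "'a::field mat"
  assumes "B \<in> carrier_mat n k" "\<And>v. v \<in> carrier_vec k \<Longrightarrow> B *\<^sub>v v = 0\<^sub>v n \<Longrightarrow> v = 0\<^sub>v k"
  shows "col_inj B"
  unfolding col_inj_def
proof (rule inj_onI)
  fix v w assume vw: "v \<in> carrier_vec (dim_col B)" "w \<in> carrier_vec (dim_col B)" "B *\<^sub>v v = B *\<^sub>v w"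
  then have c: "v \<in> carrier_vec k" "w \<in> carrier_vec k" using assms(1) by auto
  have "B *\<^sub>v (v - w) = 0\<^sub>v n"
    using vw(3) assms(1) c by (subst mult_minus_distrib_mat_vec[OF assms(1)]) auto
  then have "v - w = 0\<^sub>v k" using c by (intro assms(2)) auto
  then have "(v - w) $ i = 0" if "i < k" for i using that by simp
  then show "v = w" using c by (intro eq_vecI) auto
qed

lemma col_injD:
  fixes B :: "'a::field mat"
  assumes "col_inj B" "B \<in> carrier_mat n k" "v \<in> carrier_vec k" "B *\<^sub>v v = 0\<^sub>v n"
  shows "v = 0\<^sub>v k"
  using inj_onD[OF assms(1)[unfolded col_inj_def], of v "0\<^sub>v k"] assms(2-)
  by (auto simp: mult_mat_zero_vec)

lemma col_inj_mult:
  fixes B :: "'a::field mat"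
  assumes "B \<in> carrier_mat n k" "C \<in> carrier_mat k l" "col_inj B" "col_inj C"
  shows "col_inj (B * C)"
proof (rule col_injI)
  show "B * C \<in> carrier_mat n l" using assms by auto
  fix v assume v: "v \<in> carrier_vec l" "B * C *\<^sub>v v = 0\<^sub>v n"
  then have "B *\<^sub>v (C *\<^sub>v v) = 0\<^sub>v n" using assms by simp
  then have "C *\<^sub>v v = 0\<^sub>v k" using assms v by (intro col_injD[OF assms(3,1)]) auto
  then show "v = 0\<^sub>v l" using assms v by (intro col_injD[OF assms(4,2)]) auto
qed

lemma col_inj_cancel:
  fixes B :: "'a::field mat"
  assumes "B \<in> carrier_mat n k" "C \<in> carrier_mat k l" "col_inj (B * C)"
  shows "col_inj C"
proof (rule col_injI[OF assms(2)])
  fix v assume v: "v \<in> carrier_vec l" "C *\<^sub>v v = 0\<^sub>v k"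
  have "B * C *\<^sub>v v = B *\<^sub>v 0\<^sub>v k"
    unfolding v(2)[symmetric] by (rule assoc_mult_mat_vec[OF assms(1,2) v(1)])
  then have "B * C *\<^sub>v v = 0\<^sub>v n" using assms(1) by (auto simp: mult_mat_zero_vec)
  then show "v = 0\<^sub>v l" by (rule col_injD[OF assms(3) mult_carrier_mat[OF assms(1,2)] v(1)])
qed

lemma col_inj_iff_det:
  fixes C :: "'a::field mat"
  assumes "C \<in> carrier_mat k k"
  shows "col_inj C \<longleftrightarrow> det C \<noteq> 0"
proof
  assume "col_inj C"
  then show "det C \<noteq> 0"
    using det_0_iff_vec_prod_zero_field[OF assms] col_injD[OF _ assms] by blast
next
  assume "det C \<noteq> 0"
  then show "col_inj C"
    using det_0_iff_vec_prod_zero_field[OF assms] by (intro col_injI[OF assms]) blast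
qed

lemma det_nonzero_inverse:
  fixes g :: "'a::field mat"
  assumes "g \<in> carrier_mat n n" "det g \<noteq> 0"
  obtains h where "h \<in> carrier_mat n n" "det h \<noteq> 0" "g * h = 1\<^sub>m n" "h * g = 1\<^sub>m n"
proof -
  obtain h where h: "h \<in> carrier_mat n n" "g * h = 1\<^sub>m n" "h * g = 1\<^sub>m n"
    using det_non_zero_imp_unit[OF assms, of "()"] by (auto simp: Units_def ring_mat_def)
  moreover have "det g * det h = 1" using det_mult[OF assms(1) h(1)] h by simp
  ultimately show ?thesis using that by force
qed

lemma GL_iff_det:
  "g \<in> carrier (GL TYPE('a::field) n) \<longleftrightarrow> g \<in> carrier_mat n n \<and> det g \<noteq> 0"
proof
  assume "g \<in> carrier_mat n n \<and> det g \<noteq> 0"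
  then show "g \<in> carrier (GL TYPE('a) n)"
    unfolding GL_carrier by (blast elim: det_nonzero_inverse)
next
  assume g: "g \<in> carrier (GL TYPE('a) n)"
  then obtain h where h: "g \<in> carrier_mat n n" "h \<in> carrier_mat n n" "h * g = 1\<^sub>m n"
    unfolding GL_carrier by auto
  have "det h * det g = 1" using det_mult[OF h(2,1)] h by simp
  with h show "g \<in> carrier_mat n n \<and> det g \<noteq> 0" by auto
qed

lemma mult_mat_cancel_left:
  fixes g :: "'a::field mat"
  assumes "g \<in> carrier_mat n n" "det g \<noteq> 0" "A \<in> carrier_mat n l" "B \<in> carrier_mat n l"
    and "g * A = g * B"
  shows "A = B"
proof -
  obtain h where h: "h \<in> carrier_mat n n" "h * g = 1\<^sub>m n" 
    using det_nonzero_inverse[OF assms(1,2)] by blast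
  have "h * g * A = h * g * B"
    unfolding assoc_mult_mat[OF h(1) assms(1,3)] assoc_mult_mat[OF h(1) assms(1,4)] assms(5) ..
  then show ?thesis using h assms by simp
qed

lemma col_span_mult:
  "B \<in> carrier_mat n k \<Longrightarrow> C \<in> carrier_mat k l \<Longrightarrow> col_span (B * C) = (\<lambda>v. B *\<^sub>v v) ` col_span C"
  by (auto simp: col_span_def image_image assoc_mult_mat_vec intro!: image_cong)

lemma col_span_mult_subset:
  "B \<in> carrier_mat n k \<Longrightarrow> C \<in> carrier_mat k l \<Longrightarrow> col_span (B * C) \<subseteq> col_span B"
  by (auto simp: col_span_mult) (auto simp: col_span_def)

lemma col_span_mult_inv:
  fixes B :: "'a::field mat"
  assumes B: "B \<in> carrier_mat n k" and C: "C \<in> carrier_mat k k" and d: "det C \<noteq> 0"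
  shows "col_span (B * C) = col_span B"
proof
  show "col_span (B * C) \<subseteq> col_span B" by (rule col_span_mult_subset[OF B C])
  obtain D where D: "D \<in> carrier_mat k k" "C * D = 1\<^sub>m k" using det_nonzero_inverse[OF C d] .
  have "col_span (B * C * D) \<subseteq> col_span (B * C)" using B C D by (intro col_span_mult_subset) auto
  then show "col_span B \<subseteq> col_span (B * C)" using B C D by (simp add: assoc_mult_mat)
qed

lemma col_in_col_span:
  fixes B :: "'a::semiring_1 mat"
  assumes "B \<in> carrier_mat n k" "b < k"
  shows "col B b \<in> col_span B"
proof -
  have "col B b = B *\<^sub>v unit_vec k b"
    using assms by (intro eq_vecI) auto
  then show ?thesis using assms by (auto simp: col_span_def)
qed

lemma col_span_factor:
  fixes B :: "'a::semiring_1 mat"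
  assumes B: "B \<in> carrier_mat n k" and D: "D \<in> carrier_mat n l"
    and sub: "\<And>b. b < l \<Longrightarrow> col D b \<in> col_span B"
  obtains C where "C \<in> carrier_mat k l" "D = B * C"
proof -
  have "\<forall>b. \<exists>v. b < l \<longrightarrow> v \<in> carrier_vec k \<and> col D b = B *\<^sub>v v"
    using sub B by (auto simp: col_span_def)
  then obtain c where c: "\<And>b. b < l \<Longrightarrow> c b \<in> carrier_vec k" "\<And>b. b < l \<Longrightarrow> col D b = B *\<^sub>v c b"
    by metis
  define C where "C = mat k l (\<lambda>(a, b). c b $ a)"
  have cC: "col C b = c b" if "b < l" for b
    using c(1)[OF that] that by (intro eq_vecI) (auto simp: C_def)
  have "D = B * C"
  proof (rule eq_matI)
    fix a b assume "a < dim_row (B * C)" "b < dim_col (B * C)"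
    then have ab: "a < n" "b < l" using B by (auto simp: C_def)
    have "D $$ (a, b) = col D b $ a" using ab D by simp
    also have "\<dots> = (B * C) $$ (a, b)" using ab B c cC by (simp add: C_def)
    finally show "D $$ (a, b) = (B * C) $$ (a, b)" .
  qed (use B D in \<open>auto simp: C_def\<close>)
  then show ?thesis using that[of C] by (simp add: C_def)
qed

text \<open>The coefficient matrix \<open>C\<close> inherits injectivity from \<open>D\<close>, and
  being square it is invertible. Hence k independent vectors inside the span of k columns already
  span it.\<close>

lemma col_span_subset_eq:
  fixes B :: "'a::field mat"
  assumes B: "B \<in> carrier_mat n k" and D: "D \<in> carrier_mat n k" and inj: "col_inj D"
    and sub: "\<And>b. b < k \<Longrightarrow> col D b \<in> col_span B"
  obtains C where "C \<in> carrier_mat k k" "det C \<noteq> 0" "D = B * C" "col_span D = col_span B"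
proof -
  obtain C where C: "C \<in> carrier_mat k k" "D = B * C" using col_span_factor[OF B D sub] .
  have "det C \<noteq> 0" using col_inj_cancel[OF B C(1)] inj C col_inj_iff_det by metis
  then show ?thesis using that[OF C(1) _ C(2)] col_span_mult_inv[OF B C(1)] C(2) by simp
qed

lemma col_span_closed:
  assumes B: "B \<in> carrier_mat n k"
  shows "col_span B \<subseteq> carrier_vec n"
  using B by (auto simp: col_span_def)

lemma col_inj_first_cols_one:
  assumes "k \<le> l" shows "col_inj (first_cols k (1\<^sub>m l :: 'a::field mat))"
proof (rule col_injI)
  show "first_cols k (1\<^sub>m l :: 'a mat) \<in> carrier_mat l k" by simp
  fix v :: "'a vec" assume v: "v \<in> carrier_vec k" "first_cols k (1\<^sub>m l) *\<^sub>v v = 0\<^sub>v l"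
  show "v = 0\<^sub>v k"
  proof (rule eq_vecI)
    fix i assume i: "i < dim_vec (0\<^sub>v k :: 'a vec)"
    have "(first_cols k (1\<^sub>m l) *\<^sub>v v) $ i = (\<Sum>j = 0..<k. (if i = j then 1 else 0) * v $ j)"
      using assms v(1) i by (auto simp: scalar_prod_def first_cols_def intro!: sum.cong)
    also have "\<dots> = v $ i" using i by (simp add: if_distrib[of "\<lambda>x. x * _"] sum.delta cong: if_cong)
    finally have "(first_cols k (1\<^sub>m l) *\<^sub>v v) $ i = v $ i" .
    with v(2) i assms show "v $ i = 0\<^sub>v k $ i" by simp
  qed (use v in auto)
qed

lemma col_inj_first_cols:
  fixes B :: "'a::field mat"
  assumes "B \<in> carrier_mat n l" "k \<le> l" "col_inj B"
  shows "col_inj (first_cols k B)"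
  unfolding first_cols_eq_mult[OF assms(1,2)]
  by (rule col_inj_mult[of _ n l _ k]) (use assms col_inj_first_cols_one in auto)

lemma col_span_first_cols_mono:
  fixes B :: "'a::semiring_1 mat"
  assumes "B \<in> carrier_mat n l" "k \<le> k'" "k' \<le> l"
  shows "col_span (first_cols k B) \<subseteq> col_span (first_cols k' B)"
proof -
  have "first_cols k B = first_cols k' B * first_cols k (1\<^sub>m k')"
    using first_cols_eq_mult[of "first_cols k' B" n k' k] assms
    by (simp add: first_cols_first_cols)
  then show ?thesis
    using col_span_mult_subset[of "first_cols k' B" n k' "first_cols k (1\<^sub>m k')" k] assms by simp
qed

text \<open>A dimension count by determinants: there are more columns than rows that can be nonzero.
  Making the matrix square, by adding or cutting off zero rows, exposes the zero row
  \<open>k\<close>. With k = n this bounds the number of independent columns; with k < n it finds a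
  nonzero entry in row k or below.\<close>

lemma wide_not_col_inj:
  fixes C :: "'a::field mat"
  assumes C: "C \<in> carrier_mat n l" and "k < l" and z: "\<And>a b. k \<le> a \<Longrightarrow> a < n \<Longrightarrow> b < l \<Longrightarrow> C $$ (a, b) = 0"
  shows "\<not> col_inj C"
proof
  assume inj: "col_inj C"
  define D where "D = mat l l (\<lambda>(a, b). if a < n then C $$ (a, b) else 0)"
  have D: "D \<in> carrier_mat l l" by (simp add: D_def)
  have r0: "row D k = 0\<^sub>v l" using \<open>k < l\<close> z by (intro eq_vecI) (auto simp: D_def)
  have "col_inj D"
  proof (rule col_injI[OF D])
    fix v assume v: "v \<in> carrier_vec l" "D *\<^sub>v v = 0\<^sub>v l"
    have "(C *\<^sub>v v) $ a = 0" if a: "a < n" for a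
    proof (cases "a < l")
      case True
      have "row C a = row D a" using a True C by (intro eq_vecI) (auto simp: D_def)
      then have "(C *\<^sub>v v) $ a = (D *\<^sub>v v) $ a" using a True C D by simp
      with True show ?thesis by (simp add: v)
    next
      case False
      then have "row C a = 0\<^sub>v l" using a C z \<open>k < l\<close> by (intro eq_vecI) auto
      then show ?thesis using a C v by simp
    qed
    then have "C *\<^sub>v v = 0\<^sub>v n" using C by (intro eq_vecI) auto
    then show "v = 0\<^sub>v l" using col_injD[OF inj C v(1)] by simp
  qed
  moreover have "det D = 0"
  proof -
    have "D $$ (k, b) = 0" if "b < l" for b using that \<open>k < l\<close> z by (simp add: D_def)
    then show ?thesis by (subst laplace_expansion_row[OF D \<open>k < l\<close>]) (simp add: sum.neutral)
  qed
  ultimately show False using col_inj_iff_det[OF D] by simp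
qed

lemma col_inj_append_col:
  fixes B :: "'a::field mat"
  assumes B: "B \<in> carrier_mat n l" and w: "w \<in> carrier_vec n" and inj: "col_inj B"
    and new: "w \<notin> col_span B"
  defines "B' \<equiv> mat n (Suc l) (\<lambda>(a, b). if b < l then B $$ (a, b) else w $ a)"
  shows "col_inj B'"
    and "v \<in> carrier_vec (Suc l) \<Longrightarrow> B' *\<^sub>v v = B *\<^sub>v vec l (($) v) + v $ l \<cdot>\<^sub>v w"
proof -
  have B': "B' \<in> carrier_mat n (Suc l)" by (simp add: B'_def)
  have eq: "B' *\<^sub>v v = B *\<^sub>v vec l (($) v) + v $ l \<cdot>\<^sub>v w" if v: "v \<in> carrier_vec (Suc l)" for v
    using B w v
    by (intro eq_vecI) (auto simp: B'_def scalar_prod_def mult.commute intro!: sum.cong)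
  show "v \<in> carrier_vec (Suc l) \<Longrightarrow> B' *\<^sub>v v = B *\<^sub>v vec l (($) v) + v $ l \<cdot>\<^sub>v w" by (rule eq)
  show "col_inj B'"
  proof (rule col_injI[OF B'])
    fix v assume v: "v \<in> carrier_vec (Suc l)" "B' *\<^sub>v v = 0\<^sub>v n"
    let ?u = "vec l (($) v)"
    have idx: "(B *\<^sub>v ?u) $ a + v $ l * w $ a = 0" if "a < n" for a
    proof -
      have "(B *\<^sub>v ?u + v $ l \<cdot>\<^sub>v w) $ a = 0"
        unfolding eq[OF v(1), symmetric] v(2) using that by simp
      then show ?thesis using that w B by simp
    qed
    have vl: "v $ l = 0"
    proof (rule ccontr)
      assume nz: "v $ l \<noteq> 0"
      have "w = B *\<^sub>v ((- inverse (v $ l)) \<cdot>\<^sub>v ?u)"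
      proof (rule eq_vecI)
        fix a assume "a < dim_vec (B *\<^sub>v ((- inverse (v $ l)) \<cdot>\<^sub>v ?u))"
        then have a: "a < n" using B by simp
        have "(B *\<^sub>v ((- inverse (v $ l)) \<cdot>\<^sub>v ?u)) $ a = - inverse (v $ l) * (B *\<^sub>v ?u) $ a"
          using a B by (subst mult_mat_vec[OF B]) auto
        also have "\<dots> = w $ a"
          using idx[OF a] nz by (simp add: add_eq_0_iff field_simps)
        finally show "w $ a = (B *\<^sub>v ((- inverse (v $ l)) \<cdot>\<^sub>v ?u)) $ a" by simp
      qed (use w B in auto)
      moreover have "B *\<^sub>v ((- inverse (v $ l)) \<cdot>\<^sub>v ?u) \<in> col_span B"
        unfolding col_span_def using B by (intro imageI) auto
      ultimately show False using new by simp
    qed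
    then have "B *\<^sub>v ?u = 0\<^sub>v n" using idx B by (intro eq_vecI) auto
    then have "?u = 0\<^sub>v l" by (intro col_injD[OF inj B]) auto
    then have "v $ i = 0" if "i < l" for i using that by (metis index_vec index_zero_vec(1))
    with vl v(1) show "v = 0\<^sub>v (Suc l)" by (intro eq_vecI) (auto simp: less_Suc_eq)
  qed
qed

text \<open>A matrix with the maximal number of independent columns in \<open>W\<close> spans
  \<open>W\<close>, since any vector outside its span could be appended. The maximum exists because
  an injective matrix has at most n columns.\<close>

lemma frame_exists:
  fixes W :: "'a::field vec set"
  assumes W: "W \<subseteq> carrier_vec n" and z: "0\<^sub>v n \<in> W"
    and add: "\<And>v w. v \<in> W \<Longrightarrow> w \<in> W \<Longrightarrow> v + w \<in> W"
    and smult: "\<And>c v. v \<in> W \<Longrightarrow> c \<cdot>\<^sub>v v \<in> W"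
  obtains l B where "is_frame n l W B"
proof -
  define P where "P l \<longleftrightarrow> (\<exists>B \<in> carrier_mat n l. col_inj B \<and> col_span B \<subseteq> W)" for l
  have bound: "l \<le> n" if "P l" for l
    using that wide_not_col_inj[of _ n l n] unfolding P_def by (meson not_le)
  have "P 0"
    unfolding P_def
  proof (intro bexI conjI)
    show "col_inj (0\<^sub>m n 0 :: 'a mat)" by (rule col_injI[of _ n 0]) auto
    show "col_span (0\<^sub>m n 0 :: 'a mat) \<subseteq> W"
    proof -
      have "0\<^sub>m n 0 *\<^sub>v v = 0\<^sub>v n" if "v \<in> carrier_vec 0" for v :: "'a vec"
        using that by (intro eq_vecI) (auto simp: scalar_prod_def)
      then show ?thesis using z by (auto simp: col_span_def)
    qed
  qed simp
  define l where "l = (GREATEST l. P l)"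
  have l: "P l" unfolding l_def by (rule GreatestI_nat[of P 0 n]) (use bound \<open>P 0\<close> in auto)
  then obtain B where B: "B \<in> carrier_mat n l" "col_inj B" "col_span B \<subseteq> W"
    unfolding P_def by auto
  have "W \<subseteq> col_span B"
  proof
    fix w assume w: "w \<in> W"
    show "w \<in> col_span B"
    proof (rule ccontr)
      assume new: "w \<notin> col_span B"
      have wc: "w \<in> carrier_vec n" using w W by auto
      note app = col_inj_append_col[OF B(1) wc B(2) new]
      have "P (Suc l)"
        unfolding P_def
      proof (intro bexI conjI, rule app(1))
        show "col_span (mat n (Suc l) (\<lambda>(a, b). if b < l then B $$ (a, b) else w $ a)) \<subseteq> W"
        proof -
          have "B *\<^sub>v vec l (($) v) + v $ l \<cdot>\<^sub>v w \<in> W" for v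
            using B by (intro add smult w) (auto simp: col_span_def image_subset_iff)
          then show ?thesis using app(2) by (auto simp: col_span_def)
        qed
      qed simp
      then have "Suc l \<le> l" unfolding l_def by (rule Greatest_le_nat[of P _ n]) (use bound in auto)
      then show False by simp
    qed
  qed
  with B have "is_frame n l W B" by (auto simp: is_frame_iff)
  then show ?thesis by (rule that)
qed

text \<open>Link to the abstract \<open>dim\<close> in the definition of flags: \<open>B\<close> is
  a linear bijection from the space of k-vectors onto its column span, and such maps preserve
  dimension.\<close>

lemma col_span_in_subspaces:
  fixes B :: "'a::field mat"
  assumes B: "B \<in> carrier_mat n k" and inj: "col_inj B"
  shows "col_span B \<in> subspaces TYPE('a) n k"
proof -
  interpret Vn: vec_space "TYPE('a)" n .
  interpret Vk: vec_space "TYPE('a)" k .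
  let ?W = "col_span B"
  have sub: "submodule class_ring ?W (module_vec TYPE('a) n)"
  proof (rule submodule.intro)
    show "Module.module class_ring (module_vec TYPE('a) n)" by (rule vec_module)
    show "?W \<subseteq> carrier (module_vec TYPE('a) n)"
      using col_span_closed[OF B] by (simp add: module_vec_simps)
    show "\<zero>\<^bsub>module_vec TYPE('a) n\<^esub> \<in> ?W"
      using B by (auto simp: module_vec_simps col_span_def mult_mat_zero_vec intro!: image_eqI[of _ _ "0\<^sub>v k"])
  next
    fix v w assume "v \<in> ?W" "w \<in> ?W"
    then obtain v' w' where "v' \<in> carrier_vec k" "w' \<in> carrier_vec k" "v = B *\<^sub>v v'" "w = B *\<^sub>v w'"
      using B by (auto simp: col_span_def)
    then show "v \<oplus>\<^bsub>module_vec TYPE('a) n\<^esub> w \<in> ?W"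
      using B by (auto simp: module_vec_simps col_span_def mult_add_distrib_mat_vec[OF B]
          intro!: image_eqI[of _ _ "v' + w'"])
  next
    fix c :: 'a and v assume "v \<in> ?W"
    then obtain v' where "v' \<in> carrier_vec k" "v = B *\<^sub>v v'"
      using B by (auto simp: col_span_def)
    then show "c \<odot>\<^bsub>module_vec TYPE('a) n\<^esub> v \<in> ?W"
      using B by (auto simp: module_vec_simps col_span_def mult_mat_vec[OF B]
          intro!: image_eqI[of _ _ "c \<cdot>\<^sub>v v'"])
  qed
  have subsp: "VectorSpace.subspace class_ring ?W (module_vec TYPE('a) n)"
    unfolding VectorSpace.subspace_def using sub vec_vs by auto
  let ?V = "(module_vec TYPE('a) n) \<lparr>carrier := ?W\<rparr>"
  have vs: "vectorspace class_ring ?V" by (rule Vn.subspace_is_vs[OF subsp])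
  interpret W: vectorspace class_ring ?V by (rule vs)
  interpret T: linear_map class_ring "module_vec TYPE('a) k" ?V "\<lambda>v. B *\<^sub>v v"
  proof
    show "(\<lambda>v. B *\<^sub>v v) \<in> LinearCombinations.module_hom class_ring (module_vec TYPE('a) k) ?V"
      using B by (auto simp: LinearCombinations.module_hom_def module_vec_simps col_span_def mult_mat_vec[OF B]
          mult_add_distrib_mat_vec[OF B])
  qed
  have "Vk.dim = W.dim"
  proof (rule T.dim_eq)
    show "Vk.fin_dim" by simp
    show "inj_on (\<lambda>v. B *\<^sub>v v) (carrier (module_vec TYPE('a) k))"
      using inj B by (simp add: col_inj_def module_vec_simps)
    show "(\<lambda>v. B *\<^sub>v v) ` carrier (module_vec TYPE('a) k) = carrier ?V"
      using B by (simp add: col_span_def module_vec_simps)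
  qed
  then show ?thesis unfolding subspaces_def using subsp Vk.dim_is_n by simp
qed

lemma subspaces_iff_frame:
  fixes W :: "'a::field vec set"
  shows "W \<in> subspaces TYPE('a) n k \<longleftrightarrow> (\<exists>B. is_frame n k W B)"
proof
  assume W: "W \<in> subspaces TYPE('a) n k"
  then have cl: "W \<subseteq> carrier_vec n" "0\<^sub>v n \<in> W"
    "\<And>v w. v \<in> W \<Longrightarrow> w \<in> W \<Longrightarrow> v + w \<in> W" "\<And>c v. v \<in> W \<Longrightarrow> c \<cdot>\<^sub>v v \<in> W"
    by (auto simp: subspaces_def VectorSpace.subspace_def submodule_def module_vec_simps)
  obtain l B where B: "is_frame n l W B" using frame_exists[OF cl] by metis
  then have "W \<in> subspaces TYPE('a) n l" using col_span_in_subspaces by (auto simp: is_frame_iff)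
  with W have "l = k" by (simp add: subspaces_def)
  with B show "\<exists>B. is_frame n k W B" by auto
qed (use col_span_in_subspaces in \<open>auto simp: is_frame_iff\<close>)

text \<open>Steinitz exchange in matrix form. In the basis \<open>E\<close> the columns of
  \<open>B\<close> are those of \<open>C\<close>; being more than k independent columns, they have a
  nonzero entry in some row a at or beyond k. By Cramer's rule that entry is the factor by which the
  determinant changes when column a of \<open>E\<close> is replaced.\<close>

lemma exchange_column:
  fixes E B :: "'a::field mat"
  assumes E: "E \<in> carrier_mat n n" "det E \<noteq> 0" and B: "B \<in> carrier_mat n l" "col_inj B"
    and k: "k < l" "k < n"
  obtains E' where "E' \<in> carrier_mat n n" "det E' \<noteq> 0" "\<And>b. b < k \<Longrightarrow> col E' b = col E b"
    "col E' k \<in> col_span B"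
proof -
  obtain h where h: "h \<in> carrier_mat n n" "det h \<noteq> 0" "E * h = 1\<^sub>m n"
    using det_nonzero_inverse[OF E] by metis
  define C where "C = h * B"
  have C: "C \<in> carrier_mat n l" using h B by (simp add: C_def)
  have "col_inj C"
    unfolding C_def using h B col_inj_iff_det[OF h(1)] by (intro col_inj_mult[OF h(1) B(1)]) auto
  then obtain a b where ab: "k \<le> a" "a < n" "b < l" "C $$ (a, b) \<noteq> 0"
    using wide_not_col_inj[OF C k(1)] by blast
  have "E * C = B"
    unfolding C_def assoc_mult_mat[OF E(1) h(1) B(1), symmetric] h(3) using B by simp
  then have EC: "E *\<^sub>v col C b = col B b" using E C ab(3) by (metis col_mult2)
  define E1 where "E1 = replace_col E (col B b) a"
  have E1: "E1 \<in> carrier_mat n n" using E by (simp add: E1_def replace_col_def)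
  have "det E1 = col C b $ a * det E"
    unfolding E1_def EC[symmetric] using C ab by (intro cramer_lemma_mat[OF E(1)]) auto
  then have dE1: "det E1 \<noteq> 0" using ab C E by simp
  have colE1: "col E1 a = col B b" "\<And>c. c < n \<Longrightarrow> c \<noteq> a \<Longrightarrow> col E1 c = col E c"
    using E B ab by (auto simp: E1_def replace_col_def intro!: eq_vecI)
  have colB: "col B b \<in> col_span B" using col_in_col_span[OF B(1) ab(3)] .
  show ?thesis
  proof (cases "a = k")
    case True
    then show ?thesis using that[OF E1 dE1] colE1 colB k by auto
  next
    case False
    \<comment> \<open>The new vector sits in a column a > k; swapping it into place k leaves the
      columns before k alone.\<close>
    let ?E = "swapcols k a E1"
    have "?E \<in> carrier_mat n n" using E1 by simp
    moreover have "det ?E \<noteq> 0" using det_swapcols[OF k(2) ab(2) False[symmetric] E1] dE1 by simp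
    moreover have "col ?E c = col E c" if "c < k" for c
    proof -
      have "col ?E c = col E1 c" using that ab k E1 by (intro eq_vecI) auto
      with colE1(2)[of c] that ab k show ?thesis by simp
    qed
    moreover have "col ?E k = col E1 a" using ab k E1 by (intro eq_vecI) auto
    ultimately show ?thesis using that[of ?E] colE1 colB by simp
  qed
qed

text \<open>Exchange at the positions k, ..., l - 1 in turn. This is the passage from one subspace
  of a flag to the next, the first k columns being a basis of the smaller one.\<close>

lemma extend_columns:
  fixes E B :: "'a::field mat"
  assumes E: "E \<in> carrier_mat n n" "det E \<noteq> 0" and B: "B \<in> carrier_mat n l" "col_inj B"
    and kl: "k \<le> l" "l \<le> n" and sub: "\<And>b. b < k \<Longrightarrow> col E b \<in> col_span B"
  obtains E' where "E' \<in> carrier_mat n n" "det E' \<noteq> 0" "\<And>b. b < k \<Longrightarrow> col E' b = col E b"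
    "\<And>b. b < l \<Longrightarrow> col E' b \<in> col_span B"
proof -
  have "\<exists>E'. E' \<in> carrier_mat n n \<and> det E' \<noteq> 0 \<and> (\<forall>b<k. col E' b = col E b) \<and>
    (\<forall>b<k + i. col E' b \<in> col_span B)" if "k + i \<le> l" for i
    using that
  proof (induction i)
    case 0
    then show ?case using E sub by auto
  next
    case (Suc i)
    then obtain E' where E': "E' \<in> carrier_mat n n" "det E' \<noteq> 0" "\<forall>b<k. col E' b = col E b"
      "\<forall>b<k + i. col E' b \<in> col_span B" by auto
    have ki: "k + i < l" "k + i < n" using Suc.prems kl by auto
    obtain E'' where E'': "E'' \<in> carrier_mat n n" "det E'' \<noteq> 0"
      "\<And>b. b < k + i \<Longrightarrow> col E'' b = col E' b" "col E'' (k + i) \<in> col_span B"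
      using exchange_column[OF E'(1,2) B ki] by metis
    then show ?case using E' by (intro exI[of _ E'']) (auto simp: less_Suc_eq)
  qed
  from this[of "l - k"] kl that show ?thesis by auto
qed

lemma col_spanE:
  assumes "w \<in> col_span B"
  obtains v where "v \<in> carrier_vec (dim_col B)" "w = B *\<^sub>v v"
  using assms unfolding col_span_def by (elim imageE)

section \<open>Flags given by matrices\<close>

definition flag_of :: "nat list \<Rightarrow> 'a::field mat \<Rightarrow> 'a vec set list" where
  "flag_of ks A = map (\<lambda>k. col_span (first_cols k A)) ks"

definition flag_tuple_of :: "nat \<Rightarrow> nat list \<Rightarrow> (nat \<Rightarrow> 'a::field mat) \<Rightarrow> 'a vec set list list" where
  "flag_tuple_of m ks A = map (\<lambda>j. flag_of ks (A j)) [0..<m]"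

text \<open>The stabiliser of the standard flag.\<close>

definition parabolic :: "nat list \<Rightarrow> nat \<Rightarrow> 'a::field mat set" where
  "parabolic ks L = {b \<in> carrier_mat L L. det b \<noteq> 0 \<and>
     (\<forall>k\<in>set ks. \<forall>a<L. \<forall>c<L. c < k \<longrightarrow> k \<le> a \<longrightarrow> b $$ (a, c) = 0)}"

lemma parabolic_mult:
  assumes b: "b \<in> parabolic ks L" and b': "b' \<in> parabolic ks L"
  shows "b * b' \<in> parabolic ks L"
proof -
  have c: "b \<in> carrier_mat L L" "b' \<in> carrier_mat L L" using assms by (auto simp: parabolic_def)
  have "(b * b') $$ (a, d) = 0" if k: "k \<in> set ks" "a < L" "d < L" "d < k" "k \<le> a" for k a d
  proof -
    have "b $$ (a, t) * b' $$ (t, d) = 0" if "t < L" for t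
    proof (cases "t < k")
      case True
      then have "b $$ (a, t) = 0" using b k that by (auto simp: parabolic_def)
      then show ?thesis by simp
    next
      case False
      then have "b' $$ (t, d) = 0" using b' k that by (auto simp: parabolic_def)
      then show ?thesis by simp
    qed
    then show ?thesis using c k by (simp add: scalar_prod_def sum.neutral)
  qed
  then show ?thesis using assms c by (auto simp: parabolic_def det_mult[of _ L])
qed

section \<open>Pluecker coordinates under a change of basis and in graph form\<close>

lemma pluecker_mult:
  fixes B :: "'a::field mat"
  assumes B: "B \<in> carrier_mat n k" and C: "C \<in> carrier_mat k k"
  shows "pluecker n k (B * C) \<alpha> = det C * pluecker n k B \<alpha>"
proof (cases "length \<alpha> = k \<and> set \<alpha> \<subseteq> {..<n}")
  case True
  then have i: "\<alpha> ! a < n" if "a < k" for a using that by (metis lessThan_iff nth_mem subsetD)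
  have "mat k k (\<lambda>(a, b). (B * C) $$ (\<alpha> ! a, b)) = mat k k (\<lambda>(a, b). B $$ (\<alpha> ! a, b)) * C"
    using B C i by (intro eq_matI) (auto simp: scalar_prod_def)
  then show ?thesis using True C by (simp add: pluecker_def det_mult[of _ k])
qed (auto simp: pluecker_def)

text \<open>With an identity block on top, exchanging row l for row s leaves an identity matrix with
  one foreign row, whose determinant is the entry of that row in column l. Transposition brings it
  into the form of Cramer's rule. Coordinates of this kind therefore recover the matrix.\<close>

lemma pluecker_graph:
  fixes A :: "'a::field mat"
  assumes A: "A \<in> carrier_mat n k" and top: "\<And>a b. a < k \<Longrightarrow> b < k \<Longrightarrow> A $$ (a, b) = (if a = b then 1 else 0)"
    and kn: "k \<le> n" and "l < k" "s < n"
  shows "pluecker n k A ([0..<k][l := s]) = A $$ (s, l)"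
proof -
  let ?\<alpha> = "[0..<k][l := s]"
  let ?M = "mat k k (\<lambda>(a, b). A $$ (?\<alpha> ! a, b))"
  let ?x = "vec k (\<lambda>b. A $$ (s, b))"
  have "set ?\<alpha> \<subseteq> {..<n}" using assms set_update_subset_insert[of "[0..<k]" l s] by auto
  then have "pluecker n k A ?\<alpha> = det ?M" by (simp add: pluecker_def)
  also have "det ?M = det (transpose_mat ?M)" by (rule det_transpose[symmetric, of _ k]) simp
  also have "transpose_mat ?M = replace_col (1\<^sub>m k) (1\<^sub>m k *\<^sub>v ?x) l"
    using assms by (intro eq_matI) (auto simp: replace_col_def nth_list_update)
  also have "det \<dots> = A $$ (s, l)"
    using assms by (subst cramer_lemma_mat[of _ k]) auto
  finally show ?thesis .
qed

text \<open>Flags in n-space are described by matrices with \<open>L\<close> columns. The condition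
  \<open>full\<close> makes the span of all \<open>L\<close> columns depend on the flag alone, being
  either everything or one of its subspaces; this is what relates two matrices of the same flag by
  an invertible L x L matrix. Both uses have L = k_r, once as the largest dimension of the flag and
  once equal to n.\<close>

locale flag_shape =
  fixes ks :: "nat list" and n L :: nat
  assumes sorted: "sorted ks" and pos: "\<And>k. k \<in> set ks \<Longrightarrow> 0 < k"
    and le_L: "\<And>k. k \<in> set ks \<Longrightarrow> k \<le> L" and L_le_n: "L \<le> n"
    and full: "L = n \<or> L \<in> set ks"
begin

lemma le_n: "k \<in> set ks \<Longrightarrow> k \<le> n"
  using le_L L_le_n by fastforce

lemma frame_first_cols:
  fixes A :: "'a::field mat"
  assumes "A \<in> carrier_mat n L" "col_inj A" "k \<in> set ks"
  shows "is_frame n k (col_span (first_cols k A)) (first_cols k A)"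
  unfolding is_frame_iff using col_inj_first_cols[OF assms(1) le_L[OF assms(3)] assms(2)] assms by simp

lemma flag_of_in_flags:
  fixes A :: "'a::field mat"
  assumes "A \<in> carrier_mat n L" "col_inj A"
  shows "flag_of ks A \<in> flags TYPE('a) ks n"
proof -
  have "flag_of ks A ! i \<in> subspaces TYPE('a) n (ks ! i)" if "i < length ks" for i
    unfolding flag_of_def subspaces_iff_frame
    using that frame_first_cols[OF assms nth_mem[OF that]] by auto
  moreover have "flag_of ks A ! i \<subseteq> flag_of ks A ! Suc i" if "Suc i < length ks" for i
    using that sorted_nth_mono[OF sorted, of i "Suc i"] le_L[OF nth_mem[OF that]]
    by (auto simp: flag_of_def dest!: subsetD[OF col_span_first_cols_mono[OF assms(1)]])
  ultimately show ?thesis by (simp add: flags_def flag_of_def)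
qed

lemma flag_of_mult_parabolic:
  fixes A :: "'a::field mat"
  assumes A: "A \<in> carrier_mat n L" "col_inj A" and b: "b \<in> parabolic ks L"
  shows "flag_of ks (A * b) = flag_of ks A" "col_inj (A * b)"
proof -
  have bc: "b \<in> carrier_mat L L" "det b \<noteq> 0" using b by (auto simp: parabolic_def)
  show inj: "col_inj (A * b)"
    using A bc col_inj_iff_det[OF bc(1)] by (intro col_inj_mult[OF A(1) bc(1)]) auto
  have "col_span (first_cols k (A * b)) = col_span (first_cols k A)" if k: "k \<in> set ks" for k
  proof -
    define C where "C = mat k k (\<lambda>(a, d). b $$ (a, d))"
    have C: "C \<in> carrier_mat k k" by (simp add: C_def)
    have eq: "first_cols k (A * b) = first_cols k A * C"
    proof (rule eq_matI)
      fix a d assume "a < dim_row (first_cols k A * C)" "d < dim_col (first_cols k A * C)"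
      then have ad: "a < n" "d < k" using A by (auto simp: C_def first_cols_def)
      have kL: "k \<le> L" using le_L[OF k] .
      have "first_cols k (A * b) $$ (a, d) = (\<Sum>t = 0..<L. A $$ (a, t) * b $$ (t, d))"
        using A bc ad kL by (simp add: scalar_prod_def)
      \<comment> \<open>From row k on, the first k columns of a parabolic matrix are zero, so only
        its leading k x k block \<open>C\<close> contributes.\<close>
      also have "\<dots> = (\<Sum>t = 0..<k. A $$ (a, t) * b $$ (t, d))"
        using b k kL ad by (intro sum.mono_neutral_right) (auto simp: parabolic_def)
      also have "\<dots> = (first_cols k A * C) $$ (a, d)"
        using A ad by (simp add: scalar_prod_def C_def first_cols_def)
      finally show "first_cols k (A * b) $$ (a, d) = (first_cols k A * C) $$ (a, d)" .
    qed (use A C in \<open>auto simp: first_cols_def\<close>)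
    have "col_inj (first_cols k (A * b))"
      using A bc inj le_L[OF k] by (intro col_inj_first_cols[of _ n L]) auto
    \<comment> \<open>Independence of the first k columns of \<open>A * b\<close> forces the leading
      block to be invertible.\<close>
    then have "det C \<noteq> 0"
      unfolding eq using col_inj_cancel[of "first_cols k A" n k C k] A C col_inj_iff_det[OF C] by simp
    then show ?thesis unfolding eq using A C by (intro col_span_mult_inv[of _ n]) auto
  qed
  then show "flag_of ks (A * b) = flag_of ks A" by (simp add: flag_of_def)
qed

lemma flag_of_mult_left:
  fixes A :: "'a::field mat"
  assumes "A \<in> carrier_mat n L" "g \<in> carrier_mat n n"
  shows "flag_of ks (g * A) = map (\<lambda>W. (\<lambda>v. g *\<^sub>v v) ` W) (flag_of ks A)"
proof -
  have "col_span (first_cols k (g * A)) = (\<lambda>v. g *\<^sub>v v) ` col_span (first_cols k A)"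
    if "k \<in> set ks" for k
    using first_cols_mult[OF assms(2,1) le_L[OF that]] assms by (simp add: col_span_mult[of _ n n _ k])
  then show ?thesis by (simp add: flag_of_def)
qed

text \<open>Converse of invariance under the parabolic group. Matrices of one flag span the same
  space and so differ by an invertible \<open>C\<close>. A column d < k of \<open>A\<close> is
  already a combination of the first k columns of \<open>B\<close>; since coordinates with respect
  to \<open>B\<close> are unique, column d of \<open>C\<close> vanishes from row k on.\<close>

lemma flag_of_eqD:
  fixes A B :: "'a::field mat"
  assumes A: "A \<in> carrier_mat n L" "col_inj A" and B: "B \<in> carrier_mat n L" "col_inj B"
    and eq: "flag_of ks A = flag_of ks B"
  obtains b where "b \<in> parabolic ks L" "A = B * b"
proof -
  have k_eq: "col_span (first_cols k A) = col_span (first_cols k B)" if "k \<in> set ks" for k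
    using eq that by (simp add: flag_of_def)
  \<comment> \<open>The two cases of \<open>full\<close>: either \<open>B\<close> spans the whole
    space, or \<open>L\<close> is one of the dimensions and the flag contains the span
    itself.\<close>
  have span: "col A l \<in> col_span B" if "l < L" for l
  proof (cases "L = n")
    case True
    then have Bn: "B \<in> carrier_mat n n" using B by simp
    then have "det B \<noteq> 0" using B col_inj_iff_det by blast
    then have "col_span (1\<^sub>m n * B) = col_span (1\<^sub>m n :: 'a mat)"
      by (intro col_span_mult_inv[OF _ Bn]) auto
    then have "col_span B = col_span (1\<^sub>m n :: 'a mat)" using Bn by simp
    also have "\<dots> = carrier_vec n" by (auto simp: col_span_def)
    finally show ?thesis using A(1) that by auto
  next
    case False
    then have "L \<in> set ks" using full by simp
    from k_eq[OF this] col_in_col_span[OF A(1) that] show ?thesis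
      using A B by (simp add: first_cols_same)
  qed
  obtain C where C: "C \<in> carrier_mat L L" "det C \<noteq> 0" "A = B * C"
    using col_span_subset_eq[OF B(1) A span] by metis
  have "C $$ (a, d) = 0" if k: "k \<in> set ks" "a < L" "d < L" "d < k" "k \<le> a" for k a d
  proof -
    have kL: "k \<le> L" using le_L k by simp
    have "col (first_cols k A) d \<in> col_span (first_cols k A)"
      using A k by (intro col_in_col_span[of _ n k]) auto
    moreover have "col (first_cols k A) d = col A d"
      using A k kL by (intro eq_vecI) (auto simp: first_cols_def)
    ultimately have "col A d \<in> col_span (first_cols k B)" using k_eq[OF k(1)] by simp
    then obtain v where v': "v \<in> carrier_vec (dim_col (first_cols k B))"
      and colA: "col A d = first_cols k B *\<^sub>v v" by (rule col_spanE)
    have v: "v \<in> carrier_vec k" using v' by (simp add: first_cols_def)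
    \<comment> \<open>\<open>w\<close> is \<open>v\<close> padded with zeros to length
      \<open>L\<close>, so that uniqueness of coordinates applies to \<open>B\<close>
      itself.\<close>
    define w where "w = first_cols k (1\<^sub>m L) *\<^sub>v v"
    have w: "w \<in> carrier_vec L"
      unfolding w_def using first_cols_one_carrier v by (rule mult_mat_vec_carrier)
    have "B *\<^sub>v w = first_cols k B *\<^sub>v v"
      unfolding w_def first_cols_eq_mult[OF B(1) kL]
      by (rule assoc_mult_mat_vec[OF B(1) first_cols_one_carrier v, symmetric])
    also have "\<dots> = B *\<^sub>v col C d"
      unfolding colA[symmetric] C(3) by (rule col_mult2[OF B(1) C(1) k(3)])
    finally have eq: "B *\<^sub>v w = B *\<^sub>v col C d" .
    have "w = col C d"
      by (rule inj_onD[OF B(2)[unfolded col_inj_def] eq]) (use w C(1) k(3) B(1) in auto)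
    then have "C $$ (a, d) = w $ a" using C(1) k by simp
    also have "\<dots> = (\<Sum>t = 0..<k. (if a = t then 1 else 0) * v $ t)"
      unfolding w_def using k(2) v kL by (auto simp: scalar_prod_def first_cols_def intro!: sum.cong)
    also have "\<dots> = 0" using k(5) by (intro sum.neutral) auto
    finally show ?thesis .
  qed
  then show ?thesis using that[of C] C by (auto simp: parabolic_def)
qed

text \<open>A basis adapted to the flag, built from the smallest subspace upwards. The induction
  carries an invertible n x n matrix rather than a partial basis, so that exchange applies at each
  stage; at the end it is cut to \<open>L\<close> columns.\<close>

lemma flags_eq_flag_of:
  fixes Ws :: "'a::field vec set list"
  assumes Ws: "Ws \<in> flags TYPE('a) ks n"
  obtains A where "A \<in> carrier_mat n L" "col_inj A" "flag_of ks A = Ws"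
proof -
  have len: "length Ws = length ks" and mono: "\<And>i. Suc i < length ks \<Longrightarrow> Ws ! i \<subseteq> Ws ! Suc i"
    and fr: "\<And>i. i < length ks \<Longrightarrow> \<exists>B. is_frame n (ks ! i) (Ws ! i) B"
    using Ws by (auto simp: flags_def subspaces_iff_frame)
  have "\<exists>E. E \<in> carrier_mat n n \<and> det E \<noteq> 0 \<and>
      (\<forall>i'<i. col_span (first_cols (ks ! i') E) = Ws ! i')" if "i \<le> length ks" for i
    using that
  proof (induction i)
    case 0
    show ?case by (rule exI[of _ "1\<^sub>m n"]) auto
  next
    case (Suc i)
    then obtain E :: "'a mat" where E: "E \<in> carrier_mat n n" "det E \<noteq> 0"
      "\<forall>i'<i. col_span (first_cols (ks ! i') E) = Ws ! i'" by auto
    obtain B where B: "B \<in> carrier_mat n (ks ! i)" "col_inj B" "col_span B = Ws ! i"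
      using fr[of i] Suc.prems by (auto simp: is_frame_iff)
    \<comment> \<open>The dimension reached so far, with 0 before the first subspace.\<close>
    define k where "k = (case i of 0 \<Rightarrow> 0 | Suc i' \<Rightarrow> ks ! i')"
    have kn: "ks ! i \<le> n" using le_n Suc.prems by simp
    have ki: "k \<le> ks ! i"
      using sorted Suc.prems by (auto simp: k_def sorted_nth_mono split: nat.splits)
    have sub: "col E b \<in> col_span B" if "b < k" for b
    proof -
      obtain i' where i': "i = Suc i'" "k = ks ! i'" using \<open>b < k\<close> by (auto simp: k_def split: nat.splits)
      have "col E b = col (first_cols k E) b"
        using E(1) that ki kn by (intro eq_vecI) (auto simp: first_cols_def)
      also have "\<dots> \<in> col_span (first_cols k E)"
        using E(1) that by (intro col_in_col_span[of _ n k]) auto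
      also have "\<dots> = Ws ! i'" using E(3) i' by simp
      also have "\<dots> \<subseteq> col_span B" using mono[of i'] i' Suc.prems B(3) by simp
      finally show ?thesis .
    qed
    obtain E' where E': "E' \<in> carrier_mat n n" "det E' \<noteq> 0" "\<And>b. b < k \<Longrightarrow> col E' b = col E b"
      "\<And>b. b < ks ! i \<Longrightarrow> col E' b \<in> col_span B"
      using extend_columns[OF E(1,2) B(1,2) ki kn sub] by metis
    have injE': "col_inj E'" using E' col_inj_iff_det by blast
    have "col_span (first_cols (ks ! i') E') = Ws ! i'" if "i' < Suc i" for i'
    proof (cases "i' = i")
      case True
      have "col (first_cols (ks ! i) E') b \<in> col_span B" if "b < ks ! i" for b
      proof -
        have "col (first_cols (ks ! i) E') b = col E' b"
          using E'(1) that kn by (intro eq_vecI) (auto simp: first_cols_def)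
        with E'(4)[OF that] show ?thesis by simp
      qed
      moreover have "first_cols (ks ! i) E' \<in> carrier_mat n (ks ! i)" using E' by simp
      ultimately have "col_span (first_cols (ks ! i) E') = col_span B"
        using col_span_subset_eq[OF B(1) _ col_inj_first_cols[OF E'(1) kn injE']] by metis
      with True B(3) show ?thesis by simp
    next
      case False
      then have "i' < i" using that by simp
      \<comment> \<open>Earlier subspaces use only columns before k, which the extension has
        kept.\<close>
      then have "ks ! i' \<le> k"
        using sorted Suc.prems by (auto simp: k_def sorted_nth_mono split: nat.splits)
      then have "first_cols (ks ! i') E' = first_cols (ks ! i') E"
        using E'(1) E(1) ki kn E'(3) by (intro eq_matI) (auto simp: first_cols_def simp flip: index_col)
      with E(3) \<open>i' < i\<close> show ?thesis by simp
    qed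
    with E' show ?case by blast
  qed
  then obtain E :: "'a mat" where E: "E \<in> carrier_mat n n" "det E \<noteq> 0"
    "\<forall>i<length ks. col_span (first_cols (ks ! i) E) = Ws ! i" by blast
  show ?thesis
  proof (rule that)
    show "first_cols L E \<in> carrier_mat n L" using E by simp
    show "col_inj (first_cols L E)"
      using E L_le_n col_inj_iff_det by (intro col_inj_first_cols[OF E(1)]) auto
    show "flag_of ks (first_cols L E) = Ws"
      using E(3) len le_L
      by (auto simp: flag_of_def first_cols_first_cols intro!: nth_equalityI)
  qed
qed

end

section \<open>Dense orbits on tuples of matrices\<close>

definition mats :: "nat \<Rightarrow> nat \<Rightarrow> (nat \<times> nat \<times> nat \<Rightarrow> 'a) \<Rightarrow> nat \<Rightarrow> 'a mat" where
  "mats n L x j = mat n L (\<lambda>(a, b). x (j, a, b))"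

text \<open>All matrix tuples over one orbit of flag tuples: g is the group element, the
  \<open>b j\<close> are independent changes of adapted basis. Coordinates outside the m matrices
  stay free, so the set is a cylinder in the affine space of all functions, and its density means
  density among matrix tuples.\<close>

definition mat_orbit ::
  "nat \<Rightarrow> nat \<Rightarrow> nat \<Rightarrow> 'a::field mat set \<Rightarrow> (nat \<Rightarrow> 'a mat) \<Rightarrow> (nat \<times> nat \<times> nat \<Rightarrow> 'a) set" where
  "mat_orbit m n L P A = {x. \<exists>g\<in>carrier_mat n n. det g \<noteq> 0 \<and>
     (\<exists>b. \<forall>j<m. b j \<in> P \<and> mats n L x j = g * A j * b j)}"

definition dense_mat_orbit :: "nat \<Rightarrow> nat \<Rightarrow> nat \<Rightarrow> 'a::field mat set \<Rightarrow> bool" where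
  "dense_mat_orbit m n L P \<longleftrightarrow>
     (\<exists>A. (\<forall>j<m. A j \<in> carrier_mat n L) \<and> poly_dense (mat_orbit m n L P A))"

lemma mats_carrier [simp]: "mats n L x j \<in> carrier_mat n L"
  by (simp add: mats_def)

lemma mats_index [simp]: "a < n \<Longrightarrow> b < L \<Longrightarrow> mats n L x j $$ (a, b) = x (j, a, b)"
  by (simp add: mats_def)

lemma mats_entries: "A j \<in> carrier_mat n L \<Longrightarrow> mats n L (\<lambda>(j, ab). A j $$ ab) j = A j"
  by (intro eq_matI) (auto simp: mats_def)

text \<open>The maps between parameter spaces take the coordinates outside the matrices from a fixed
  point \<open>x\<close>; thus they can hit \<open>x\<close> exactly.\<close>

lemma mats_override:
  assumes "j < m" "A j \<in> carrier_mat n L"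
  shows "mats n L (\<lambda>(j, a, b). if j < m \<and> a < n \<and> b < L then A j $$ (a, b) else x (j, a, b)) j = A j"
  using assms by (intro eq_matI) (auto simp: mats_def)

text \<open>Reduces injectivity to a polynomial condition that truncated identities satisfy, so that
  every dense set contains points satisfying it.\<close>

lemma col_inj_of_top:
  fixes A :: "'a::field mat"
  assumes A: "A \<in> carrier_mat n L" and Ln: "L \<le> n" and d: "det (mat L L (\<lambda>(a, b). A $$ (a, b))) \<noteq> 0"
  shows "col_inj A"
proof (rule col_injI[OF A])
  let ?T = "mat L L (\<lambda>(a, b). A $$ (a, b))"
  fix v assume v: "v \<in> carrier_vec L" "A *\<^sub>v v = 0\<^sub>v n"
  have "(?T *\<^sub>v v) $ a = (A *\<^sub>v v) $ a" if "a < L" for a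
    using that A Ln v(1) by (auto simp: scalar_prod_def)
  then have eq: "?T *\<^sub>v v = 0\<^sub>v L" unfolding v(2) using Ln by (intro eq_vecI) auto
  have "col_inj ?T" using d col_inj_iff_det[of ?T L] by simp
  then show "v = 0\<^sub>v L" by (rule col_injD[OF _ mat_carrier v(1) eq])
qed

lemma col_inj_conj:
  fixes A :: "'a::field mat"
  assumes g: "g \<in> carrier_mat n n" "det g \<noteq> 0" and b: "b \<in> carrier_mat L L" "det b \<noteq> 0"
    and A: "A \<in> carrier_mat n L"
  shows "col_inj (g * A * b) \<longleftrightarrow> col_inj A"
proof
  have gA: "g * A \<in> carrier_mat n L" using g A by simp
  assume inj: "col_inj (g * A * b)"
  obtain c where c: "c \<in> carrier_mat L L" "det c \<noteq> 0" "b * c = 1\<^sub>m L"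
    using det_nonzero_inverse[OF b] by metis
  have "g * A = g * A * b * c"
    unfolding assoc_mult_mat[OF gA b(1) c(1)] c(3) by (rule right_mult_one_mat[OF gA, symmetric])
  moreover have "col_inj (g * A * b * c)"
    using c(2) col_inj_iff_det[OF c(1)] by (intro col_inj_mult[OF mult_carrier_mat[OF gA b(1)] c(1) inj]) simp
  ultimately show "col_inj A" using col_inj_cancel[OF g(1) A] by simp
next
  have gA: "g * A \<in> carrier_mat n L" using g A by simp
  assume "col_inj A"
  then have "col_inj (g * A)" using g col_inj_iff_det[OF g(1)] by (intro col_inj_mult[OF g(1) A]) auto
  then show "col_inj (g * A * b)" using b col_inj_iff_det[OF b(1)] by (intro col_inj_mult[OF gA b(1)]) auto
qed

section \<open>Group orbits, frames and Pluecker coordinates\<close>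

lemma PGL_orbit_eq:
  assumes xs: "xs \<in> flag_tuples TYPE('a::field) m ks n"
  shows "orbit (PGL TYPE('a) n) PGL_act xs = {mat_act g xs | g. g \<in> carrier_mat n n \<and> det g \<noteq> 0}"
proof -
  interpret G: group "GL TYPE('a) n" by (rule group_GL)
  let ?S = "scalar_mats TYPE('a) n"
  have sub: "subgroup ?S (GL TYPE('a) n)" using scalar_mats_normal normal_imp_subgroup by blast
  have coset: "?S #>\<^bsub>GL TYPE('a) n\<^esub> g \<in> carrier (PGL TYPE('a) n)"
    "g \<in> ?S #>\<^bsub>GL TYPE('a) n\<^esub> g" if "g \<in> carrier (GL TYPE('a) n)" for g
    using that G.rcos_self[OF that sub] by (auto simp: PGL_def FactGroup_def RCOSETS_def)
  have rep: "\<exists>g \<in> carrier (GL TYPE('a) n). g \<in> C" if "C \<in> carrier (PGL TYPE('a) n)" for C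
    using that G.rcos_self[OF _ sub] by (auto simp: PGL_def FactGroup_def RCOSETS_def)
  show ?thesis
  proof (intro equalityI subsetI)
    fix y assume "y \<in> orbit (PGL TYPE('a) n) PGL_act xs"
    then obtain C where C: "C \<in> carrier (PGL TYPE('a) n)" "y = PGL_act C xs"
      by (auto simp: orbit_def)
    then obtain g where "g \<in> carrier (GL TYPE('a) n)" "g \<in> C" using rep by blast
    then show "y \<in> {mat_act g xs | g. g \<in> carrier_mat n n \<and> det g \<noteq> 0}"
      using PGL_act_eq[OF C(1) _ xs] C(2) GL_iff_det by auto
  next
    fix y assume "y \<in> {mat_act g xs | g. g \<in> carrier_mat n n \<and> det g \<noteq> 0}"
    then obtain g where g: "g \<in> carrier (GL TYPE('a) n)" "y = mat_act g xs" using GL_iff_det by blast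
    then have "y = PGL_act (?S #>\<^bsub>GL TYPE('a) n\<^esub> g) xs"
      using PGL_act_eq[OF coset[OF g(1)] xs] by simp
    then show "y \<in> orbit (PGL TYPE('a) n) PGL_act xs"
      unfolding orbit_def using coset(1)[OF g(1)] by blast
  qed
qed

text \<open>Scaling one column scales all maximal minors by the same factor. A column must exist,
  hence \<open>0 < k\<close>; for k = 0 the only nonzero coordinate is the empty determinant
  1.\<close>

lemma pluecker_rescale:
  fixes B :: "'a::field mat"
  assumes B: "B \<in> carrier_mat n k" "col_inj B" and k: "0 < k" and c: "c \<noteq> 0"
  obtains B' where "is_frame n k (col_span B) B'" "\<And>\<alpha>. pluecker n k B' \<alpha> = c * pluecker n k B \<alpha>"
proof -
  let ?D = "multrow_mat k 0 c"
  have D: "?D \<in> carrier_mat k k" "det ?D = c" using k by (auto simp: det_multrow_mat)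
  show ?thesis
  proof (rule that[of "B * ?D"])
    show "is_frame n k (col_span B) (B * ?D)"
      unfolding is_frame_iff
      using B D c col_inj_iff_det[OF D(1)] col_span_mult_inv[OF B(1) D(1)] col_inj_mult[OF B(1) D(1)]
      by simp
    show "pluecker n k (B * ?D) \<alpha> = c * pluecker n k B \<alpha>" for \<alpha>
      using pluecker_mult[OF B(1) D(1)] D(2) by simp
  qed
qed

lemma frame_change:
  fixes B B' :: "'a::field mat"
  assumes "is_frame n k W B" "is_frame n k W B'"
  obtains c where "c \<noteq> 0" "\<And>\<alpha>. pluecker n k B' \<alpha> = c * pluecker n k B \<alpha>"
proof -
  have B: "B \<in> carrier_mat n k" "col_span B = W" and B': "B' \<in> carrier_mat n k" "col_inj B'" "col_span B' = W"
    using assms by (auto simp: is_frame_iff)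
  have "col B' b \<in> col_span B" if "b < k" for b
    using col_in_col_span[OF B'(1) that] B B' by simp
  then obtain C where "C \<in> carrier_mat k k" "det C \<noteq> 0" "B' = B * C"
    using col_span_subset_eq[OF B(1) B'(1,2)] by metis
  with that[of "det C"] show ?thesis using pluecker_mult[OF B(1)] by blast
qed

context flag_shape
begin

lemma flag_tuple_of_in:
  fixes A :: "nat \<Rightarrow> 'a::field mat"
  assumes "\<And>j. j < m \<Longrightarrow> A j \<in> carrier_mat n L" "\<And>j. j < m \<Longrightarrow> col_inj (A j)"
  shows "flag_tuple_of m ks A \<in> flag_tuples TYPE('a) m ks n"
  using assms by (auto simp: flag_tuples_def flag_tuple_of_def intro!: flag_of_in_flags)

lemma flag_tuples_eq_flag_tuple_of:
  assumes xs: "xs \<in> flag_tuples TYPE('a::field) m ks n"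
  obtains A where "\<And>j. j < m \<Longrightarrow> A j \<in> carrier_mat n L" "\<And>j. j < m \<Longrightarrow> col_inj (A j)"
    "flag_tuple_of m ks A = xs"
proof -
  have len: "length xs = m" using xs by (simp add: flag_tuples_def)
  have "\<exists>A. A \<in> carrier_mat n L \<and> col_inj A \<and> flag_of ks A = xs ! j" if "j < m" for j
  proof -
    have "xs ! j \<in> flags TYPE('a) ks n" using xs that by (auto simp: flag_tuples_def)
    then show ?thesis using flags_eq_flag_of by metis
  qed
  then obtain A where A: "\<And>j. j < m \<Longrightarrow> A j \<in> carrier_mat n L \<and> col_inj (A j) \<and> flag_of ks (A j) = xs ! j"
    by metis
  then have "flag_tuple_of m ks A = xs"
    using len by (auto simp: flag_tuple_of_def intro!: nth_equalityI)
  with A that show ?thesis by blast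
qed

lemma mat_act_flag_tuple_of:
  fixes A :: "nat \<Rightarrow> 'a::field mat"
  assumes "\<And>j. j < m \<Longrightarrow> A j \<in> carrier_mat n L" "g \<in> carrier_mat n n"
  shows "mat_act g (flag_tuple_of m ks A) = flag_tuple_of m ks (\<lambda>j. g * A j)"
  by (simp add: mat_act_def flag_tuple_of_def flag_of_mult_left[OF assms])

lemma mat_orbit_flag_tuple:
  fixes A :: "nat \<Rightarrow> 'a::field mat"
  assumes A: "\<And>j. j < m \<Longrightarrow> A j \<in> carrier_mat n L" "\<And>j. j < m \<Longrightarrow> col_inj (A j)"
    and x: "x \<in> mat_orbit m n L (parabolic ks L) A"
  shows "j < m \<Longrightarrow> col_inj (mats n L x j)"
    and "flag_tuple_of m ks (mats n L x) \<in> orbit (PGL TYPE('a) n) PGL_act (flag_tuple_of m ks A)"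
proof -
  obtain g b where g: "g \<in> carrier_mat n n" "det g \<noteq> 0"
    and b: "\<And>j. j < m \<Longrightarrow> b j \<in> parabolic ks L" "\<And>j. j < m \<Longrightarrow> mats n L x j = g * A j * b j"
    using x unfolding mat_orbit_def by blast
  have gA: "g * A j \<in> carrier_mat n L" "col_inj (g * A j)" if "j < m" for j
    using A[OF that] g col_inj_iff_det[OF g(1)] by (auto intro: col_inj_mult)
  show "col_inj (mats n L x j)" if "j < m" for j
    using flag_of_mult_parabolic(2)[OF gA[OF that] b(1)[OF that]] b(2)[OF that] by simp
  have "mat_act g (flag_tuple_of m ks A) = flag_tuple_of m ks (\<lambda>j. g * A j)"
    using A(1) g(1) by (rule mat_act_flag_tuple_of)
  then have "flag_tuple_of m ks (mats n L x) = mat_act g (flag_tuple_of m ks A)"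
    by (simp add: flag_tuple_of_def b(2) flag_of_mult_parabolic(1)[OF gA b(1)])
  then show "flag_tuple_of m ks (mats n L x) \<in> orbit (PGL TYPE('a) n) PGL_act (flag_tuple_of m ks A)"
    using PGL_orbit_eq[OF flag_tuple_of_in[OF A]] g by auto
qed

lemma pluecker_first_cols_polynomial:
  assumes "k \<le> L"
  shows "(\<lambda>x. pluecker n k (first_cols k (mats n L x j)) \<alpha> :: 'a::field) \<in> polynomial_functions"
proof (cases "length \<alpha> = k \<and> set \<alpha> \<subseteq> {..<n}")
  case True
  then have i: "\<alpha> ! a < n" if "a < k" for a using that by (metis lessThan_iff nth_mem subsetD)
  have "(\<lambda>x. det (mat k k (\<lambda>(a, b). x (j, \<alpha> ! a, b)))) \<in> polynomial_functions"
    by (intro polynomial.det[of _ k]) (auto intro: polynomial_functions.intros)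
  moreover have "mat k k (\<lambda>(a, b). first_cols k (mats n L x j) $$ (\<alpha> ! a, b)) =
      mat k k (\<lambda>(a, b). x (j, \<alpha> ! a, b))" for x :: "nat \<times> nat \<times> nat \<Rightarrow> 'a"
    using i assms by (intro eq_matI) (auto simp: first_cols_def mats_def)
  ultimately show ?thesis using True by (simp add: pluecker_def)
next
  case False
  show ?thesis unfolding pluecker_def if_not_P[OF False] by (rule polynomial.const)
qed

text \<open>Equations \<open>T\<close> in Pluecker coordinates pull back to polynomials in matrix
  entries. Since vanishing has to be shown for every system \<open>p\<close> of coordinates of every
  point, the scalars relating \<open>p\<close> to the minors of one chosen matrix tuple
  \<open>X\<close> are built into the pullback.\<close>

lemma dense_PGL_action_if_dense_mat_orbit:
  assumes "dense_mat_orbit m n L (parabolic ks L :: 'a::alg_closed_field mat set)"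
  shows "dense_PGL_action TYPE('a) m ks n"
proof -
  obtain A :: "nat \<Rightarrow> 'a mat" where A: "\<And>j. j < m \<Longrightarrow> A j \<in> carrier_mat n L"
    and dense: "poly_dense (mat_orbit m n L (parabolic ks L) A)"
    using assms unfolding dense_mat_orbit_def by blast
  \<comment> \<open>The base tuple \<open>A\<close> is not known to be injective. A dense orbit
    meets the set where all top blocks are invertible, and injectivity is constant along an
    orbit.\<close>
  define d where "d x = (\<Prod>j<m. det (mat L L (\<lambda>(a, b). x (j, a, b))))" for x :: "nat \<times> nat \<times> nat \<Rightarrow> 'a"
  have d: "d \<in> polynomial_functions"
    unfolding d_def
    by (intro polynomial.prod polynomial.det[of _ L]) (auto intro: polynomial_functions.intros)
  have "mat L L (\<lambda>(a, b). if a = b then 1 else 0) = (1\<^sub>m L :: 'a mat)" by (intro eq_matI) auto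
  then have "d (\<lambda>(j, a, b). if a = b then 1 else 0) \<noteq> 0" by (simp add: d_def)
  then obtain x where x: "x \<in> mat_orbit m n L (parabolic ks L) A" "d x \<noteq> 0"
    using poly_dense_nonzero[OF dense d] by metis
  have inj: "col_inj (A j)" if j: "j < m" for j
  proof -
    have "mat L L (\<lambda>(a, b). mats n L x j $$ (a, b)) = mat L L (\<lambda>(a, b). x (j, a, b))"
      using L_le_n by (intro eq_matI) auto
    then have "det (mat L L (\<lambda>(a, b). mats n L x j $$ (a, b))) \<noteq> 0" using x(2) j by (simp add: d_def)
    then have "col_inj (mats n L x j)" using L_le_n by (intro col_inj_of_top) auto
    moreover obtain g b where "g \<in> carrier_mat n n" "det g \<noteq> 0" "b j \<in> parabolic ks L"
        "mats n L x j = g * A j * b j"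
      using x(1) j unfolding mat_orbit_def by blast
    ultimately show ?thesis using col_inj_conj[of g n "b j" L "A j"] A[OF j] by (simp add: parabolic_def)
  qed
  let ?x0 = "flag_tuple_of m ks A"
  have x0: "?x0 \<in> flag_tuples TYPE('a) m ks n" using flag_tuple_of_in[OF A inj] .
  let ?S = "orbit (PGL TYPE('a) n) PGL_act ?x0"
  have "zariski_dense TYPE('a) m ks n ?S"
    unfolding zariski_dense_def
  proof (intro conjI allI impI)
    show "?S \<subseteq> flag_tuples TYPE('a) m ks n"
    proof -
      have "mat_act g ?x0 \<in> flag_tuples TYPE('a) m ks n" if g: "g \<in> carrier_mat n n" "det g \<noteq> 0" for g
      proof -
        have "mat_act g ?x0 = flag_tuple_of m ks (\<lambda>j. g * A j)"
          using A g(1) by (rule mat_act_flag_tuple_of)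
        then show ?thesis
          using A inj g col_inj_iff_det[OF g(1)] flag_tuple_of_in[of m "\<lambda>j. g * A j"]
          by (auto intro: col_inj_mult)
      qed
      then show ?thesis unfolding PGL_orbit_eq[OF x0] by auto
    qed
  next
    fix Z assume "zariski_closed TYPE('a) m ks n Z \<and> ?S \<subseteq> Z"
    then obtain T where T: "T \<subseteq> polynomial_functions"
      and Z: "Z = {xs \<in> flag_tuples TYPE('a) m ks n. \<forall>f\<in>T. \<forall>p\<in>homogeneous_coords ks n xs. f p = 0}"
      and SZ: "?S \<subseteq> Z"
      unfolding zariski_closed_def by auto
    have "f p = 0" if xs: "xs \<in> flag_tuples TYPE('a) m ks n" and f: "f \<in> T"
      and p: "p \<in> homogeneous_coords ks n xs" for xs f p
    proof -
      have len: "length xs = m" using xs by (simp add: flag_tuples_def)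
      obtain B where fr: "\<And>j i. j < m \<Longrightarrow> i < length ks \<Longrightarrow> is_frame n (ks ! i) (xs ! j ! i) (B j i)"
        and p_eq: "p = (\<lambda>(j, i, \<alpha>). if j < m \<and> i < length ks then pluecker n (ks ! i) (B j i) \<alpha> else 0)"
        using p len unfolding homogeneous_coords_def by auto
      obtain X where X: "\<And>j. j < m \<Longrightarrow> X j \<in> carrier_mat n L" "\<And>j. j < m \<Longrightarrow> col_inj (X j)"
        "flag_tuple_of m ks X = xs"
        using flag_tuples_eq_flag_tuple_of[OF xs] by metis
      have xs_nth: "xs ! j ! i = col_span (first_cols (ks ! i) (X j))" if "j < m" "i < length ks" for j i
        using that unfolding X(3)[symmetric] by (simp add: flag_tuple_of_def flag_of_def)
      have "\<exists>c. c \<noteq> 0 \<and> (\<forall>\<alpha>. pluecker n (ks ! i) (B j i) \<alpha>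
          = c * pluecker n (ks ! i) (first_cols (ks ! i) (X j)) \<alpha>)"
        if ji: "j < m" "i < length ks" for j i
      proof -
        have "is_frame n (ks ! i) (xs ! j ! i) (first_cols (ks ! i) (X j))"
          unfolding xs_nth[OF ji]
          by (rule frame_first_cols[OF X(1)[OF ji(1)] X(2)[OF ji(1)] nth_mem[OF ji(2)]])
        from frame_change[OF this fr[OF ji]] show ?thesis by metis
      qed
      then obtain c where c: "\<And>j i. j < m \<Longrightarrow> i < length ks \<Longrightarrow> c j i \<noteq> 0"
        "\<And>j i \<alpha>. j < m \<Longrightarrow> i < length ks \<Longrightarrow> pluecker n (ks ! i) (B j i) \<alpha>
          = c j i * pluecker n (ks ! i) (first_cols (ks ! i) (X j)) \<alpha>" by metis
      \<comment> \<open>The scalars \<open>c\<close> are constants of the map: at \<open>X\<close>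
        it gives \<open>p\<close>, and on the orbit it gives rescaled minors, which are coordinates
        again by \<open>pluecker_rescale\<close>.\<close>
      define \<phi> where "\<phi> x = (\<lambda>(j, i, \<alpha>). if j < m \<and> i < length ks
        then c j i * pluecker n (ks ! i) (first_cols (ks ! i) (mats n L x j)) \<alpha> else 0)" for x
      have "(\<lambda>x. f (\<phi> x)) \<in> polynomial_functions"
      proof (rule polynomial.polynomial_comp[of f \<phi>])
        show "f \<in> polynomial_functions" using f T by auto
        show "(\<lambda>x. \<phi> x t) \<in> polynomial_functions" for t
        proof -
          obtain j i \<alpha> where t: "t = (j, i, \<alpha>)" by (cases t)
          show ?thesis
          proof (cases "j < m \<and> i < length ks")
            case True
            then have "ks ! i \<le> L" using le_L by simp
            then show ?thesis
              using True by (auto simp: t \<phi>_def intro: pluecker_first_cols_polynomial)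
          qed (auto simp: t \<phi>_def)
        qed
      qed
      moreover have "f (\<phi> x) = 0" if x: "x \<in> mat_orbit m n L (parabolic ks L) A" for x
      proof -
        let ?z = "flag_tuple_of m ks (mats n L x)"
        have injx: "col_inj (mats n L x j)" if "j < m" for j
          using A inj x that by (rule mat_orbit_flag_tuple(1))
        have zS: "?z \<in> ?S"
          using A inj x by (rule mat_orbit_flag_tuple(2))
        have "\<exists>B'. is_frame n (ks ! i) (?z ! j ! i) B' \<and> (\<forall>\<alpha>. pluecker n (ks ! i) B' \<alpha>
          = c j i * pluecker n (ks ! i) (first_cols (ks ! i) (mats n L x j)) \<alpha>)"
          if ji: "j < m" "i < length ks" for j i
        proof -
          have k: "ks ! i \<in> set ks" using ji by simp
          have "col_inj (first_cols (ks ! i) (mats n L x j))"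
            by (rule col_inj_first_cols[OF mats_carrier le_L[OF k] injx[OF ji(1)]])
          moreover have "?z ! j ! i = col_span (first_cols (ks ! i) (mats n L x j))"
            using ji by (simp add: flag_tuple_of_def flag_of_def)
          ultimately show ?thesis
            using pluecker_rescale[of "first_cols (ks ! i) (mats n L x j)" n "ks ! i" "c j i"]
              pos[OF k] c(1)[OF ji] by (metis first_cols_carrier mats_carrier)
        qed
        then obtain B' where B': "\<And>j i. j < m \<Longrightarrow> i < length ks \<Longrightarrow> is_frame n (ks ! i) (?z ! j ! i) (B' j i)"
          "\<And>j i \<alpha>. j < m \<Longrightarrow> i < length ks \<Longrightarrow> pluecker n (ks ! i) (B' j i) \<alpha>
            = c j i * pluecker n (ks ! i) (first_cols (ks ! i) (mats n L x j)) \<alpha>" by metis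
        have lz: "length ?z = m" by (simp add: flag_tuple_of_def)
        have "\<phi> x \<in> homogeneous_coords ks n ?z"
          unfolding homogeneous_coords_def lz
          by (intro CollectI exI[of _ B'] conjI) (use B' in \<open>auto simp: \<phi>_def fun_eq_iff\<close>)
        moreover have "?z \<in> Z" using zS SZ by auto
        ultimately show ?thesis using f Z by auto
      qed
      ultimately have "f (\<phi> (\<lambda>(j, ab). X j $$ ab)) = 0" by (rule poly_denseD[OF dense])
      moreover have "\<phi> (\<lambda>(j, ab). X j $$ ab) = p"
        unfolding p_eq \<phi>_def using c(2) by (auto simp: fun_eq_iff mats_entries[OF X(1)])
      ultimately show ?thesis by simp
    qed
    then show "Z = flag_tuples TYPE('a) m ks n" unfolding Z by auto
  qed
  with x0 show ?thesis unfolding dense_PGL_action_def by blast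
qed

end

section \<open>Charts on the big cell: from Pluecker coordinates back to matrices\<close>

text \<open>
  Where the leading minors do not vanish, a flag has a unique matrix in a normal form whose entries
  are ratios of Pluecker coordinates. Column \<open>l\<close> is read off the first subspace of dimension
  greater than \<open>l\<close>.
\<close>

definition chart :: "nat list \<Rightarrow> nat \<Rightarrow> nat \<Rightarrow> (nat \<times> nat \<times> nat list \<Rightarrow> 'a::field) \<Rightarrow> nat \<Rightarrow> 'a mat" where
  "chart ks n L p j = mat n L (\<lambda>(s, l).
     if \<exists>i<length ks. l < ks ! i
     then let i = (LEAST i. i < length ks \<and> l < ks ! i)
          in p (j, i, [0..<ks ! i][l := s]) / p (j, i, [0..<ks ! i])
     else if s = l then 1 else 0)"

lemma chart_carrier [simp]: "chart ks n L p j \<in> carrier_mat n L"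
  by (simp add: chart_def)

text \<open>Multiplying by the inverse of the top block \<open>T\<close> puts an identity on top
  without changing the span. Then the entries are minors, and the factor \<open>det T\<close>
  between the minors of \<open>B\<close> and of \<open>A\<close> cancels in the ratio.\<close>

lemma pluecker_ratio:
  fixes B :: "'a::field mat"
  assumes B: "B \<in> carrier_mat n k" and kn: "k \<le> n" and nz: "pluecker n k B [0..<k] \<noteq> 0"
  obtains A where "A \<in> carrier_mat n k" "col_span A = col_span B"
    "\<And>a b. a < k \<Longrightarrow> b < k \<Longrightarrow> A $$ (a, b) = (if a = b then 1 else 0)"
    "\<And>s l. s < n \<Longrightarrow> l < k \<Longrightarrow> A $$ (s, l) = pluecker n k B ([0..<k][l := s]) / pluecker n k B [0..<k]"
proof -
  define T where "T = mat k k (\<lambda>(a, b). B $$ (a, b))"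
  have T: "T \<in> carrier_mat k k" by (simp add: T_def)
  have "mat k k (\<lambda>(a, b). B $$ ([0..<k] ! a, b)) = T" by (intro eq_matI) (auto simp: T_def)
  moreover have "set [0..<k] \<subseteq> {..<n}" using kn by auto
  ultimately have dT: "det T = pluecker n k B [0..<k]" by (simp add: pluecker_def)
  with nz have dT0: "det T \<noteq> 0" by simp
  obtain U where U: "U \<in> carrier_mat k k" "det U \<noteq> 0" "T * U = 1\<^sub>m k" "U * T = 1\<^sub>m k"
    using det_nonzero_inverse[OF T dT0] .
  define A where "A = B * U"
  have A: "A \<in> carrier_mat n k" using B U by (simp add: A_def)
  have top: "A $$ (a, b) = (if a = b then 1 else 0)" if ab: "a < k" "b < k" for a b
  proof -
    have "A $$ (a, b) = (T * U) $$ (a, b)"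
      using ab kn B U(1) by (auto simp: A_def T_def scalar_prod_def intro!: sum.cong)
    then show ?thesis using ab U(3) by simp
  qed
  have "A * T = B" unfolding A_def assoc_mult_mat[OF B U(1) T] U(4) using B by simp
  then have pl: "pluecker n k B \<alpha> = det T * pluecker n k A \<alpha>" for \<alpha>
    using pluecker_mult[OF A T] by metis
  show ?thesis
  proof (rule that)
    show "A \<in> carrier_mat n k" by (rule A)
    show "col_span A = col_span B" unfolding A_def by (rule col_span_mult_inv[OF B U(1,2)])
    show "A $$ (a, b) = (if a = b then 1 else 0)" if "a < k" "b < k" for a b using top that .
    show "A $$ (s, l) = pluecker n k B ([0..<k][l := s]) / pluecker n k B [0..<k]"
      if "s < n" "l < k" for s l
    proof -
      have "pluecker n k A ([0..<k][l := s]) = A $$ (s, l)"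
        using A top kn that(2,1) by (rule pluecker_graph)
      with pl[of "[0..<k][l := s]"] show ?thesis using dT0 unfolding dT[symmetric] by simp
    qed
  qed
qed

context flag_shape
begin

text \<open>Column l of the chart is column l of the normal form of the first subspace whose
  dimension exceeds l, so it lies in that subspace and in all later ones. Entries on or above the
  diagonal fall into identity blocks, so the top block is unitriangular and the columns are
  independent; equal dimension then gives equal subspaces. Columns beyond all dimensions are unit
  vectors and occur only for L = n.\<close>

lemma chart_flag:
  fixes X :: "nat \<Rightarrow> 'a::field mat"
  assumes X: "\<And>j. j < m \<Longrightarrow> X j \<in> carrier_mat n L" "\<And>j. j < m \<Longrightarrow> col_inj (X j)"
    and p: "p \<in> homogeneous_coords ks n (flag_tuple_of m ks X)"
    and nz: "\<And>j i. j < m \<Longrightarrow> i < length ks \<Longrightarrow> p (j, i, [0..<ks ! i]) \<noteq> 0" and j: "j < m"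
  shows "col_inj (chart ks n L p j)" "flag_of ks (chart ks n L p j) = flag_of ks (X j)"
proof -
  let ?C = "chart ks n L p j"
  define idx where "idx l = (LEAST i. i < length ks \<and> l < ks ! i)" for l
  have idx: "idx l < length ks" "l < ks ! idx l" "idx l \<le> i" if "i < length ks" "l < ks ! i" for l i
  proof -
    have P: "i < length ks \<and> l < ks ! i" using that by simp
    show "idx l < length ks" "l < ks ! idx l"
      unfolding idx_def using LeastI[of "\<lambda>i. i < length ks \<and> l < ks ! i", OF P] by auto
    show "idx l \<le> i"
      unfolding idx_def using P by (rule Least_le)
  qed
  have len: "length (flag_tuple_of m ks X) = m" by (simp add: flag_tuple_of_def)
  obtain B where fr: "\<And>i. i < length ks \<Longrightarrow> is_frame n (ks ! i) (col_span (first_cols (ks ! i) (X j))) (B i)"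
    and pB: "\<And>i \<alpha>. i < length ks \<Longrightarrow> p (j, i, \<alpha>) = pluecker n (ks ! i) (B i) \<alpha>"
  proof -
    obtain B where B: "\<forall>j<m. \<forall>i<length ks. is_frame n (ks ! i) (flag_tuple_of m ks X ! j ! i) (B j i)"
      "p = (\<lambda>(j, i, \<alpha>). if j < m \<and> i < length ks then pluecker n (ks ! i) (B j i) \<alpha> else 0)"
      using p unfolding homogeneous_coords_def len by blast
    have "flag_tuple_of m ks X ! j ! i = col_span (first_cols (ks ! i) (X j))" if "i < length ks" for i
      using that j by (simp add: flag_tuple_of_def flag_of_def)
    with B j show ?thesis by (intro that[of "B j"]) auto
  qed
  define normal where "normal i A \<longleftrightarrow> A \<in> carrier_mat n (ks ! i) \<and> col_span A = col_span (first_cols (ks ! i) (X j)) \<and>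
    (\<forall>a b. a < ks ! i \<longrightarrow> b < ks ! i \<longrightarrow> A $$ (a, b) = (if a = b then 1 else 0)) \<and>
    (\<forall>s l. s < n \<longrightarrow> l < ks ! i \<longrightarrow> A $$ (s, l) = p (j, i, [0..<ks ! i][l := s]) / p (j, i, [0..<ks ! i]))"
    for i A
  have "\<exists>A. normal i A" if i: "i < length ks" for i
  proof -
    have B: "B i \<in> carrier_mat n (ks ! i)" "col_span (B i) = col_span (first_cols (ks ! i) (X j))"
      using fr[OF i] by (auto simp: is_frame_iff)
    have "pluecker n (ks ! i) (B i) [0..<ks ! i] \<noteq> 0" using nz[OF j i] pB[OF i] by simp
    from B(1) le_n[OF nth_mem[OF i]] this show ?thesis
      by (rule pluecker_ratio) (auto simp: normal_def B(2) pB[OF i])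
  qed
  then obtain A where "\<And>i. i < length ks \<Longrightarrow> normal i (A i)" by metis
  then have A: "\<And>i. i < length ks \<Longrightarrow> A i \<in> carrier_mat n (ks ! i)"
    "\<And>i. i < length ks \<Longrightarrow> col_span (A i) = col_span (first_cols (ks ! i) (X j))"
    "\<And>i a b. i < length ks \<Longrightarrow> a < ks ! i \<Longrightarrow> b < ks ! i \<Longrightarrow> A i $$ (a, b) = (if a = b then 1 else 0)"
    "\<And>i s l. i < length ks \<Longrightarrow> s < n \<Longrightarrow> l < ks ! i \<Longrightarrow>
      A i $$ (s, l) = p (j, i, [0..<ks ! i][l := s]) / p (j, i, [0..<ks ! i])"
    by (simp_all add: normal_def)
  have entry: "?C $$ (s, l) = A (idx l) $$ (s, l)" if "i < length ks" "l < ks ! i" "s < n" for i l s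
  proof -
    have "l < L" using that le_L[of "ks ! i"] by simp
    then show ?thesis
      using that idx[OF that(1,2)] A(4)[of "idx l" s l]
      by (auto simp: chart_def idx_def Let_def)
  qed
  \<comment> \<open>From s \<le> l < \<open>ks ! idx l\<close> the entry lies in the identity block
    of its normal form.\<close>
  have tri: "?C $$ (s, l) = (if s = l then 1 else 0)" if "s \<le> l" "l < L" for s l
  proof (cases "\<exists>i<length ks. l < ks ! i")
    case True
    then obtain i where i: "i < length ks" "l < ks ! i" by auto
    then show ?thesis
      using entry[OF i, of s] A(3)[of "idx l" s l] idx[OF i] that L_le_n by auto
  next
    case False
    then show ?thesis using that L_le_n by (auto simp: chart_def)
  qed
  show inj: "col_inj ?C"
  proof (rule col_inj_of_top[OF chart_carrier L_le_n])
    let ?T = "mat L L (\<lambda>(a, b). ?C $$ (a, b))"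
    have "det ?T = prod_list (diag_mat ?T)"
      using tri by (intro det_lower_triangular[of L]) auto
    also have "diag_mat ?T = map (\<lambda>_. 1) [0..<L]" using tri by (auto simp: diag_mat_def)
    finally show "det ?T \<noteq> 0" by (simp add: map_replicate_const)
  qed
  have "col_span (first_cols (ks ! i) ?C) = col_span (first_cols (ks ! i) (X j))" if i: "i < length ks" for i
  proof -
    have kL: "ks ! i \<le> L" using i le_L by simp
    have sub: "col (first_cols (ks ! i) ?C) l \<in> col_span (first_cols (ks ! i) (X j))" if l: "l < ks ! i" for l
    proof -
      note idx' = idx[OF i l]
      have "col (first_cols (ks ! i) ?C) l = col (A (idx l)) l"
        using A(1)[OF idx'(1)] idx'(2) entry[OF i l] l
        by (intro eq_vecI) (auto simp: first_cols_def chart_def)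
      also have "\<dots> \<in> col_span (A (idx l))" using A(1)[OF idx'(1)] idx'(2) by (rule col_in_col_span)
      also have "\<dots> = col_span (first_cols (ks ! idx l) (X j))" using A(2)[OF idx'(1)] .
      also have "\<dots> \<subseteq> col_span (first_cols (ks ! i) (X j))"
        using sorted_nth_mono[OF sorted idx'(3) i] kL by (rule col_span_first_cols_mono[OF X(1)[OF j]])
      finally show ?thesis .
    qed
    have c: "first_cols (ks ! i) (X j) \<in> carrier_mat n (ks ! i)" using X(1)[OF j] by simp
    have "first_cols (ks ! i) ?C \<in> carrier_mat n (ks ! i)"
      using chart_carrier by (rule first_cols_carrier)
    from col_span_subset_eq[OF c this col_inj_first_cols[OF chart_carrier kL inj] sub]
    show ?thesis by metis
  qed
  then show "flag_of ks ?C = flag_of ks (X j)"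
    by (auto simp: flag_of_def in_set_conv_nth)
qed

text \<open>Over a point of the orbit the chart matrix and \<open>g * A j\<close> define the same
  flag, so they differ by a parabolic factor, which is merged with the prescribed
  \<open>b j\<close>.\<close>

lemma mat_orbit_chart:
  fixes A :: "nat \<Rightarrow> 'a::field mat"
  assumes A: "\<And>j. j < m \<Longrightarrow> A j \<in> carrier_mat n L" "\<And>j. j < m \<Longrightarrow> col_inj (A j)"
    and z: "z \<in> orbit (PGL TYPE('a) n) PGL_act (flag_tuple_of m ks A)"
    and p: "p \<in> homogeneous_coords ks n z"
    and nz: "\<And>j i. j < m \<Longrightarrow> i < length ks \<Longrightarrow> p (j, i, [0..<ks ! i]) \<noteq> 0"
    and b: "\<And>j. j < m \<Longrightarrow> b j \<in> parabolic ks L"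
    and x: "\<And>j. j < m \<Longrightarrow> mats n L x j = chart ks n L p j * b j"
  shows "x \<in> mat_orbit m n L (parabolic ks L) A"
proof -
  have "flag_tuple_of m ks A \<in> flag_tuples TYPE('a) m ks n" using A by (rule flag_tuple_of_in)
  then obtain g where g: "g \<in> carrier_mat n n" "det g \<noteq> 0" "z = mat_act g (flag_tuple_of m ks A)"
    using z PGL_orbit_eq by blast
  have "mat_act g (flag_tuple_of m ks A) = flag_tuple_of m ks (\<lambda>j. g * A j)"
    using A(1) g(1) by (rule mat_act_flag_tuple_of)
  then have p': "p \<in> homogeneous_coords ks n (flag_tuple_of m ks (\<lambda>j. g * A j))" using p g(3) by simp
  have gA: "g * A j \<in> carrier_mat n L" "col_inj (g * A j)" if "j < m" for j
    using A[OF that] g col_inj_iff_det[OF g(1)] by (auto intro: col_inj_mult)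
  have "\<exists>b'. b' \<in> parabolic ks L \<and> chart ks n L p j = g * A j * b'" if j: "j < m" for j
  proof -
    have "col_inj (chart ks n L p j)" using gA p' nz j by (rule chart_flag(1))
    moreover have "flag_of ks (chart ks n L p j) = flag_of ks (g * A j)" using gA p' nz j by (rule chart_flag(2))
    ultimately show ?thesis using flag_of_eqD[OF chart_carrier _ gA[OF j]] by metis
  qed
  then obtain b' where b': "\<And>j. j < m \<Longrightarrow> b' j \<in> parabolic ks L" "\<And>j. j < m \<Longrightarrow> chart ks n L p j = g * A j * b' j"
    by metis
  have "b' j * b j \<in> parabolic ks L \<and> mats n L x j = g * A j * (b' j * b j)" if j: "j < m" for j
  proof
    show "b' j * b j \<in> parabolic ks L" using b'(1)[OF j] b[OF j] by (rule parabolic_mult)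
    have "b' j \<in> carrier_mat L L" "b j \<in> carrier_mat L L" using b'(1)[OF j] b[OF j] by (auto simp: parabolic_def)
    then show "mats n L x j = g * A j * (b' j * b j)"
      unfolding x[OF j] b'(2)[OF j] by (rule assoc_mult_mat[OF gA(1)[OF j]])
  qed
  then have "\<forall>j<m. b' j * b j \<in> parabolic ks L \<and> mats n L x j = g * A j * (b' j * b j)" by blast
  then show ?thesis
    unfolding mat_orbit_def using g(1,2)
    by (intro CollectI bexI[of _ g] conjI exI[of _ "\<lambda>j. b' j * b j"])
qed

lemma chart_regular:
  assumes "j < m" "s < n" "l < L"
  shows "(\<lambda>p. chart ks n L p j $$ (s, l) :: 'a::field)
    \<in> regular_on {p. \<forall>j<m. \<forall>i<length ks. p (j, i, [0..<ks ! i]) \<noteq> 0}"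
proof (cases "\<exists>i<length ks. l < ks ! i")
  case True
  define i where "i = (LEAST i. i < length ks \<and> l < ks ! i)"
  have "i < length ks" using LeastI_ex[of "\<lambda>i. i < length ks \<and> l < ks ! i"] True by (auto simp: i_def)
  then have "(\<lambda>p. p (j, i, [0..<ks ! i][l := s]) / p (j, i, [0..<ks ! i]) :: 'a)
    \<in> regular_on {p. \<forall>j<m. \<forall>i<length ks. p (j, i, [0..<ks ! i]) \<noteq> 0}"
    using assms by (intro regular_divide polynomial_regular polynomial_functions.coord) auto
  then show ?thesis using True assms by (simp add: chart_def Let_def i_def)
next
  case False
  then have "chart ks n L p j $$ (s, l) = (if s = l then 1 else 0)" for p :: "_ \<Rightarrow> 'a"
    using assms by (auto simp: chart_def)
  then show ?thesis by (auto intro: regular.const)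
qed

text \<open>The chart, multiplied by fixed parabolic matrices, is a rational map from coordinates to
  matrices. The factors are fitted to a given tuple \<open>x\<close> so that the coordinates of its
  flags are sent to \<open>x\<close>. Clearing denominators turns vanishing on matrices into a
  closed condition on flags.\<close>

lemma dense_mat_orbit_if_dense_PGL_action:
  assumes "dense_PGL_action TYPE('a::alg_closed_field) m ks n"
  shows "dense_mat_orbit m n L (parabolic ks L :: 'a mat set)"
proof -
  obtain x0 where x0: "x0 \<in> flag_tuples TYPE('a) m ks n"
    and dense: "zariski_dense TYPE('a) m ks n (orbit (PGL TYPE('a) n) PGL_act x0)"
    using assms unfolding dense_PGL_action_def by blast
  have denseD: "Z = flag_tuples TYPE('a) m ks n"
    if "zariski_closed TYPE('a) m ks n Z" "orbit (PGL TYPE('a) n) PGL_act x0 \<subseteq> Z" for Z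
    using dense that unfolding zariski_dense_def by blast
  obtain A where A: "\<And>j. j < m \<Longrightarrow> A j \<in> carrier_mat n L" "\<And>j. j < m \<Longrightarrow> col_inj (A j)"
    "flag_tuple_of m ks A = x0"
    using flag_tuples_eq_flag_tuple_of[OF x0] by metis
  let ?top = "\<lambda>j k x. det (mat k k (\<lambda>(a, b). x (j, a, b))) :: 'a"
  \<comment> \<open>The minors of size \<open>L\<close> make the columns independent; those of size
    \<open>ks ! i\<close> put the flags into the domain of the chart.\<close>
  define d where "d x = (\<Prod>j<m. ?top j L x * (\<Prod>i<length ks. ?top j (ks ! i) x))"
    for x :: "nat \<times> nat \<times> nat \<Rightarrow> 'a"
  have d: "d \<in> polynomial_functions"
  proof -
    have "(\<lambda>x. ?top j k x) \<in> polynomial_functions" for j k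
      by (intro polynomial.det[of _ k]) (auto intro: polynomial_functions.intros)
    then show ?thesis unfolding d_def by (intro polynomial.prod polynomial.mult) auto
  qed
  have "mat k k (\<lambda>(a, b). if a = b then 1 else 0) = (1\<^sub>m k :: 'a mat)" for k by (intro eq_matI) auto
  then have d1: "d (\<lambda>(j, a, b). if a = b then 1 else 0) \<noteq> 0" by (simp add: d_def)
  have "poly_dense (mat_orbit m n L (parabolic ks L) A)"
    unfolding poly_dense_def
  proof (intro ballI impI allI)
    fix h :: "(nat \<times> nat \<times> nat \<Rightarrow> 'a) \<Rightarrow> 'a" and x
    assume h: "h \<in> polynomial_functions"
      and h0: "\<forall>x\<in>mat_orbit m n L (parabolic ks L) A. h x = 0"
    have h_zero: "h x = 0" if dx: "d x \<noteq> 0" for x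
    proof -
      let ?X = "mats n L x"
      have top: "?top j L x \<noteq> 0" "\<And>i. i < length ks \<Longrightarrow> ?top j (ks ! i) x \<noteq> 0" if "j < m" for j
        using dx that by (auto simp: d_def)
      have topX: "mat k k (\<lambda>(a, b). ?X j $$ (a, b)) = mat k k (\<lambda>(a, b). x (j, a, b))" if "k \<le> L" for j k
        using that L_le_n by (intro eq_matI) auto
      have X: "?X j \<in> carrier_mat n L" "col_inj (?X j)" if "j < m" for j
        using top(1)[OF that] topX[of L j] L_le_n by (auto intro!: col_inj_of_top[of _ n L])
      define p where "p = (\<lambda>(j, i, \<alpha>). if j < m \<and> i < length ks
        then pluecker n (ks ! i) (first_cols (ks ! i) (?X j)) \<alpha> else 0)"
      have p: "p \<in> homogeneous_coords ks n (flag_tuple_of m ks ?X)"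
      proof -
        have "is_frame n (ks ! i) (flag_tuple_of m ks ?X ! j ! i) (first_cols (ks ! i) (?X j))"
          if "j < m" "i < length ks" for j i
          using frame_first_cols[OF X[OF that(1)] nth_mem[OF that(2)]] that
          by (simp add: flag_tuple_of_def flag_of_def)
        moreover have "length (flag_tuple_of m ks ?X) = m" by (simp add: flag_tuple_of_def)
        ultimately show ?thesis
          unfolding homogeneous_coords_def p_def
          by (intro CollectI exI[of _ "\<lambda>j i. first_cols (ks ! i) (?X j)"]) auto
      qed
      have pnz: "p (j, i, [0..<ks ! i]) \<noteq> 0" if ji: "j < m" "i < length ks" for j i
      proof -
        have k: "ks ! i \<le> L" "ks ! i \<le> n" using ji le_L le_n by auto
        have "mat (ks ! i) (ks ! i) (\<lambda>(a, b). first_cols (ks ! i) (?X j) $$ ([0..<ks ! i] ! a, b))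
          = mat (ks ! i) (ks ! i) (\<lambda>(a, b). x (j, a, b))"
          using k by (intro eq_matI) (auto simp: first_cols_def mats_def)
        moreover have "set [0..<ks ! i] \<subseteq> {..<n}" using k by auto
        ultimately show ?thesis using top(2)[OF ji] ji by (simp add: p_def pluecker_def)
      qed
      have "\<exists>b. b \<in> parabolic ks L \<and> ?X j = chart ks n L p j * b" if j: "j < m" for j
      proof -
        have "col_inj (chart ks n L p j)" using X p pnz j by (rule chart_flag(1))
        moreover have "flag_of ks (chart ks n L p j) = flag_of ks (?X j)" using X p pnz j by (rule chart_flag(2))
        ultimately show ?thesis using flag_of_eqD[OF X[OF j] chart_carrier] by metis
      qed
      \<comment> \<open>The discrepancy between \<open>x\<close> and the chart of its own flags; it
        is kept fixed while the coordinates vary.\<close>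
      then obtain b where b: "\<And>j. j < m \<Longrightarrow> b j \<in> parabolic ks L" "\<And>j. j < m \<Longrightarrow> ?X j = chart ks n L p j * b j"
        by metis
      have bc: "b j \<in> carrier_mat L L" if "j < m" for j using b(1)[OF that] by (simp add: parabolic_def)
      let ?U = "{p :: nat \<times> nat \<times> nat list \<Rightarrow> 'a. \<forall>j<m. \<forall>i<length ks. p (j, i, [0..<ks ! i]) \<noteq> 0}"
      define \<phi> where "\<phi> q = (\<lambda>(j, s, l). if j < m \<and> s < n \<and> l < L
        then (chart ks n L q j * b j) $$ (s, l) else x (j, s, l))" for q
      have reg: "(\<lambda>q. h (\<phi> q)) \<in> regular_on ?U"
      proof (rule regular.polynomial_comp[of h \<phi>, OF h])
        fix t :: "nat \<times> nat \<times> nat"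
        obtain j s l where t: "t = (j, s, l)" by (cases t)
        show "(\<lambda>q. \<phi> q t) \<in> regular_on ?U"
        proof (cases "j < m \<and> s < n \<and> l < L")
          case True
          then have "(\<lambda>q. (chart ks n L q j * b j) $$ (s, l)) \<in> regular_on ?U"
            using bc by (intro regular.mat_mult[of _ n L _ L] chart_regular regular.const) auto
          with True show ?thesis by (simp add: t \<phi>_def)
        next
          case False
          then show ?thesis unfolding t \<phi>_def by (auto intro: regular.const)
        qed
      qed
      then obtain P Q where P: "P \<in> polynomial_functions" and "Q \<in> polynomial_functions" and Q: "\<And>q. q \<in> ?U \<Longrightarrow> Q q \<noteq> 0"
        and PQ: "\<And>q. q \<in> ?U \<Longrightarrow> h (\<phi> q) * Q q = P q"
        by (rule regular_onE) (rule that)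
      \<comment> \<open>The extra product makes \<open>F\<close> vanish outside the domain of the
        chart too, so that one equation defines a closed set containing the whole orbit.\<close>
      define F where "F q = P q * (\<Prod>j<m. \<Prod>i<length ks. q (j, i, [0..<ks ! i]))" for q
      have F: "F \<in> polynomial_functions"
        unfolding F_def by (intro polynomial.mult polynomial.prod P polynomial_functions.coord)
      let ?Z = "{xs \<in> flag_tuples TYPE('a) m ks n. \<forall>f\<in>{F}. \<forall>p\<in>homogeneous_coords ks n xs. f p = 0}"
      have "zariski_closed TYPE('a) m ks n ?Z"
        unfolding zariski_closed_def using F by (intro exI[of _ "{F}"]) auto
      moreover have "orbit (PGL TYPE('a) n) PGL_act x0 \<subseteq> ?Z"
      proof
        fix z assume z: "z \<in> orbit (PGL TYPE('a) n) PGL_act x0"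
        then have zf: "z \<in> flag_tuples TYPE('a) m ks n" using dense by (auto simp: zariski_dense_def)
        have "F q = 0" if q: "q \<in> homogeneous_coords ks n z" for q
        proof (cases "q \<in> ?U")
          case True
          have "\<phi> q \<in> mat_orbit m n L (parabolic ks L) A"
          proof (rule mat_orbit_chart[OF A(1,2) _ q])
            show "z \<in> orbit (PGL TYPE('a) n) PGL_act (flag_tuple_of m ks A)" using z A(3) by simp
            show "mats n L (\<phi> q) j = chart ks n L q j * b j" if "j < m" for j
              unfolding \<phi>_def
              by (rule mats_override[of j m "\<lambda>j. chart ks n L q j * b j"]) (use that mult_carrier_mat[OF chart_carrier bc[OF that]] in auto)
          qed (use True b(1) in auto)
          then have "P q = 0" using PQ[OF True] h0 by simp
          then show ?thesis by (simp add: F_def)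
        next
          case False
          then show ?thesis by (auto simp: F_def)
        qed
        with zf show "z \<in> ?Z" by auto
      qed
      ultimately have "?Z = flag_tuples TYPE('a) m ks n" by (rule denseD)
      moreover have "flag_tuple_of m ks ?X \<in> flag_tuples TYPE('a) m ks n" using X by (rule flag_tuple_of_in)
      ultimately have "flag_tuple_of m ks ?X \<in> ?Z" by simp
      then have "F p = 0" using p by simp
      moreover have pU: "p \<in> ?U" using pnz by auto
      moreover have "(\<Prod>j<m. \<Prod>i<length ks. p (j, i, [0..<ks ! i])) \<noteq> 0" using pnz by auto
      ultimately have "P p = 0" by (simp add: F_def)
      then have "h (\<phi> p) = 0" using PQ[OF pU] Q[OF pU] by auto
      moreover have "\<phi> p = x"
        unfolding \<phi>_def by (auto simp: fun_eq_iff b(2)[symmetric])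
      ultimately show "h x = 0" by simp
    qed
    have hd: "h x * d x = 0" for x
    proof (cases "d x = 0")
      case False
      then have "h x = 0" by (rule h_zero)
      then show ?thesis by simp
    qed simp
    show "h x = 0" by (rule polynomial_functions_no_zero_divisors[where f = h and g = d, OF h d hd d1])
  qed
  then show ?thesis
    unfolding dense_mat_orbit_def using A(1) by (intro exI[of _ A] conjI) simp_all
qed

theorem dense_PGL_action_iff:
  "dense_PGL_action TYPE('a::alg_closed_field) m ks n
    \<longleftrightarrow> dense_mat_orbit m n L (parabolic ks L :: 'a mat set)"
  using dense_PGL_action_if_dense_mat_orbit dense_mat_orbit_if_dense_PGL_action by blast

end

section \<open>Block matrices\<close>

definition row_block :: "nat \<Rightarrow> nat \<Rightarrow> 'a mat \<Rightarrow> 'a mat" where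
  "row_block K j Y = mat K K (\<lambda>(a, b). Y $$ (j * K + a, b))"

definition block_inj :: "nat \<Rightarrow> nat \<Rightarrow> nat \<Rightarrow> 'a::field mat" where
  "block_inj q K j = mat (q * K) K (\<lambda>(a, b). if a = j * K + b then 1 else 0)"

text \<open>The diagonal embedding v -> (v, ..., v) into q summands. Its image is the graph of the
  identities between the summands, the standard choice for the last subspace.\<close>

definition diag_inj :: "nat \<Rightarrow> nat \<Rightarrow> 'a::field mat" where
  "diag_inj q K = mat (q * K) K (\<lambda>(a, b). if a mod K = b then 1 else 0)"

definition block_diag :: "nat \<Rightarrow> nat \<Rightarrow> (nat \<Rightarrow> 'a::field mat) \<Rightarrow> 'a mat" where
  "block_diag q K E = mat (q * K) (q * K) (\<lambda>(a, c).
     if a div K = c div K then E (a div K) $$ (a mod K, c mod K) else 0)"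

definition block_row :: "nat \<Rightarrow> nat \<Rightarrow> (nat \<Rightarrow> 'a mat) \<Rightarrow> 'a mat" where
  "block_row q K X = mat (q * K) (q * K) (\<lambda>(a, c). X (c div K) $$ (a, c mod K))"

lemma block_carriers [simp]:
  "row_block K j Y \<in> carrier_mat K K" "block_inj q K j \<in> carrier_mat (q * K) K"
  "diag_inj q K \<in> carrier_mat (q * K) K" "block_diag q K E \<in> carrier_mat (q * K) (q * K)"
  "block_row q K X \<in> carrier_mat (q * K) (q * K)"
  by (simp_all add: row_block_def block_inj_def diag_inj_def block_diag_def block_row_def)

lemma block_index: "j < q \<Longrightarrow> a < K \<Longrightarrow> j * K + a < q * (K::nat)"
proof -
  assume "j < q" "a < K"
  then have "j * K + a < Suc j * K" by simp
  also have "\<dots> \<le> q * K" using \<open>j < q\<close> by (intro mult_right_mono) auto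
  finally show ?thesis .
qed

lemma block_indexE:
  assumes "c < q * (K::nat)"
  obtains j a where "j < q" "a < K" "c = j * K + a"
proof (rule that)
  have K: "K > 0" using assms by (cases K) auto
  show "c div K < q" using assms by (simp add: less_mult_imp_div_less)
  show "c mod K < K" using K by simp
  show "c = c div K * K + c mod K" by simp
qed

lemma sum_block:
  fixes f :: "nat \<Rightarrow> 'a::comm_monoid_add"
  assumes "j < q"
  shows "(\<Sum>c = 0..<q * K. if j = c div K then f c else 0) = (\<Sum>t = 0..<K. f (j * K + t))"
proof -
  have "(\<Sum>c = 0..<q * K. if j = c div K then f c else 0) = sum f ((\<lambda>t. j * K + t) ` {0..<K})"
  proof (rule sum.mono_neutral_cong_right)
    show "(\<lambda>t. j * K + t) ` {0..<K} \<subseteq> {0..<q * K}"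
      by (rule image_subsetI) (simp add: block_index[OF assms])
    show "\<forall>c\<in>{0..<q * K} - (\<lambda>t. j * K + t) ` {0..<K}. (if j = c div K then f c else 0) = 0"
    proof
      fix c assume "c \<in> {0..<q * K} - (\<lambda>t. j * K + t) ` {0..<K}"
      then have c: "c < q * K" "c \<notin> (\<lambda>t. j * K + t) ` {0..<K}" by simp_all
      from c(1) obtain i a where "a < K" "c = i * K + a" by (rule block_indexE)
      then have "c div K = i" by simp
      with c(2) \<open>a < K\<close> \<open>c = i * K + a\<close> have "c div K \<noteq> j" by (metis atLeast0LessThan image_eqI lessThan_iff)
      then show "(if j = c div K then f c else 0) = 0" by simp
    qed
    show "(if j = c div K then f c else 0) = f c" if "c \<in> (\<lambda>t. j * K + t) ` {0..<K}" for c
      using that by (elim imageE) simp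
  qed simp
  also have "\<dots> = (\<Sum>t = 0..<K. f (j * K + t))" by (subst sum.reindex) (auto simp: inj_on_def)
  finally show ?thesis .
qed

lemma row_block_eqI:
  assumes A: "A \<in> carrier_mat (q * K) K" and B: "B \<in> carrier_mat (q * K) K"
    and eq: "\<And>j. j < q \<Longrightarrow> row_block K j A = row_block K j B"
  shows "A = B"
proof (rule eq_matI)
  fix c b assume "c < dim_row B" "b < dim_col B"
  then have c: "c < q * K" and b: "b < K" using B by auto
  from c obtain j a where ja: "j < q" "a < K" "c = j * K + a" by (rule block_indexE)
  have "A $$ (c, b) = row_block K j A $$ (a, b)" using ja b by (simp add: row_block_def)
  also have "\<dots> = B $$ (c, b)" unfolding eq[OF ja(1)] using ja b by (simp add: row_block_def)
  finally show "A $$ (c, b) = B $$ (c, b)" .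
qed (use A B in auto)

lemma row_block_mult:
  assumes Y: "Y \<in> carrier_mat (q * K) K" and C: "C \<in> carrier_mat K K" and j: "j < q"
  shows "row_block K j (Y * C) = row_block K j Y * C"
proof (rule eq_matI)
  fix a b assume "a < dim_row (row_block K j Y * C)" "b < dim_col (row_block K j Y * C)"
  then have "a < K" "b < K" using C by (auto simp: row_block_def)
  then show "row_block K j (Y * C) $$ (a, b) = (row_block K j Y * C) $$ (a, b)"
    using Y C block_index[OF j, of a K] by (simp add: row_block_def scalar_prod_def)
qed (use C in \<open>auto simp: row_block_def\<close>)

lemma row_block_smult:
  assumes Y: "Y \<in> carrier_mat (q * K) K" and j: "j < q"
  shows "row_block K j (c \<cdot>\<^sub>m Y) = c \<cdot>\<^sub>m row_block K j Y"
  using Y block_index[OF j] by (intro eq_matI) (auto simp: row_block_def)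

lemma row_block_block_diag_mult:
  fixes E :: "nat \<Rightarrow> 'a::field mat"
  assumes E: "E j \<in> carrier_mat K K" and Y: "Y \<in> carrier_mat (q * K) K" and j: "j < q"
  shows "row_block K j (block_diag q K E * Y) = E j * row_block K j Y"
proof (rule eq_matI)
  fix a b assume "a < dim_row (E j * row_block K j Y)" "b < dim_col (E j * row_block K j Y)"
  then have ab: "a < K" "b < K" using E by (auto simp: row_block_def)
  have i: "j * K + a < q * K" using block_index[OF j ab(1)] .
  have "row_block K j (block_diag q K E * Y) $$ (a, b)
    = (\<Sum>c = 0..<q * K. block_diag q K E $$ (j * K + a, c) * Y $$ (c, b))"
    using ab i Y by (simp add: row_block_def scalar_prod_def block_diag_def)
  also have "\<dots> = (\<Sum>c = 0..<q * K. if j = c div K then E j $$ (a, c mod K) * Y $$ (c, b) else 0)"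
    using ab i by (intro sum.cong) (auto simp: block_diag_def)
  also have "\<dots> = (\<Sum>t = 0..<K. E j $$ (a, t) * Y $$ (j * K + t, b))"
    unfolding sum_block[OF j] by (intro sum.cong) auto
  also have "\<dots> = (E j * row_block K j Y) $$ (a, b)"
    using ab E by (simp add: row_block_def scalar_prod_def)
  finally show "row_block K j (block_diag q K E * Y) $$ (a, b) = (E j * row_block K j Y) $$ (a, b)" .
qed (use E in \<open>auto simp: row_block_def\<close>)

lemma row_block_block_inj:
  "i < q \<Longrightarrow> j < q \<Longrightarrow> row_block K j (block_inj q K i) = (if i = j then 1\<^sub>m K else 0\<^sub>m K K)"
proof (rule eq_matI)
  fix a b assume ij: "i < q" "j < q"
    and "a < dim_row (if i = j then 1\<^sub>m K else 0\<^sub>m K K :: 'a mat)"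
      "b < dim_col (if i = j then 1\<^sub>m K else 0\<^sub>m K K :: 'a mat)"
  then have ab: "a < K" "b < K" by (auto split: if_splits)
  have "j * K + a = i * K + b \<longleftrightarrow> i = j \<and> a = b"
  proof
    assume eq: "j * K + a = i * K + b"
    have "(j * K + a) div K = j" "(i * K + b) div K = i" using ab by simp_all
    then have "i = j" using eq by metis
    with eq show "i = j \<and> a = b" by simp
  qed auto
  then show "row_block K j (block_inj q K i) $$ (a, b)
      = (if i = j then 1\<^sub>m K else 0\<^sub>m K K :: 'a mat) $$ (a, b)"
    using ab ij block_index[of j q a K] by (auto simp: row_block_def block_inj_def)
qed (auto simp: row_block_def)

lemma row_block_diag_inj: "j < q \<Longrightarrow> row_block K j (diag_inj q K) = 1\<^sub>m K"
  using block_index[of j q _ K] by (intro eq_matI) (auto simp: row_block_def diag_inj_def)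

lemma mult_block_inj_index:
  assumes M: "M \<in> carrier_mat n (q * K)" and j: "j < q" and ab: "a < n" "b < K"
  shows "(M * block_inj q K j) $$ (a, b) = M $$ (a, j * K + b)"
proof -
  have "(M * block_inj q K j) $$ (a, b)
      = (\<Sum>c = 0..<q * K. M $$ (a, c) * (if c = j * K + b then 1 else 0))"
    using assms by (simp add: block_inj_def scalar_prod_def)
  also have "\<dots> = M $$ (a, j * K + b)"
    using block_index[OF j ab(2)] by (simp add: if_distrib[of "\<lambda>x. _ * x"] cong: if_cong)
  finally show ?thesis .
qed

text \<open>A matrix with q K columns is determined by its restrictions to the q summands;
  identities between block matrices are checked in this way, without computing with
  \<open>div\<close> and \<open>mod\<close>.\<close>

lemma mult_block_inj_eqI:
  assumes M: "M \<in> carrier_mat n (q * K)" and M': "M' \<in> carrier_mat n (q * K)"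
    and eq: "\<And>j. j < q \<Longrightarrow> M * block_inj q K j = M' * block_inj q K j"
  shows "M = M'"
proof (rule eq_matI)
  fix a c assume "a < dim_row M'" "c < dim_col M'"
  then have a: "a < n" and c: "c < q * K" using M' by auto
  from c obtain j b where jb: "j < q" "b < K" "c = j * K + b" by (rule block_indexE)
  show "M $$ (a, c) = M' $$ (a, c)"
    unfolding jb(3)
    using mult_block_inj_index[OF M jb(1) a jb(2)] mult_block_inj_index[OF M' jb(1) a jb(2)]
      eq[OF jb(1)] by simp
qed (use M M' in auto)

lemma block_row_mult_block_inj:
  assumes X: "X j \<in> carrier_mat (q * K) K" and j: "j < q"
  shows "block_row q K X * block_inj q K j = X j"
proof (rule eq_matI)
  fix a b assume "a < dim_row (X j)" "b < dim_col (X j)"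
  then have ab: "a < q * K" "b < K" using X by auto
  show "(block_row q K X * block_inj q K j) $$ (a, b) = X j $$ (a, b)"
    using mult_block_inj_index[OF block_carriers(5) j ab] ab block_index[OF j ab(2)]
    by (simp add: block_row_def)
qed (use X in \<open>auto simp: block_row_def block_inj_def\<close>)

lemma block_diag_mult_block_inj:
  fixes E :: "nat \<Rightarrow> 'a::field mat"
  assumes E: "\<And>j. j < q \<Longrightarrow> E j \<in> carrier_mat K K" and j: "j < q"
  shows "block_diag q K E * block_inj q K j = block_inj q K j * E j"
proof (rule row_block_eqI)
  show "block_diag q K E * block_inj q K j \<in> carrier_mat (q * K) K"
    by (rule mult_carrier_mat[OF block_carriers(4,2)])
  show "block_inj q K j * E j \<in> carrier_mat (q * K) K"
    by (rule mult_carrier_mat[OF block_carriers(2) E[OF j]])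
  fix i assume i: "i < q"
  show "row_block K i (block_diag q K E * block_inj q K j) = row_block K i (block_inj q K j * E j)"
    unfolding row_block_block_diag_mult[of E i, OF E[OF i] block_carriers(2) i]
      row_block_mult[OF block_carriers(2) E[OF j] i] row_block_block_inj[OF j i]
    using E[OF i] E[OF j] by auto
qed

text \<open>A tall matrix is the image of the diagonal under the block diagonal matrix of its own
  blocks. With invertible blocks this moves the diagonal to a given subspace in general position
  while keeping the summands.\<close>

lemma block_diag_mult_diag_inj:
  fixes Y :: "'a::field mat"
  assumes Y: "Y \<in> carrier_mat (q * K) K"
  shows "block_diag q K (\<lambda>j. row_block K j Y) * diag_inj q K = Y"
proof (rule row_block_eqI)
  show "block_diag q K (\<lambda>j. row_block K j Y) * diag_inj q K \<in> carrier_mat (q * K) K"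
    by (rule mult_carrier_mat[OF block_carriers(4,3)])
  fix i assume i: "i < q"
  show "row_block K i (block_diag q K (\<lambda>j. row_block K j Y) * diag_inj q K) = row_block K i Y"
    unfolding row_block_block_diag_mult[of "\<lambda>j. row_block K j Y" i, OF block_carriers(1,3) i]
      row_block_diag_inj[OF i] by (rule right_mult_one_mat[OF block_carriers(1)])
qed (rule Y)

text \<open>Together with \<open>block_diag_mult_block_inj\<close>: equal blocks h preserve the
  summands and the diagonal and act on each of them as h. This is the diagonal copy of GL(K) in the
  stabiliser.\<close>

lemma block_diag_const_mult_diag_inj:
  fixes h :: "'a::field mat"
  assumes h: "h \<in> carrier_mat K K"
  shows "block_diag q K (\<lambda>_. h) * diag_inj q K = diag_inj q K * h"
proof (rule row_block_eqI)
  show "block_diag q K (\<lambda>_. h) * diag_inj q K \<in> carrier_mat (q * K) K"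
    by (rule mult_carrier_mat[OF block_carriers(4,3)])
  show "diag_inj q K * h \<in> carrier_mat (q * K) K"
    by (rule mult_carrier_mat[OF block_carriers(3) h])
  fix i assume i: "i < q"
  show "row_block K i (block_diag q K (\<lambda>_. h) * diag_inj q K) = row_block K i (diag_inj q K * h)"
    unfolding row_block_block_diag_mult[of "\<lambda>_. h" i, OF h block_carriers(3) i]
      row_block_mult[OF block_carriers(3) h i] row_block_diag_inj[OF i]
    using h by simp
qed

text \<open>An inverse is written down block by block, which suffices for a nonzero
  determinant.\<close>

lemma det_block_diag:
  fixes E :: "nat \<Rightarrow> 'a::field mat"
  assumes E: "\<And>j. j < q \<Longrightarrow> E j \<in> carrier_mat K K" "\<And>j. j < q \<Longrightarrow> det (E j) \<noteq> 0"
  shows "det (block_diag q K E) \<noteq> 0"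
proof -
  have "\<exists>F. F \<in> carrier_mat K K \<and> E j * F = 1\<^sub>m K" if "j < q" for j
    using det_nonzero_inverse[OF E(1)[OF that] E(2)[OF that]] by metis
  then obtain F where F: "\<And>j. j < q \<Longrightarrow> F j \<in> carrier_mat K K" "\<And>j. j < q \<Longrightarrow> E j * F j = 1\<^sub>m K"
    by metis
  have "block_diag q K E * block_diag q K F = 1\<^sub>m (q * K)"
  proof (rule mult_block_inj_eqI)
    fix j assume j: "j < q"
    have "block_diag q K E * block_diag q K F * block_inj q K j
      = block_diag q K E * (block_inj q K j * F j)"
      unfolding assoc_mult_mat[OF block_carriers(4) block_carriers(4) block_carriers(2)]
      using F(1) j by (simp only: block_diag_mult_block_inj)
    also have "\<dots> = block_diag q K E * block_inj q K j * F j"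
      by (rule assoc_mult_mat[OF block_carriers(4,2) F(1)[OF j], symmetric])
    also have "\<dots> = block_inj q K j * E j * F j"
      using E(1) j by (simp only: block_diag_mult_block_inj)
    also have "\<dots> = block_inj q K j * 1\<^sub>m K"
      unfolding assoc_mult_mat[OF block_carriers(2) E(1)[OF j] F(1)[OF j]] F(2)[OF j] ..
    also have "\<dots> = 1\<^sub>m (q * K) * block_inj q K j"
      unfolding right_mult_one_mat[OF block_carriers(2)] left_mult_one_mat[OF block_carriers(2)] ..
    finally show "block_diag q K E * block_diag q K F * block_inj q K j = 1\<^sub>m (q * K) * block_inj q K j" .
  qed (rule mult_carrier_mat[OF block_carriers(4,4)], simp)
  then have "det (block_diag q K E) * det (block_diag q K F) = 1"
    using det_mult[OF block_carriers(4) block_carriers(4), of q K E F] by simp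
  then show ?thesis by auto
qed

section \<open>Reduction to a single block\<close>

definition stack :: "nat \<Rightarrow> nat \<Rightarrow> (nat \<times> nat \<times> nat \<Rightarrow> 'a::field) \<Rightarrow> 'a mat" where
  "stack q K x = block_row q K (mats (q * K) K x)"

text \<open>Up to the factor \<open>det (stack q K x)\<close> these are the blocks of the last matrix with respect to
  the decomposition of the space given by the column spaces of the first \<open>q\<close> matrices.\<close>

definition last_block :: "nat \<Rightarrow> nat \<Rightarrow> (nat \<times> nat \<times> nat \<Rightarrow> 'a::field) \<Rightarrow> nat \<Rightarrow> 'a mat" where
  "last_block q K x j = row_block K j (adj_mat (stack q K x) * mats (q * K) K x q)"

text \<open>Nonzero exactly when the first q column spaces decompose the space as a direct sum and
  the last one projects isomorphically onto each summand.\<close>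

definition gen_pos :: "nat \<Rightarrow> nat \<Rightarrow> (nat \<times> nat \<times> nat \<Rightarrow> 'a::field) \<Rightarrow> 'a" where
  "gen_pos q K x = det (stack q K x) * (\<Prod>j<q. det (last_block q K x j))"

text \<open>The inverse of Y_j, the j-th block of the last matrix written in the basis
  \<open>stack q K x\<close>: \<open>last_block\<close> is the determinant of that basis times Y_j,
  which the scalar in front corrects. For a tuple in normal form the value is F_q^{-1} F_j, whatever
  \<open>X\<close> is.\<close>

definition rel_pos :: "nat \<Rightarrow> nat \<Rightarrow> (nat \<times> nat \<times> nat \<Rightarrow> 'a::field) \<Rightarrow> nat \<Rightarrow> 'a mat" where
  "rel_pos q K x j =
     (det (stack q K x) / det (last_block q K x j)) \<cdot>\<^sub>m adj_mat (last_block q K x j)"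

lemma stack_carrier [simp]: "stack q K x \<in> carrier_mat (q * K) (q * K)"
  by (simp add: stack_def)

lemma last_block_carrier [simp]: "last_block q K x j \<in> carrier_mat K K"
  by (simp add: last_block_def)

lemma rel_pos_carrier [simp]: "rel_pos q K x j \<in> carrier_mat K K"
  unfolding rel_pos_def by (rule smult_carrier_mat[OF adj_mat(1)[OF last_block_carrier]])

lemma last_block_polynomial:
  assumes j: "j < q" and ab: "a < K" "b < K"
  shows "(\<lambda>x. last_block q K x j $$ (a, b) :: 'a::field) \<in> polynomial_functions"
proof -
  have stack: "(\<lambda>x. stack q K x $$ (a, c) :: 'a) \<in> polynomial_functions"
    if "a < q * K" "c < q * K" for a c
  proof -
    have "c mod K < K" using ab by simp
    then show ?thesis
      using that by (simp add: stack_def block_row_def polynomial_functions.coord)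
  qed
  have "(\<lambda>x. (adj_mat (stack q K x) * mats (q * K) K x q) $$ (j * K + a, b) :: 'a) \<in> polynomial_functions"
  proof (rule polynomial.mat_mult[where M = "\<lambda>x. adj_mat (stack q K x)" and N = "\<lambda>x. mats (q * K) K x q"
        and n = "q * K" and l = "q * K" and k = K])
    show "adj_mat (stack q K x) \<in> carrier_mat (q * K) (q * K)" for x :: "_ \<Rightarrow> 'a"
      by (rule adj_mat(1)[OF stack_carrier])
    show "(\<lambda>x. adj_mat (stack q K x) $$ (a, b) :: 'a) \<in> polynomial_functions"
      if "a < q * K" "b < q * K" for a b
      by (rule polynomial.adj_mat[where M = "stack q K" and n = "q * K"]) (simp_all add: stack that)
  qed (use ab block_index[OF j ab(1)] in \<open>auto intro: polynomial_functions.coord\<close>)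
  then show ?thesis using ab by (simp add: last_block_def row_block_def)
qed

lemma stack_polynomial: "(\<lambda>x. det (stack q K x)) \<in> polynomial_functions"
proof (rule polynomial.det[of _ "q * K"])
  fix a c assume "a < q * K" "c < q * K"
  then show "(\<lambda>x. stack q K x $$ (a, c)) \<in> polynomial_functions"
    by (cases "K = 0") (simp_all add: stack_def block_row_def polynomial_functions.coord)
qed simp

lemma last_block_det_polynomial:
  "j < q \<Longrightarrow> (\<lambda>x. det (last_block q K x j)) \<in> polynomial_functions"
  by (rule polynomial.det[of _ K]) (simp_all add: last_block_polynomial)

lemma gen_pos_polynomial: "gen_pos q K \<in> polynomial_functions"
proof -
  have "(\<lambda>x. det (stack q K x) * (\<Prod>j<q. det (last_block q K x j))) \<in> polynomial_functions"
    by (intro polynomial.mult polynomial.prod stack_polynomial last_block_det_polynomial) simp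
  then show ?thesis by (simp add: gen_pos_def[abs_def])
qed

lemma gen_pos_nonzero:
  assumes "gen_pos q K x \<noteq> 0"
  shows "det (stack q K x) \<noteq> 0" "j < q \<Longrightarrow> det (last_block q K x j) \<noteq> 0"
  using assms by (auto simp: gen_pos_def)

lemma rel_pos_regular:
  assumes j: "j < q" and ab: "a < K" "b < K"
  shows "(\<lambda>x. rel_pos q K x j $$ (a, b) :: 'a::field) \<in> regular_on {x. gen_pos q K x \<noteq> 0}"
proof -
  have "(\<lambda>x. adj_mat (last_block q K x j) $$ (a, b) :: 'a) \<in> polynomial_functions"
    by (rule polynomial.adj_mat[where M = "\<lambda>x. last_block q K x j" and n = K])
      (simp_all add: last_block_polynomial j ab)
  then have "(\<lambda>x. det (stack q K x) / det (last_block q K x j) * adj_mat (last_block q K x j) $$ (a, b) :: 'a)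
    \<in> regular_on {x. gen_pos q K x \<noteq> 0}"
    using gen_pos_nonzero(2)[OF _ j]
    by (intro regular.mult regular_divide polynomial_regular stack_polynomial last_block_det_polynomial j)
      simp_all
  moreover have "rel_pos q K x j $$ (a, b)
      = det (stack q K x) / det (last_block q K x j) * adj_mat (last_block q K x j) $$ (a, b)" for x :: "_ \<Rightarrow> 'a"
    unfolding rel_pos_def using adj_mat(1)[OF last_block_carrier[of q K x j]] ab
    by (subst index_smult_mat(1)) auto
  ultimately show ?thesis by simp
qed

section \<open>Normal form of tuples in general position\<close>

definition standard_pos :: "nat \<Rightarrow> nat \<Rightarrow> 'a::field mat \<Rightarrow> (nat \<Rightarrow> 'a mat) \<Rightarrow> nat \<Rightarrow> 'a mat" where
  "standard_pos q K X F j =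
     (if j < q then X * block_inj q K j * F j else X * diag_inj q K * F j)"

lemma standard_pos_carrier:
  "X \<in> carrier_mat n (q * K) \<Longrightarrow> F j \<in> carrier_mat K K \<Longrightarrow> standard_pos q K X F j \<in> carrier_mat n K"
  unfolding standard_pos_def
  using mult_carrier_mat[OF mult_carrier_mat[of X n "q * K"], of _ K "F j" K] by auto

lemma standard_pos_mult_left:
  fixes X :: "'a::field mat"
  assumes g: "g \<in> carrier_mat n n" and X: "X \<in> carrier_mat n (q * K)" and F: "F j \<in> carrier_mat K K"
  shows "standard_pos q K (g * X) F j = g * standard_pos q K X F j"
proof -
  have "g * X * B * F j = g * (X * B * F j)" if B: "B \<in> carrier_mat (q * K) K" for B
  proof -
    have "g * X * B * F j = g * (X * B) * F j" unfolding assoc_mult_mat[OF g X B] ..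
    also have "\<dots> = g * (X * B * F j)" by (rule assoc_mult_mat[OF g mult_carrier_mat[OF X B] F])
    finally show ?thesis .
  qed
  then show ?thesis by (simp add: standard_pos_def)
qed

lemma standard_pos_mult_right:
  fixes X :: "'a::field mat"
  assumes X: "X \<in> carrier_mat n (q * K)" and F: "F j \<in> carrier_mat K K" and b: "b j \<in> carrier_mat K K"
  shows "standard_pos q K X (\<lambda>j. F j * b j) j = standard_pos q K X F j * b j"
proof -
  have "X * B * (F j * b j) = X * B * F j * b j" if B: "B \<in> carrier_mat (q * K) K" for B
    by (rule assoc_mult_mat[OF mult_carrier_mat[OF X B] F b, symmetric])
  then show ?thesis by (simp add: standard_pos_def)
qed

text \<open>The freedom left in the normal form: a common matrix h can be moved from the space to
  the bases \<open>F\<close>. So the diagonal copy of GL(K) in the large group becomes one left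
  factor on all small matrices.\<close>

lemma standard_pos_block_diag:
  fixes X :: "'a::field mat"
  assumes X: "X \<in> carrier_mat n (q * K)" and F: "F j \<in> carrier_mat K K" and h: "h \<in> carrier_mat K K"
  shows "standard_pos q K (X * block_diag q K (\<lambda>_. h)) F j = standard_pos q K X (\<lambda>j. h * F j) j"
proof -
  have eq: "X * block_diag q K (\<lambda>_. h) * B * F j = X * B * (h * F j)"
    if B: "B \<in> carrier_mat (q * K) K" and swap: "block_diag q K (\<lambda>_. h) * B = B * h" for B
  proof -
    have "X * block_diag q K (\<lambda>_. h) * B * F j = X * (B * h) * F j"
      unfolding assoc_mult_mat[OF X block_carriers(4) B] swap ..
    also have "\<dots> = X * B * h * F j" unfolding assoc_mult_mat[OF X B h] ..
    also have "\<dots> = X * B * (h * F j)" by (rule assoc_mult_mat[OF mult_carrier_mat[OF X B] h F])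
    finally show ?thesis .
  qed
  show ?thesis
    unfolding standard_pos_def
    using eq[OF block_carriers(2) block_diag_mult_block_inj[of q "\<lambda>_. h" K j, OF h]]
      eq[OF block_carriers(3) block_diag_const_mult_diag_inj[OF h]] by simp
qed

text \<open>\<open>X\<close> has to carry the summands to the first q subspaces and the diagonal to
  the last one. \<open>G\<close> does the former; composing it with the blocks of \<open>Z\<close>
  keeps this, by \<open>block_diag_mult_block_inj\<close>, and moves the diagonal as required.
  \<open>F\<close> undoes the resulting changes of basis.\<close>

lemma standard_posE:
  fixes x :: "nat \<times> nat \<times> nat \<Rightarrow> 'a::field"
  assumes pos: "gen_pos q K x \<noteq> 0"
  obtains X F where "X \<in> carrier_mat (q * K) (q * K)" "det X \<noteq> 0"
    "\<And>j. F j \<in> carrier_mat K K" "\<And>j. det (F j) \<noteq> 0"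
    "\<And>j. j \<le> q \<Longrightarrow> mats (q * K) K x j = standard_pos q K X F j"
proof -
  let ?N = "q * K"
  define G where "G = stack q K x"
  define Z where "Z = adj_mat G * mats ?N K x q"
  have G: "G \<in> carrier_mat ?N ?N" by (simp add: G_def)
  have adj: "adj_mat G \<in> carrier_mat ?N ?N" using adj_mat(1)[OF G] .
  have Z: "Z \<in> carrier_mat ?N K" unfolding Z_def by (rule mult_carrier_mat[OF adj mats_carrier])
  have dG: "det G \<noteq> 0" using gen_pos_nonzero(1)[OF pos] by (simp add: G_def)
  have dZ: "det (row_block K j Z) \<noteq> 0" if "j < q" for j
    using gen_pos_nonzero(2)[OF pos that] by (simp add: last_block_def Z_def G_def)
  have GZ: "G * Z = det G \<cdot>\<^sub>m mats ?N K x q"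
  proof -
    have "G * Z = det G \<cdot>\<^sub>m 1\<^sub>m ?N * mats ?N K x q"
      unfolding Z_def assoc_mult_mat[OF G adj mats_carrier, symmetric] adj_mat(2)[OF G] ..
    also have "\<dots> = det G \<cdot>\<^sub>m (1\<^sub>m ?N * mats ?N K x q)"
      by (rule mult_smult_assoc_mat[OF one_carrier_mat mats_carrier])
    finally show ?thesis unfolding left_mult_one_mat[OF mats_carrier] .
  qed
  have "\<exists>U. U \<in> carrier_mat K K \<and> det U \<noteq> 0 \<and> row_block K j Z * U = 1\<^sub>m K" if "j < q" for j
    using det_nonzero_inverse[OF block_carriers(1) dZ[OF that]] by metis
  then obtain U where U: "\<And>j. j < q \<Longrightarrow> U j \<in> carrier_mat K K" "\<And>j. j < q \<Longrightarrow> det (U j) \<noteq> 0"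
    "\<And>j. j < q \<Longrightarrow> row_block K j Z * U j = 1\<^sub>m K" by metis
  define X where "X = G * block_diag q K (\<lambda>j. row_block K j Z)"
  \<comment> \<open>For j = q the scalar cancels the factor \<open>det G\<close> that the adjugate
    has left in \<open>Z\<close>; the others invert the blocks put into \<open>X\<close>.\<close>
  define F where "F j = (if j < q then U j else inverse (det G) \<cdot>\<^sub>m 1\<^sub>m K)" for j
  show ?thesis
  proof (rule that)
    show "X \<in> carrier_mat ?N ?N" unfolding X_def by (rule mult_carrier_mat[OF G block_carriers(4)])
    show "det X \<noteq> 0"
      unfolding X_def det_mult[OF G block_carriers(4)]
      using dG det_block_diag[of q "\<lambda>j. row_block K j Z" K, OF block_carriers(1) dZ] by simp
    show F: "F j \<in> carrier_mat K K" for j using U(1) by (simp add: F_def)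
    show "det (F j) \<noteq> 0" for j using U(2) dG by (simp add: F_def det_smult)
    fix j assume "j \<le> q"
    show "mats ?N K x j = standard_pos q K X F j"
    proof (cases "j < q")
      case True
      have "X * block_inj q K j = G * (block_inj q K j * row_block K j Z)"
        unfolding X_def assoc_mult_mat[OF G block_carriers(4,2)]
          block_diag_mult_block_inj[of q "\<lambda>j. row_block K j Z" K j, OF block_carriers(1) True] ..
      also have "\<dots> = mats ?N K x j * row_block K j Z"
        unfolding assoc_mult_mat[OF G block_carriers(2,1), symmetric]
        unfolding G_def stack_def block_row_mult_block_inj[of "mats ?N K x" j, OF mats_carrier True] ..
      finally have "standard_pos q K X F j = mats ?N K x j * row_block K j Z * U j"
        using True by (simp add: standard_pos_def F_def)
      also have "\<dots> = mats ?N K x j"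
        unfolding assoc_mult_mat[OF mats_carrier block_carriers(1) U(1)[OF True]] U(3)[OF True]
        by (rule right_mult_one_mat[OF mats_carrier])
      finally show ?thesis ..
    next
      case False
      with \<open>j \<le> q\<close> have j: "j = q" by simp
      have "X * diag_inj q K = det G \<cdot>\<^sub>m mats ?N K x q"
        unfolding X_def assoc_mult_mat[OF G block_carriers(4,3)] block_diag_mult_diag_inj[OF Z] GZ ..
      then have "standard_pos q K X F j
          = det G \<cdot>\<^sub>m mats ?N K x q * (inverse (det G) \<cdot>\<^sub>m 1\<^sub>m K)"
        by (simp add: standard_pos_def F_def j)
      also have "\<dots> = inverse (det G) \<cdot>\<^sub>m (det G \<cdot>\<^sub>m mats ?N K x q)"
        unfolding mult_smult_distrib[OF smult_carrier_mat[OF mats_carrier] one_carrier_mat]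
          right_mult_one_mat[OF smult_carrier_mat[OF mats_carrier]] ..
      also have "\<dots> = mats ?N K x q" using dG by (intro eq_matI) auto
      finally show ?thesis by (simp add: j)
    qed
  qed
qed

text \<open>Converse of the normal form. Let Y be the last matrix written in the basis
  \<open>G\<close>. In X diag(F_0, ..., F_(q-1)) Y = X D F_q, with D the diagonal embedding, the
  invertible \<open>X\<close> cancels and leaves F_j Y_j = F_q in each block. Hence
  \<open>rel_pos\<close>, the inverse of Y_j, depends on \<open>F\<close> alone.\<close>

lemma standard_pos_rel_pos:
  fixes x :: "nat \<times> nat \<times> nat \<Rightarrow> 'a::field"
  assumes X: "X \<in> carrier_mat (q * K) (q * K)" "det X \<noteq> 0"
    and F: "\<And>j. j \<le> q \<Longrightarrow> F j \<in> carrier_mat K K" "\<And>j. j \<le> q \<Longrightarrow> det (F j) \<noteq> 0"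
    and x: "\<And>j. j \<le> q \<Longrightarrow> mats (q * K) K x j = standard_pos q K X F j"
  shows "gen_pos q K x \<noteq> 0" "j < q \<Longrightarrow> F q * rel_pos q K x j = F j"
proof -
  let ?N = "q * K"
  define G where "G = stack q K x"
  have G: "G \<in> carrier_mat ?N ?N" by (simp add: G_def)
  have adj: "adj_mat G \<in> carrier_mat ?N ?N" using adj_mat(1)[OF G] .
  have "G = X * block_diag q K F"
  proof (rule mult_block_inj_eqI[OF G])
    show "X * block_diag q K F \<in> carrier_mat ?N ?N" by (rule mult_carrier_mat[OF X(1) block_carriers(4)])
    fix j assume j: "j < q"
    have Fc: "\<And>j. j < q \<Longrightarrow> F j \<in> carrier_mat K K" using F(1) by simp
    have bdF: "block_diag q K F * block_inj q K j = block_inj q K j * F j"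
      using Fc j by (rule block_diag_mult_block_inj)
    have "G * block_inj q K j = X * block_inj q K j * F j"
      using block_row_mult_block_inj[of "mats ?N K x" j, OF mats_carrier j] x[of j] j
      by (simp add: G_def stack_def standard_pos_def)
    also have "\<dots> = X * (block_diag q K F * block_inj q K j)"
      unfolding bdF by (rule assoc_mult_mat[OF X(1) block_carriers(2) Fc[OF j]])
    also have "\<dots> = X * block_diag q K F * block_inj q K j"
      by (rule assoc_mult_mat[OF X(1) block_carriers(4,2), symmetric])
    finally show "G * block_inj q K j = X * block_diag q K F * block_inj q K j" .
  qed
  then have dG: "det G \<noteq> 0"
    using X(2) det_block_diag[of q F K] F det_mult[OF X(1) block_carriers(4), of F] by simp
  obtain h where h: "h \<in> carrier_mat ?N ?N" "G * h = 1\<^sub>m ?N" using det_nonzero_inverse[OF G dG] by metis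
  define Y where "Y = h * mats ?N K x q"
  have Y: "Y \<in> carrier_mat ?N K" unfolding Y_def by (rule mult_carrier_mat[OF h(1) mats_carrier])
  have GY: "G * Y = mats ?N K x q"
    unfolding Y_def assoc_mult_mat[OF G h(1) mats_carrier, symmetric] h(2)
    by (rule left_mult_one_mat[OF mats_carrier])
  have "X * (block_diag q K F * Y) = X * (diag_inj q K * F q)"
  proof -
    have "X * (block_diag q K F * Y) = mats ?N K x q"
      unfolding GY[symmetric] \<open>G = X * block_diag q K F\<close>
      by (rule assoc_mult_mat[OF X(1) block_carriers(4) Y, symmetric])
    also have "\<dots> = X * diag_inj q K * F q" using x[of q] by (simp add: standard_pos_def)
    also have "\<dots> = X * (diag_inj q K * F q)"
      by (rule assoc_mult_mat[OF X(1) block_carriers(3) F(1)]) simp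
    finally show ?thesis .
  qed
  then have bdY: "block_diag q K F * Y = diag_inj q K * F q"
    using F(1)[of q] by (intro mult_mat_cancel_left[OF X mult_carrier_mat[OF block_carriers(4) Y]
          mult_carrier_mat[OF block_carriers(3)]]) auto
  have FY: "F j * row_block K j Y = F q" if j: "j < q" for j
  proof -
    have Fj: "F j \<in> carrier_mat K K" "F q \<in> carrier_mat K K" using F(1) j by auto
    have "F j * row_block K j Y = row_block K j (diag_inj q K * F q)"
      unfolding bdY[symmetric] by (rule row_block_block_diag_mult[of F j, OF Fj(1) Y j, symmetric])
    also have "\<dots> = 1\<^sub>m K * F q"
      unfolding row_block_mult[OF block_carriers(3) Fj(2) j] row_block_diag_inj[OF j] ..
    finally show ?thesis unfolding left_mult_one_mat[OF Fj(2)] .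
  qed
  have last: "last_block q K x j = det G \<cdot>\<^sub>m row_block K j Y" if j: "j < q" for j
  proof -
    have "adj_mat G * mats ?N K x q = adj_mat G * G * Y"
      unfolding GY[symmetric] by (rule assoc_mult_mat[OF adj G Y, symmetric])
    also have "\<dots> = det G \<cdot>\<^sub>m (1\<^sub>m ?N * Y)"
      unfolding adj_mat(3)[OF G] by (rule mult_smult_assoc_mat[OF one_carrier_mat Y])
    finally show ?thesis
      unfolding last_block_def G_def[symmetric] left_mult_one_mat[OF Y] by (simp add: row_block_smult[OF Y j])
  qed
  have dlast: "det (last_block q K x j) \<noteq> 0" if j: "j < q" for j
  proof -
    have "det (F j) * det (row_block K j Y) = det (F q)"
      using FY[OF j] det_mult[OF F(1)[of j] block_carriers(1), of j Y] j by simp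
    then have "det (row_block K j Y) \<noteq> 0" using F(2)[of q] by auto
    then show ?thesis using last[OF j] dG by (simp add: det_smult)
  qed
  then show "gen_pos q K x \<noteq> 0" using dG by (simp add: gen_pos_def G_def)
  show "F q * rel_pos q K x j = F j" if j: "j < q"
  proof -
    let ?L = "last_block q K x j" and ?R = "rel_pos q K x j" and ?Y = "row_block K j Y"
    have aL: "adj_mat ?L \<in> carrier_mat K K" by (rule adj_mat(1)[OF last_block_carrier])
    have "?L * ?R = (det G / det ?L) \<cdot>\<^sub>m (?L * adj_mat ?L)"
      unfolding rel_pos_def G_def[symmetric] by (rule mult_smult_distrib[OF last_block_carrier aL])
    also have "\<dots> = det G \<cdot>\<^sub>m 1\<^sub>m K"
      unfolding adj_mat(2)[OF last_block_carrier] using dlast[OF j] by (intro eq_matI) auto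
    finally have "det G \<cdot>\<^sub>m (?Y * ?R) = det G \<cdot>\<^sub>m 1\<^sub>m K"
      unfolding last[OF j] mult_smult_assoc_mat[OF block_carriers(1) rel_pos_carrier] .
    then have "inverse (det G) \<cdot>\<^sub>m (det G \<cdot>\<^sub>m (?Y * ?R)) = inverse (det G) \<cdot>\<^sub>m (det G \<cdot>\<^sub>m 1\<^sub>m K)" by simp
    moreover have "inverse (det G) \<cdot>\<^sub>m (det G \<cdot>\<^sub>m M) = M" for M :: "'a mat"
      using dG by (intro eq_matI) auto
    ultimately have YR: "?Y * ?R = 1\<^sub>m K" by simp
    have Fj: "F j \<in> carrier_mat K K" using F(1) j by simp
    have "F q * ?R = F j * ?Y * ?R" using FY[OF j] by simp
    also have "\<dots> = F j * 1\<^sub>m K"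
      unfolding assoc_mult_mat[OF Fj block_carriers(1) rel_pos_carrier] YR ..
    finally show ?thesis unfolding right_mult_one_mat[OF Fj] .
  qed
qed

text \<open>With \<open>X\<close> fixed, normal forms depend linearly on \<open>F\<close>. For a
  given \<open>x\<close> in general position this yields a polynomial map from tuples of K x K
  matrices that hits \<open>x\<close> and turns the action of h into that of X diag(h, ..., h); so
  it carries the small orbit into the large one.\<close>

lemma dense_mat_orbit_blow_up:
  fixes P :: "'a::alg_closed_field mat set"
  assumes P: "P \<subseteq> {b \<in> carrier_mat K K. det b \<noteq> 0}"
    and dense: "dense_mat_orbit (Suc q) K K P"
  shows "dense_mat_orbit (Suc q) (q * K) K P"
proof -
  let ?N = "q * K"
  obtain C :: "nat \<Rightarrow> 'a mat" where C: "\<And>j. j < Suc q \<Longrightarrow> C j \<in> carrier_mat K K"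
    and dense: "poly_dense (mat_orbit (Suc q) K K P C)"
    using dense unfolding dense_mat_orbit_def by blast
  \<comment> \<open>The small tuple \<open>C\<close>, placed in the coordinate summands and the
    diagonal.\<close>
  define A where "A = standard_pos q K (1\<^sub>m ?N) C"
  have "poly_dense (mat_orbit (Suc q) ?N K P A)"
    unfolding poly_dense_def
  proof (intro ballI impI allI)
    fix f :: "(nat \<times> nat \<times> nat \<Rightarrow> 'a) \<Rightarrow> 'a" and x
    assume f: "f \<in> polynomial_functions" and f0: "\<forall>x\<in>mat_orbit (Suc q) ?N K P A. f x = 0"
    have f_zero: "f x = 0" if pos: "gen_pos q K x \<noteq> 0" for x
    proof -
      obtain X F where X: "X \<in> carrier_mat ?N ?N" "det X \<noteq> 0"
        and F: "\<And>j. F j \<in> carrier_mat K K"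
        and x: "\<And>j. j \<le> q \<Longrightarrow> mats ?N K x j = standard_pos q K X F j"
        using standard_posE[OF pos] by metis
      define \<psi> where "\<psi> e = (\<lambda>(j, a, b). if j < Suc q \<and> a < ?N \<and> b < K
        then standard_pos q K X (mats K K e) j $$ (a, b) else x (j, a, b))" for e
      have mats_\<psi>: "mats ?N K (\<psi> e) j = standard_pos q K X (mats K K e) j" if "j < Suc q" for e j
        unfolding \<psi>_def
        by (rule mats_override[of j "Suc q" "standard_pos q K X (mats K K e)"])
          (use that standard_pos_carrier[OF X(1), of "mats K K e" j] in auto)
      have "f (\<psi> (\<lambda>(j, ab). F j $$ ab)) = 0"
      proof (rule poly_denseD[OF dense, of "\<lambda>e. f (\<psi> e)"])
        show "(\<lambda>e. f (\<psi> e)) \<in> polynomial_functions"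
        proof (rule polynomial.polynomial_comp[of f \<psi>, OF f])
          fix t :: "nat \<times> nat \<times> nat"
          obtain j a b where t: "t = (j, a, b)" by (cases t)
          show "(\<lambda>e. \<psi> e t) \<in> polynomial_functions"
          proof (cases "j < Suc q \<and> a < ?N \<and> b < K")
            case True
            have "(\<lambda>e. standard_pos q K X (mats K K e) j $$ (a, b)) \<in> polynomial_functions"
            proof -
              have mult: "(\<lambda>e. (X * B * mats K K e j) $$ (a, b)) \<in> polynomial_functions"
                if "B \<in> carrier_mat ?N K" for B
                by (rule polynomial.mat_mult[where M = "\<lambda>_. X * B" and N = "\<lambda>e. mats K K e j"
                      and n = ?N and l = K and k = K])
                  (use that X(1) True in \<open>auto intro: polynomial_functions.intros\<close>)
              show ?thesis
                using mult[OF block_carriers(2)] mult[OF block_carriers(3)]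
                by (cases "j < q") (simp_all add: standard_pos_def)
            qed
            with True show ?thesis by (simp add: t \<psi>_def)
          next
            case False
            then show ?thesis unfolding t \<psi>_def by (auto intro: polynomial_functions.const)
          qed
        qed
        fix e assume "e \<in> mat_orbit (Suc q) K K P C"
        then obtain h b where h: "h \<in> carrier_mat K K" "det h \<noteq> 0"
          and b: "\<And>j. j < Suc q \<Longrightarrow> b j \<in> P" "\<And>j. j < Suc q \<Longrightarrow> mats K K e j = h * C j * b j"
          unfolding mat_orbit_def by blast
        \<comment> \<open>The group element behind \<open>\<psi> e\<close>: h acts on all summands
          alike, then \<open>X\<close> moves the standard position.\<close>
        define g where "g = X * block_diag q K (\<lambda>_. h)"
        have g: "g \<in> carrier_mat ?N ?N" unfolding g_def by (rule mult_carrier_mat[OF X(1) block_carriers(4)])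
        have "det g \<noteq> 0"
          unfolding g_def det_mult[OF X(1) block_carriers(4)]
          using X(2) det_block_diag[of q "\<lambda>_. h" K] h by simp
        moreover have "b j \<in> P \<and> mats ?N K (\<psi> e) j = g * A j * b j" if j: "j < Suc q" for j
        proof
          show "b j \<in> P" using b(1)[OF j] .
          have bc: "b j \<in> carrier_mat K K" using b(1)[OF j] P by auto
          have hC: "h * C j \<in> carrier_mat K K" using h(1) C[OF j] by simp
          have "mats ?N K (\<psi> e) j = standard_pos q K X (\<lambda>j. h * C j * b j) j"
            unfolding mats_\<psi>[OF j] by (simp add: standard_pos_def b(2)[OF j])
          also have "\<dots> = standard_pos q K X (\<lambda>j. h * C j) j * b j"
            by (rule standard_pos_mult_right[where F = "\<lambda>j. h * C j" and j = j and b = b, OF X(1) hC bc])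
          also have "standard_pos q K X (\<lambda>j. h * C j) j = standard_pos q K g C j"
            unfolding g_def by (rule standard_pos_block_diag[where F = C and j = j, OF X(1) C[OF j] h(1), symmetric])
          also have "\<dots> = g * A j"
            using standard_pos_mult_left[where F = C and j = j, OF g one_carrier_mat C[OF j]] right_mult_one_mat[OF g]
            by (simp add: A_def)
          finally show "mats ?N K (\<psi> e) j = g * A j * b j" .
        qed
        ultimately have "\<psi> e \<in> mat_orbit (Suc q) ?N K P A"
          unfolding mat_orbit_def using g by (intro CollectI bexI[of _ g] conjI exI[of _ b]) auto
        then show "f (\<psi> e) = 0" using f0 by blast
      qed
      moreover have "\<psi> (\<lambda>(j, ab). F j $$ ab) = x"
      proof -
        have "standard_pos q K X (mats K K (\<lambda>(j, ab). F j $$ ab)) j = mats ?N K x j" if "j < Suc q" for j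
          using x[of j] that mats_entries[OF F] by (simp add: standard_pos_def)
        then show ?thesis by (auto simp: \<psi>_def fun_eq_iff)
      qed
      ultimately show "f x = 0" by simp
    qed
    have fd: "f x * gen_pos q K x = 0" for x
    proof (cases "gen_pos q K x = 0")
      case False
      then have "f x = 0" by (rule f_zero)
      then show ?thesis by simp
    qed simp
    \<comment> \<open>The standard position is itself in general position, so \<open>gen_pos\<close>
      is not the zero polynomial.\<close>
    let ?y = "\<lambda>(j, ab). standard_pos q K (1\<^sub>m ?N) (\<lambda>_. 1\<^sub>m K :: 'a mat) j $$ ab"
    have "gen_pos q K ?y \<noteq> 0"
      by (rule standard_pos_rel_pos(1)[where X = "1\<^sub>m ?N" and F = "\<lambda>_. 1\<^sub>m K"])
        (auto intro!: mats_entries standard_pos_carrier[OF one_carrier_mat])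
    then show "f x = 0"
      by (rule polynomial_functions_no_zero_divisors[where f = f and g = "gen_pos q K",
            OF f gen_pos_polynomial fd])
  qed
  moreover have "A j \<in> carrier_mat ?N K" if "j < Suc q" for j
    unfolding A_def by (rule standard_pos_carrier[where F = C and j = j, OF one_carrier_mat C[OF that]])
  ultimately show ?thesis
    unfolding dense_mat_orbit_def by (intro exI[of _ A] conjI) auto
qed

text \<open>The way back is a rational map: it reads off the relative positions of a tuple and
  normalises the last block to a prescribed \<open>E q\<close>. Fixing that block uses up the left
  action of GL(K), and the result lies in the small orbit because \<open>rel_pos\<close> sees only
  the bases in the normal form.\<close>

lemma dense_mat_orbit_blow_down:
  fixes P :: "'a::alg_closed_field mat set"
  assumes P: "P \<subseteq> {b \<in> carrier_mat K K. det b \<noteq> 0}"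
    and dense: "dense_mat_orbit (Suc q) (q * K) K P"
  shows "dense_mat_orbit (Suc q) K K P"
proof -
  let ?N = "q * K"
  obtain A :: "nat \<Rightarrow> 'a mat" where A: "\<And>j. j < Suc q \<Longrightarrow> A j \<in> carrier_mat ?N K"
    and dense: "poly_dense (mat_orbit (Suc q) ?N K P A)"
    using dense unfolding dense_mat_orbit_def by blast
  \<comment> \<open>Tuples with X = 1 serve both as witnesses for general position and as preimages
    under the rational map.\<close>
  have pos_standard: "gen_pos q K (\<lambda>(j, ab). standard_pos q K (1\<^sub>m ?N) F j $$ ab) \<noteq> 0"
    "j < q \<Longrightarrow> F q * rel_pos q K (\<lambda>(j, ab). standard_pos q K (1\<^sub>m ?N) F j $$ ab) j = F j"
    if F: "\<And>j. j \<le> q \<Longrightarrow> F j \<in> carrier_mat K K" "\<And>j. j \<le> q \<Longrightarrow> det (F j) \<noteq> 0"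
    for F :: "nat \<Rightarrow> 'a mat" and j
  proof -
    have *: "mats ?N K (\<lambda>(j, ab). standard_pos q K (1\<^sub>m ?N) F j $$ ab) j = standard_pos q K (1\<^sub>m ?N) F j"
      if "j \<le> q" for j
      by (rule mats_entries[where A = "standard_pos q K (1\<^sub>m ?N) F" and j = j,
            OF standard_pos_carrier[where F = F and j = j, OF one_carrier_mat F(1)[OF that]]])
    show "gen_pos q K (\<lambda>(j, ab). standard_pos q K (1\<^sub>m ?N) F j $$ ab) \<noteq> 0"
      by (rule standard_pos_rel_pos(1)[where X = "1\<^sub>m ?N" and F = F]) (use F * in auto)
    show "j < q \<Longrightarrow> F q * rel_pos q K (\<lambda>(j, ab). standard_pos q K (1\<^sub>m ?N) F j $$ ab) j = F j"
      by (rule standard_pos_rel_pos(2)[where X = "1\<^sub>m ?N" and F = F]) (use F * in auto)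
  qed
  have "gen_pos q K (\<lambda>(j, ab). standard_pos q K (1\<^sub>m ?N) (\<lambda>_. 1\<^sub>m K :: 'a mat) j $$ ab) \<noteq> 0"
    by (rule pos_standard(1)) auto
  \<comment> \<open>A dense orbit contains a tuple in general position. Undoing g and the
    \<open>b j\<close> turns its normal form into one of \<open>A\<close>, whose bases are the small
    tuple \<open>C\<close>.\<close>
  then obtain x where x: "x \<in> mat_orbit (Suc q) ?N K P A" "gen_pos q K x \<noteq> 0"
    by (rule poly_dense_nonzero[OF dense gen_pos_polynomial])
  obtain g b where g: "g \<in> carrier_mat ?N ?N" "det g \<noteq> 0"
    and b: "\<And>j. j < Suc q \<Longrightarrow> b j \<in> P" "\<And>j. j < Suc q \<Longrightarrow> mats ?N K x j = g * A j * b j"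
    using x(1) unfolding mat_orbit_def by blast
  obtain X0 F where X0: "X0 \<in> carrier_mat ?N ?N" "det X0 \<noteq> 0"
    and F: "\<And>j. F j \<in> carrier_mat K K" "\<And>j. det (F j) \<noteq> 0"
    and xF: "\<And>j. j \<le> q \<Longrightarrow> mats ?N K x j = standard_pos q K X0 F j"
    using standard_posE[OF x(2)] by metis
  have bc: "b j \<in> carrier_mat K K" "det (b j) \<noteq> 0" if "j < Suc q" for j
    using b(1)[OF that] P by auto
  have "\<exists>c. c \<in> carrier_mat K K \<and> det c \<noteq> 0 \<and> b j * c = 1\<^sub>m K" if "j < Suc q" for j
    using det_nonzero_inverse[OF bc[OF that]] by metis
  then obtain c where c: "\<And>j. j < Suc q \<Longrightarrow> c j \<in> carrier_mat K K" "\<And>j. j < Suc q \<Longrightarrow> det (c j) \<noteq> 0"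
    "\<And>j. j < Suc q \<Longrightarrow> b j * c j = 1\<^sub>m K" by metis
  obtain h where h: "h \<in> carrier_mat ?N ?N" "det h \<noteq> 0" "h * g = 1\<^sub>m ?N"
    using det_nonzero_inverse[OF g] by metis
  define X where "X = h * X0"
  define C where "C j = F j * c j" for j
  have X: "X \<in> carrier_mat ?N ?N" "det X \<noteq> 0"
    using h X0 by (auto simp: X_def det_mult[OF h(1) X0(1)])
  have C: "C j \<in> carrier_mat K K" "det (C j) \<noteq> 0" if "j < Suc q" for j
    using F(1)[of j] F(2)[of j] c(1,2)[OF that] by (auto simp: C_def det_mult[OF F(1) c(1)[OF that]])
  have AX: "A j = standard_pos q K X C j" if j: "j < Suc q" for j
  proof -
    have gA: "g * A j \<in> carrier_mat ?N K" by (rule mult_carrier_mat[OF g(1) A[OF j]])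
    have "standard_pos q K X C j = h * standard_pos q K X0 (\<lambda>j. F j * c j) j"
      using standard_pos_mult_left[where F = C and j = j, OF h(1) X0(1) C(1)[OF j]] by (simp add: X_def C_def[abs_def])
    also have "standard_pos q K X0 (\<lambda>j. F j * c j) j = standard_pos q K X0 F j * c j"
      by (rule standard_pos_mult_right[where F = F and j = j and b = c, OF X0(1) F(1) c(1)[OF j]])
    also have "\<dots> = g * A j * b j * c j" using xF[of j] b(2)[OF j] j by simp
    also have "\<dots> = g * A j"
      unfolding assoc_mult_mat[OF gA bc(1)[OF j] c(1)[OF j]] c(3)[OF j] by (rule right_mult_one_mat[OF gA])
    also have "h * (g * A j) = A j"
      unfolding assoc_mult_mat[OF h(1) g(1) A[OF j], symmetric] h(3) by (rule left_mult_one_mat[OF A[OF j]])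
    finally show ?thesis ..
  qed
  have "poly_dense (mat_orbit (Suc q) K K P C)"
    unfolding poly_dense_def
  proof (intro ballI impI allI)
    fix f :: "(nat \<times> nat \<times> nat \<Rightarrow> 'a) \<Rightarrow> 'a" and e
    assume f: "f \<in> polynomial_functions" and f0: "\<forall>x\<in>mat_orbit (Suc q) K K P C. f x = 0"
    define d where "d e = (\<Prod>j\<le>q. det (mats K K e j))" for e :: "nat \<times> nat \<times> nat \<Rightarrow> 'a"
    have d: "d \<in> polynomial_functions"
      unfolding d_def
      by (intro polynomial.prod polynomial.det[of _ K]) (auto intro: polynomial_functions.coord)
    have f_zero: "f e = 0" if de: "d e \<noteq> 0" for e
    proof -
      define E where "E = mats K K e"
      have E: "E j \<in> carrier_mat K K" for j by (simp add: E_def)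
      have dE: "det (E j) \<noteq> 0" if "j \<le> q" for j using de that by (auto simp: d_def E_def)
      define R where "R y j = (if j < q then E q * rel_pos q K y j else E q)" for y j
      have R: "R y j \<in> carrier_mat K K" for y j
        using E[of q] mult_carrier_mat[OF E rel_pos_carrier] by (simp add: R_def)
      define \<phi> where "\<phi> y = (\<lambda>(j, a, b). if j < Suc q \<and> a < K \<and> b < K
        then R y j $$ (a, b) else e (j, a, b))" for y
      \<comment> \<open>The preimage of \<open>e\<close>: here \<open>rel_pos\<close> is the inverse
        of \<open>E q\<close> times \<open>E j\<close>, so \<open>R\<close> returns
        \<open>E j\<close>.\<close>
      let ?y = "\<lambda>(j, ab). standard_pos q K (1\<^sub>m ?N) E j $$ ab"
      have "f (\<phi> ?y) = 0"
      proof (rule poly_dense_regular_eq_0[where \<phi> = "\<lambda>y. f (\<phi> y)", OF dense gen_pos_polynomial])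
        show "(\<lambda>y. f (\<phi> y)) \<in> regular_on {x. gen_pos q K x \<noteq> 0}"
        proof (rule regular.polynomial_comp[of f \<phi>, OF f])
          fix t :: "nat \<times> nat \<times> nat"
          obtain j a b where t: "t = (j, a, b)" by (cases t)
          show "(\<lambda>y. \<phi> y t) \<in> regular_on {x. gen_pos q K x \<noteq> 0}"
          proof (cases "j < q \<and> a < K \<and> b < K")
            case True
            have "(\<lambda>y. (E q * rel_pos q K y j) $$ (a, b)) \<in> regular_on {x. gen_pos q K x \<noteq> 0}"
              by (rule regular.mat_mult[where M = "\<lambda>_. E q" and N = "\<lambda>y. rel_pos q K y j"
                    and n = K and l = K and k = K])
                (use True E in \<open>auto intro: rel_pos_regular regular.const\<close>)
            with True show ?thesis by (simp add: t \<phi>_def R_def)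
          next
            case False
            then have "\<phi> y t = (if j < Suc q \<and> a < K \<and> b < K then E q $$ (a, b) else e (j, a, b))" for y
              by (auto simp: t \<phi>_def R_def)
            then show ?thesis by (simp add: regular.const)
          qed
        qed
        fix y assume y: "y \<in> mat_orbit (Suc q) ?N K P A" and "gen_pos q K y \<noteq> 0"
        obtain g b where g: "g \<in> carrier_mat ?N ?N" "det g \<noteq> 0"
          and b: "\<And>j. j < Suc q \<Longrightarrow> b j \<in> P" "\<And>j. j < Suc q \<Longrightarrow> mats ?N K y j = g * A j * b j"
          using y unfolding mat_orbit_def by blast
        have bc: "b j \<in> carrier_mat K K" "det (b j) \<noteq> 0" if "j < Suc q" for j
          using b(1)[OF that] P by auto
        define F where "F j = C j * b j" for j
        have F: "F j \<in> carrier_mat K K" "det (F j) \<noteq> 0" if "j \<le> q" for j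
          using C[of j] bc[of j] that by (auto simp: F_def det_mult[of _ K])
        have gX: "g * X \<in> carrier_mat ?N ?N" "det (g * X) \<noteq> 0"
          using g X by (auto simp: det_mult[OF g(1) X(1)])
        have yF: "mats ?N K y j = standard_pos q K (g * X) F j" if "j \<le> q" for j
        proof -
          have j: "j < Suc q" using that by simp
          have "mats ?N K y j = standard_pos q K (g * X) C j * b j"
            unfolding b(2)[OF j] AX[OF j] standard_pos_mult_left[where F = C and j = j, OF g(1) X(1) C(1)[OF j]] ..
          also have "\<dots> = standard_pos q K (g * X) F j"
            unfolding F_def by (rule standard_pos_mult_right[where F = C and j = j and b = b, OF gX(1) C(1)[OF j] bc(1)[OF j], symmetric])
          finally show ?thesis .
        qed
        have rel: "F q * rel_pos q K y j = F j" if "j < q" for j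
          using gX F yF that by (rule standard_pos_rel_pos(2))
        have Fq: "F q \<in> carrier_mat K K" "det (F q) \<noteq> 0" using F by auto
        obtain u where u: "u \<in> carrier_mat K K" "det u \<noteq> 0" "u * F q = 1\<^sub>m K"
          using det_nonzero_inverse[OF Fq] by metis
        \<comment> \<open>The element of GL(K) realising the normalisation: it takes
          \<open>F q\<close> to \<open>E q\<close>, hence every \<open>F j\<close> to
          \<open>R y j\<close>.\<close>
        define v where "v = E q * u"
        have v: "v \<in> carrier_mat K K" "det v \<noteq> 0"
          using u(2) dE[of q] mult_carrier_mat[OF E u(1)] by (auto simp: v_def det_mult[OF E u(1)])
        have vF: "v * F q = E q"
          unfolding v_def assoc_mult_mat[OF E u(1) Fq(1)] u(3) by (rule right_mult_one_mat[OF E])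
        have "mats K K (\<phi> y) j = v * C j * b j" if j: "j < Suc q" for j
        proof -
          have "mats K K (\<phi> y) j = R y j"
            unfolding \<phi>_def by (rule mats_override[of j "Suc q" "R y", OF j R])
          also have "R y j = v * F j"
          proof (cases "j < q")
            case True
            have "v * F j = v * F q * rel_pos q K y j"
              unfolding rel[OF True, symmetric] by (rule assoc_mult_mat[OF v(1) Fq(1) rel_pos_carrier, symmetric])
            then show ?thesis using True by (simp add: R_def vF)
          next
            case False
            with j have "j = q" by simp
            then show ?thesis by (simp add: R_def vF)
          qed
          also have "\<dots> = v * C j * b j"
            unfolding F_def by (rule assoc_mult_mat[OF v(1) C(1)[OF j] bc(1)[OF j], symmetric])
          finally show ?thesis .
        qed
        then have "\<phi> y \<in> mat_orbit (Suc q) K K P C"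
          unfolding mat_orbit_def using v b(1) by (intro CollectI bexI[of _ v] conjI exI[of _ b]) auto
        then show "f (\<phi> y) = 0" using f0 by blast
      next
        show "gen_pos q K ?y \<noteq> 0" using E dE by (rule pos_standard(1))
      qed
      moreover have "\<phi> ?y = e"
      proof -
        have "R ?y j = E j" if "j < Suc q" for j
          using pos_standard(2)[of E j] E dE that by (cases "j = q") (auto simp: R_def)
        then show ?thesis by (auto simp: \<phi>_def E_def fun_eq_iff)
      qed
      ultimately show "f e = 0" by simp
    qed
    have fd: "f e * d e = 0" for e
    proof (cases "d e = 0")
      case False
      then have "f e = 0" by (rule f_zero)
      then show ?thesis by simp
    qed simp
    have "d (\<lambda>(j, ab). (1\<^sub>m K :: 'a mat) $$ ab) \<noteq> 0"
      using mats_entries[of "\<lambda>_. 1\<^sub>m K :: 'a mat" _ K K] by (simp add: d_def)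
    then show "f e = 0"
      by (rule polynomial_functions_no_zero_divisors[where f = f and g = d, OF f d fd])
  qed
  with C(1) show ?thesis
    unfolding dense_mat_orbit_def by (intro exI[of _ C] conjI) auto
qed

theorem proposition3p2:
  fixes m r :: nat and k :: "nat \<Rightarrow> nat"
  assumes "m \<ge> 3" and "r \<ge> 1"
    and "0 < k 1" and "\<And>i. 1 \<le> i \<Longrightarrow> i < r \<Longrightarrow> k i < k (i + 1)"
  shows "dense_PGL_action TYPE('a::alg_closed_field) m (map k [1..<r + 1]) ((m - 1) * k r)
     \<longleftrightarrow> dense_PGL_action TYPE('a) m (map k [1..<r]) (k r)"
proof -
  \<comment> \<open>The last of the m matrices has index q, and the first q fill a space of
    dimension q k_r.\<close>
  define q where "q = m - 1"
  have q: "m = Suc q" "q \<ge> 1" using assms(1) by (auto simp: q_def)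
  have mono: "k i \<le> k j" if "1 \<le> i" "i \<le> j" "j \<le> r" for i j
    using that(2,1,3)
  proof (induction j rule: dec_induct)
    case (step j)
    then show ?case using assms(4)[of j] by simp
  qed simp
  have pos: "0 < k i" if "1 \<le> i" "i \<le> r" for i
    using mono[of 1 i] that assms(3) by simp
  have big: "flag_shape (map k [1..<r + 1]) (q * k r) (k r)"
  proof
    show "sorted (map k [1..<r + 1])"
      unfolding sorted_iff_nth_mono_less by (auto intro!: mono simp del: upt_Suc)
    show "k r = q * k r \<or> k r \<in> set (map k [1..<r + 1])" using assms(2) by auto
  qed (use mono pos q(2) in auto)
  have small: "flag_shape (map k [1..<r]) (k r) (k r)"
  proof
    show "sorted (map k [1..<r])"
      unfolding sorted_iff_nth_mono_less by (auto intro!: mono)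
  qed (use mono pos in auto)
  \<comment> \<open>For the dimension k_r itself the vanishing condition is void, since no row index
    of a k_r x k_r matrix reaches k_r; so the flags with and without that subspace have the same
    parabolic group.\<close>
  have par: "parabolic (map k [1..<r + 1]) (k r) = (parabolic (map k [1..<r]) (k r) :: 'a mat set)"
    using assms(2) by (auto simp: parabolic_def)
  have GL: "parabolic (map k [1..<r]) (k r) \<subseteq> {b \<in> carrier_mat (k r) (k r). det b \<noteq> (0 :: 'a)}"
    by (auto simp: parabolic_def)
  have "dense_PGL_action TYPE('a) m (map k [1..<r + 1]) ((m - 1) * k r)
      \<longleftrightarrow> dense_mat_orbit (Suc q) (q * k r) (k r) (parabolic (map k [1..<r]) (k r) :: 'a mat set)"
    using flag_shape.dense_PGL_action_iff[OF big, where 'a = 'a and m = m] unfolding par by (simp add: q(1))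
  also have "\<dots> \<longleftrightarrow> dense_mat_orbit (Suc q) (k r) (k r) (parabolic (map k [1..<r]) (k r) :: 'a mat set)"
    using dense_mat_orbit_blow_up[OF GL] dense_mat_orbit_blow_down[OF GL] by blast
  also have "\<dots> \<longleftrightarrow> dense_PGL_action TYPE('a) m (map k [1..<r]) (k r)"
    using flag_shape.dense_PGL_action_iff[OF small, where 'a = 'a and m = m] by (simp add: q(1))
  finally show ?thesis .
qed

end
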